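(* Let $G$ be a discrete group with an almost normal subgroup $\Gamma$, and assume $G$ admits a unitary representation $\pi$ on $\ell^2(\Gamma)$ extending the left regular representation of $\Gamma$. For $\theta\in G$ let $t(\theta)=\langle\pi(\theta)e,e\rangle$, where $e\in\ell^2(\Gamma)$ is the delta function at the identity. For a double coset $\alpha=[\Gamma\sigma\Gamma]$ put $t^\alpha=\sum_{\theta\in\alpha}t(\theta)\theta$. Then $t^\alpha\in\ell^2(\Gamma\sigma\Gamma)\subseteq\ell^2(G)$, and the linear map $\alpha\mapsto t^\alpha$ on $\mathcal H_0(\Gamma\backslash G/\Gamma)$ extends to a unital normal injective $*$-homomorphism $\rho$ from the reduced Hecke von Neumann algebra $\mathcal H$ into $\mathcal L(G)$, under which the restriction of $\tau_{\mathcal L(G)}$ corresponds to the state $x\mapsto\langle x[\Gamma],[\Gamma]\rangle$. Moreover, for a coset $c=\Gamma s$ put $t^c=\sum_{\theta\in\Gamma s}t(\theta)\theta$; then $t^c\in\ell^2(\Gamma s)$, the family $(t^c)$, $c$ ranging over the cosets $\Gamma s$, is orthonormal and spans a closed subspace $K\subseteq\ell^2(G)$ which reduces $\rho$, and the restriction of $\rho$ to $K$ is unitarily equivalent to the left regular representation $\lambda_{\Gamma\backslash G}$ of the Hecke algebra on $\ell^2(\Gamma\backslash G)$, via the unitary mapping $t^c$ to $c$.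
   Context: $\Gamma\subseteq G$ is almost normal: $[\Gamma:\Gamma\cap\sigma\Gamma\sigma^{-1}]<\infty$ for all $\sigma\in G$. $\mathcal L(G)$ is the group von Neumann algebra (left convolvers on $\ell^2(G)$) with trace $\tau_{\mathcal L(G)}$; elements are identified with vectors of $\ell^2(G)$. The Hecke algebra $\mathcal H_0(\Gamma\backslash G/\Gamma)$ is the vector space with basis the double cosets $[\Gamma\sigma\Gamma]$, product $[\Gamma\sigma_1\Gamma][\Gamma\sigma_2\Gamma]=\sum c(\sigma_1,\sigma_2,z)[\Gamma z\Gamma]$ over double cosets in $\Gamma\sigma_1\Gamma\sigma_2\Gamma$ with $c(\sigma_1,\sigma_2,z)=\#\{\Gamma\theta_2\subseteq\Gamma\sigma_2\Gamma:\exists\theta_1\in\Gamma\sigma_1\Gamma,\ z=\theta_1\theta_2\}$, and involution $[\Gamma\sigma\Gamma]^*=[\Gamma\sigma^{-1}\Gamma]$. Its left regular representation on $\ell^2(\Gamma\backslash G)$ (orthonormal basis the cosets $\Gamma h$) is $\lambda_{\Gamma\backslash G}([\Gamma g\Gamma])[\Gamma h]=\sum_{\Gamma g_i\subseteq\Gamma g\Gamma}[\Gamma g_ih]$, the sum over the cosets $\Gamma g_i$ contained in $\Gamma g\Gamma$. The reduced Hecke von Neumann algebra $\mathcal H$ is the weak closure of $\lambda_{\Gamma\backslash G}(\mathcal H_0)$ in $B(\ell^2(\Gamma\backslash G))$. *)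

theory Defs
  imports "HOL-Analysis.Analysis" "HOL-Algebra.Coset"
begin

section \<open>The Hilbert spaces \<open>\<ell>\<^sup>2(X)\<close>\<close>

text \<open>
  Vectors of \<open>\<ell>\<^sup>2(X)\<close> are functions on the whole type that vanish off \<open>X\<close>, so that
  \<open>\<ell>\<^sup>2(A) \<subseteq> \<ell>\<^sup>2(X)\<close> whenever \<open>A \<subseteq> X\<close>.  The inner product is linear in the first argument.
\<close>

definition ell2 :: "'x set \<Rightarrow> ('x \<Rightarrow> complex) set" where
  "ell2 X = {f. (\<lambda>x. (cmod (f x))\<^sup>2) summable_on X \<and> (\<forall>x. x \<notin> X \<longrightarrow> f x = 0)}"

definition ell2_inner :: "'x set \<Rightarrow> ('x \<Rightarrow> complex) \<Rightarrow> ('x \<Rightarrow> complex) \<Rightarrow> complex" where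
  "ell2_inner X f g = (\<Sum>\<^sub>\<infinity>x\<in>X. f x * cnj (g x))"

definition ell2_norm :: "'x set \<Rightarrow> ('x \<Rightarrow> complex) \<Rightarrow> real" where
  "ell2_norm X f = sqrt (\<Sum>\<^sub>\<infinity>x\<in>X. (cmod (f x))\<^sup>2)"

definition ell2_delta :: "'x \<Rightarrow> 'x \<Rightarrow> complex" where
  "ell2_delta x = (\<lambda>y. if y = x then 1 else 0)"

definition ell2_closed_span :: "'x set \<Rightarrow> ('x \<Rightarrow> complex) set \<Rightarrow> ('x \<Rightarrow> complex) set" where
  "ell2_closed_span X S = {f \<in> ell2 X. \<forall>\<epsilon>>0. \<exists>F c. finite F \<and> F \<subseteq> S \<and>
     ell2_norm X (\<lambda>x. f x - (\<Sum>v\<in>F. c v * v x)) < \<epsilon>}"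

definition ell2_orthogonal :: "'x set \<Rightarrow> ('x \<Rightarrow> complex) set \<Rightarrow> ('x \<Rightarrow> complex) set" where
  "ell2_orthogonal X K = {f \<in> ell2 X. \<forall>g\<in>K. ell2_inner X f g = 0}"


section \<open>Bounded operators\<close>

text \<open>
  Operators on \<open>\<ell>\<^sup>2(X)\<close> are extensional (undefined off \<open>\<ell>\<^sup>2(X)\<close>), so that equality of
  operators is equality of functions.
\<close>

type_synonym 'x ell2_op = "('x \<Rightarrow> complex) \<Rightarrow> ('x \<Rightarrow> complex)"

definition linear_on_space ::
    "('x \<Rightarrow> complex) set \<Rightarrow> (('x \<Rightarrow> complex) \<Rightarrow> ('y \<Rightarrow> complex)) \<Rightarrow> bool" where
  "linear_on_space K T \<longleftrightarrow>
     (\<forall>f\<in>K. \<forall>g\<in>K. T (\<lambda>x. f x + g x) = (\<lambda>y. T f y + T g y)) \<and>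
     (\<forall>c. \<forall>f\<in>K. T (\<lambda>x. c * f x) = (\<lambda>y. c * T f y))"

definition bounded_ops :: "'x set \<Rightarrow> 'x ell2_op set" where
  "bounded_ops X = {T \<in> ell2 X \<rightarrow>\<^sub>E ell2 X. linear_on_space (ell2 X) T \<and>
     (\<exists>C. \<forall>f\<in>ell2 X. ell2_norm X (T f) \<le> C * ell2_norm X f)}"

definition op_id :: "'x set \<Rightarrow> 'x ell2_op" where
  "op_id X = (\<lambda>f\<in>ell2 X. f)"

definition op_comp :: "'x set \<Rightarrow> 'x ell2_op \<Rightarrow> 'x ell2_op \<Rightarrow> 'x ell2_op" where
  "op_comp X S T = compose (ell2 X) S T"

definition op_plus :: "'x set \<Rightarrow> 'x ell2_op \<Rightarrow> 'x ell2_op \<Rightarrow> 'x ell2_op" where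
  "op_plus X S T = (\<lambda>f\<in>ell2 X. \<lambda>x. S f x + T f x)"

definition op_scale :: "'x set \<Rightarrow> complex \<Rightarrow> 'x ell2_op \<Rightarrow> 'x ell2_op" where
  "op_scale X c T = (\<lambda>f\<in>ell2 X. \<lambda>x. c * T f x)"

definition op_adjoint :: "'x set \<Rightarrow> 'x ell2_op \<Rightarrow> 'x ell2_op" where
  "op_adjoint X T = (THE S. S \<in> bounded_ops X \<and>
     (\<forall>f\<in>ell2 X. \<forall>g\<in>ell2 X. ell2_inner X (T f) g = ell2_inner X f (S g)))"

text \<open>\<open>U\<close> is a unitary from \<open>K \<subseteq> \<ell>\<^sup>2(X)\<close> onto \<open>L \<subseteq> \<ell>\<^sup>2(Y)\<close>.\<close>

definition unitary_between :: "'x set \<Rightarrow> ('x \<Rightarrow> complex) set \<Rightarrow> 'y set \<Rightarrow> ('y \<Rightarrow> complex) set \<Rightarrow>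
    (('x \<Rightarrow> complex) \<Rightarrow> ('y \<Rightarrow> complex)) \<Rightarrow> bool" where
  "unitary_between X K Y L U \<longleftrightarrow> linear_on_space K U \<and> bij_betw U K L \<and>
     (\<forall>f\<in>K. \<forall>g\<in>K. ell2_inner Y (U f) (U g) = ell2_inner X f g)"

definition unitary_group :: "'x set \<Rightarrow> 'x ell2_op monoid" where
  "unitary_group X =
     \<lparr>carrier = {U \<in> extensional (ell2 X). unitary_between X (ell2 X) X (ell2 X) U},
      mult = op_comp X, one = op_id X\<rparr>"

text \<open>
  The weak operator topology is the initial topology for the functionals
  \<open>T \<mapsto> \<langle>T f, g\<rangle>\<close>; the ultraweak topology is the initial topology for the functionals
  \<open>T \<mapsto> \<Sum>\<^sub>n \<langle>T f\<^sub>n, g\<^sub>n\<rangle>\<close> with \<open>\<Sum>\<^sub>n \<parallel>f\<^sub>n\<parallel>\<^sup>2\<close> and \<open>\<Sum>\<^sub>n \<parallel>g\<^sub>n\<parallel>\<^sup>2\<close> finite.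
\<close>

definition weak_op_topology :: "'x set \<Rightarrow> 'x ell2_op topology" where
  "weak_op_topology X = pullback_topology (bounded_ops X)
     (\<lambda>T. \<lambda>(f, g)\<in>ell2 X \<times> ell2 X. ell2_inner X (T f) g)
     (product_topology (\<lambda>_. euclidean) (ell2 X \<times> ell2 X))"

definition square_summable_seqs :: "'x set \<Rightarrow> (nat \<Rightarrow> 'x \<Rightarrow> complex) set" where
  "square_summable_seqs X = {F. (\<forall>n. F n \<in> ell2 X) \<and> summable (\<lambda>n. (ell2_norm X (F n))\<^sup>2)}"

definition ultraweak_topology :: "'x set \<Rightarrow> 'x ell2_op topology" where
  "ultraweak_topology X = pullback_topology (bounded_ops X)
     (\<lambda>T. \<lambda>(F, G)\<in>square_summable_seqs X \<times> square_summable_seqs X.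
        \<Sum>n. ell2_inner X (T (F n)) (G n))
     (product_topology (\<lambda>_. euclidean) (square_summable_seqs X \<times> square_summable_seqs X))"

definition unital_star_hom ::
    "'x set \<Rightarrow> 'x ell2_op set \<Rightarrow> 'y set \<Rightarrow> 'y ell2_op set \<Rightarrow> ('x ell2_op \<Rightarrow> 'y ell2_op) \<Rightarrow> bool" where
  "unital_star_hom X M Y N \<rho> \<longleftrightarrow> \<rho> \<in> M \<rightarrow> N \<and>
     (\<forall>S\<in>M. \<forall>T\<in>M. \<rho> (op_plus X S T) = op_plus Y (\<rho> S) (\<rho> T)) \<and>
     (\<forall>c. \<forall>T\<in>M. \<rho> (op_scale X c T) = op_scale Y c (\<rho> T)) \<and>
     (\<forall>S\<in>M. \<forall>T\<in>M. \<rho> (op_comp X S T) = op_comp Y (\<rho> S) (\<rho> T)) \<and>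
     (\<forall>T\<in>M. \<rho> (op_adjoint X T) = op_adjoint Y (\<rho> T)) \<and>
     \<rho> (op_id X) = op_id Y"

definition normal_map ::
    "'x set \<Rightarrow> 'x ell2_op set \<Rightarrow> 'y set \<Rightarrow> 'y ell2_op set \<Rightarrow> ('x ell2_op \<Rightarrow> 'y ell2_op) \<Rightarrow> bool" where
  "normal_map X M Y N \<rho> \<longleftrightarrow>
     continuous_map (subtopology (ultraweak_topology X) M) (subtopology (ultraweak_topology Y) N) \<rho>"

definition reducing_subspace ::
    "'y set \<Rightarrow> 'm set \<Rightarrow> ('m \<Rightarrow> 'y ell2_op) \<Rightarrow> ('y \<Rightarrow> complex) set \<Rightarrow> bool" where
  "reducing_subspace Y M \<rho> K \<longleftrightarrow>
     (\<forall>x\<in>M. \<rho> x ` K \<subseteq> K \<and> \<rho> x ` ell2_orthogonal Y K \<subseteq> ell2_orthogonal Y K)"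


section \<open>The group von Neumann algebra\<close>

definition left_convolution :: "('a, 'b) monoid_scheme \<Rightarrow> ('a \<Rightarrow> complex) \<Rightarrow> 'a ell2_op" where
  "left_convolution G \<xi> = (\<lambda>f\<in>ell2 (carrier G). \<lambda>x. if x \<in> carrier G
     then \<Sum>\<^sub>\<infinity>y\<in>carrier G. \<xi> y * f (inv\<^bsub>G\<^esub> y \<otimes>\<^bsub>G\<^esub> x) else 0)"

definition group_vn_algebra :: "('a, 'b) monoid_scheme \<Rightarrow> 'a ell2_op set" where
  "group_vn_algebra G =
     {T \<in> bounded_ops (carrier G). \<exists>\<xi>\<in>ell2 (carrier G). T = left_convolution G \<xi>}"

definition group_vn_trace :: "('a, 'b) monoid_scheme \<Rightarrow> 'a ell2_op \<Rightarrow> complex" where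
  "group_vn_trace G T =
     ell2_inner (carrier G) (T (ell2_delta \<one>\<^bsub>G\<^esub>)) (ell2_delta \<one>\<^bsub>G\<^esub>)"

definition left_regular :: "('a, 'b) monoid_scheme \<Rightarrow> 'a set \<Rightarrow> 'a \<Rightarrow> 'a ell2_op" where
  "left_regular G \<Gamma> \<gamma> =
     (\<lambda>f\<in>ell2 \<Gamma>. \<lambda>x. if x \<in> \<Gamma> then f (inv\<^bsub>G\<^esub> \<gamma> \<otimes>\<^bsub>G\<^esub> x) else 0)"


section \<open>The Hecke algebra\<close>

definition almost_normal :: "('a, 'b) monoid_scheme \<Rightarrow> 'a set \<Rightarrow> bool" where
  "almost_normal G \<Gamma> \<longleftrightarrow> (\<forall>\<sigma>\<in>carrier G.
     finite (rcosets\<^bsub>G\<lparr>carrier := \<Gamma>\<rparr>\<^esub> (\<Gamma> \<inter> ((\<sigma> <#\<^bsub>G\<^esub> \<Gamma>) #>\<^bsub>G\<^esub> inv\<^bsub>G\<^esub> \<sigma>))))"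

definition double_cosets :: "('a, 'b) monoid_scheme \<Rightarrow> 'a set \<Rightarrow> 'a set set" where
  "double_cosets G \<Gamma> = (\<lambda>\<sigma>. (\<Gamma> #>\<^bsub>G\<^esub> \<sigma>) <#>\<^bsub>G\<^esub> \<Gamma>) ` carrier G"

definition cosets_in :: "('a, 'b) monoid_scheme \<Rightarrow> 'a set \<Rightarrow> 'a set \<Rightarrow> 'a set set" where
  "cosets_in G \<Gamma> D = {c \<in> rcosets\<^bsub>G\<^esub> \<Gamma>. c \<subseteq> D}"

text \<open>
  Elements of the Hecke algebra are the finitely supported functions on the set of double cosets;
  the double coset \<open>D\<close> itself is \<open>ell2_delta D\<close>.
\<close>

definition hecke_algebra :: "('a, 'b) monoid_scheme \<Rightarrow> 'a set \<Rightarrow> ('a set \<Rightarrow> complex) set" where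
  "hecke_algebra G \<Gamma> = {a. finite {D. a D \<noteq> 0} \<and> {D. a D \<noteq> 0} \<subseteq> double_cosets G \<Gamma>}"

definition hecke_const ::
    "('a, 'b) monoid_scheme \<Rightarrow> 'a set \<Rightarrow> 'a set \<Rightarrow> 'a set \<Rightarrow> 'a \<Rightarrow> nat" where
  "hecke_const G \<Gamma> D1 D2 z =
     card {c \<in> cosets_in G \<Gamma> D2. \<exists>\<theta>\<^sub>1\<in>D1. \<exists>\<theta>\<^sub>2\<in>c. z = \<theta>\<^sub>1 \<otimes>\<^bsub>G\<^esub> \<theta>\<^sub>2}"

definition hecke_mult :: "('a, 'b) monoid_scheme \<Rightarrow> 'a set \<Rightarrow>
    ('a set \<Rightarrow> complex) \<Rightarrow> ('a set \<Rightarrow> complex) \<Rightarrow> ('a set \<Rightarrow> complex)" where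
  "hecke_mult G \<Gamma> a b = (\<lambda>E. if E \<in> double_cosets G \<Gamma>
     then \<Sum>D1 | a D1 \<noteq> 0. \<Sum>D2 | b D2 \<noteq> 0.
       a D1 * b D2 * of_nat (hecke_const G \<Gamma> D1 D2 (SOME z. z \<in> E)) else 0)"

definition hecke_star ::
    "('a, 'b) monoid_scheme \<Rightarrow> 'a set \<Rightarrow> ('a set \<Rightarrow> complex) \<Rightarrow> ('a set \<Rightarrow> complex)" where
  "hecke_star G \<Gamma> a =
     (\<lambda>D. if D \<in> double_cosets G \<Gamma> then cnj (a ((\<lambda>x. inv\<^bsub>G\<^esub> x) ` D)) else 0)"

text \<open>
  \<open>hecke_basis_image G \<Gamma> D (\<Gamma>h)\<close> is the vector \<open>\<Sum> [\<Gamma> g\<^sub>i h]\<close>, the sum over the cosets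
  \<open>\<Gamma> g\<^sub>i \<subseteq> D\<close>; it does not depend on the representative \<open>h\<close>.  \<open>hecke_rep\<close> is its extension,
  linear in the Hecke algebra and linear and continuous on \<open>\<ell>\<^sup>2(\<Gamma>\G)\<close>.
\<close>

definition hecke_basis_image ::
    "('a, 'b) monoid_scheme \<Rightarrow> 'a set \<Rightarrow> 'a set \<Rightarrow> 'a set \<Rightarrow> ('a set \<Rightarrow> complex)" where
  "hecke_basis_image G \<Gamma> D c =
     (\<lambda>k. \<Sum>c'\<in>cosets_in G \<Gamma> D. ell2_delta (c' #>\<^bsub>G\<^esub> (SOME h. h \<in> c)) k)"

definition hecke_rep ::
    "('a, 'b) monoid_scheme \<Rightarrow> 'a set \<Rightarrow> ('a set \<Rightarrow> complex) \<Rightarrow> 'a set ell2_op" where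
  "hecke_rep G \<Gamma> a = (\<lambda>f\<in>ell2 (rcosets\<^bsub>G\<^esub> \<Gamma>). \<lambda>k.
     \<Sum>D | a D \<noteq> 0. a D * (\<Sum>\<^sub>\<infinity>c\<in>rcosets\<^bsub>G\<^esub> \<Gamma>. f c * hecke_basis_image G \<Gamma> D c k))"

definition hecke_vn_algebra :: "('a, 'b) monoid_scheme \<Rightarrow> 'a set \<Rightarrow> 'a set ell2_op set" where
  "hecke_vn_algebra G \<Gamma> =
     weak_op_topology (rcosets\<^bsub>G\<^esub> \<Gamma>) closure_of (hecke_rep G \<Gamma> ` hecke_algebra G \<Gamma>)"

definition hecke_state :: "('a, 'b) monoid_scheme \<Rightarrow> 'a set \<Rightarrow> 'a set ell2_op \<Rightarrow> complex" where
  "hecke_state G \<Gamma> x = ell2_inner (rcosets\<^bsub>G\<^esub> \<Gamma>) (x (ell2_delta \<Gamma>)) (ell2_delta \<Gamma>)"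


section \<open>The vectors \<open>t\<^sup>A\<close>\<close>

definition t_coeff ::
    "('a, 'b) monoid_scheme \<Rightarrow> 'a set \<Rightarrow> ('a \<Rightarrow> 'a ell2_op) \<Rightarrow> 'a \<Rightarrow> complex" where
  "t_coeff G \<Gamma> \<pi> \<theta> = ell2_inner \<Gamma> (\<pi> \<theta> (ell2_delta \<one>\<^bsub>G\<^esub>)) (ell2_delta \<one>\<^bsub>G\<^esub>)"

definition t_vec ::
    "('a, 'b) monoid_scheme \<Rightarrow> 'a set \<Rightarrow> ('a \<Rightarrow> 'a ell2_op) \<Rightarrow> 'a set \<Rightarrow> ('a \<Rightarrow> complex)" where
  "t_vec G \<Gamma> \<pi> A = (\<lambda>\<theta>. if \<theta> \<in> A then t_coeff G \<Gamma> \<pi> \<theta> else 0)"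

definition t_linear ::
    "('a, 'b) monoid_scheme \<Rightarrow> 'a set \<Rightarrow> ('a \<Rightarrow> 'a ell2_op) \<Rightarrow> ('a set \<Rightarrow> complex) \<Rightarrow> ('a \<Rightarrow> complex)"
  where "t_linear G \<Gamma> \<pi> a = (\<lambda>\<theta>. \<Sum>D | a D \<noteq> 0. a D * t_vec G \<Gamma> \<pi> D \<theta>)"


section \<open>The left regular representation is a unital *-representation\<close>


locale hecke_pair = group G for G :: "('a, 'b) monoid_scheme" (structure) +
  fixes \<Gamma> :: "'a set"
  assumes sub: "subgroup \<Gamma> G" and alm: "almost_normal G \<Gamma>"
begin

lemma Gamma_carrier: "\<Gamma> \<subseteq> carrier G"
  using sub subgroup.subset by blast

lemma Gamma_mem [simp]: "x \<in> \<Gamma> \<Longrightarrow> x \<in> carrier G"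
  using Gamma_carrier by blast

lemma Gamma_closed [simp]: "\<one> \<in> \<Gamma>" "x \<in> \<Gamma> \<Longrightarrow> inv x \<in> \<Gamma>"
    "x \<in> \<Gamma> \<Longrightarrow> y \<in> \<Gamma> \<Longrightarrow> x \<otimes> y \<in> \<Gamma>"
  using sub subgroup.one_closed subgroup.m_inv_closed subgroup.m_closed by fastforce+

lemma coset_eq: "c \<in> rcosets \<Gamma> \<Longrightarrow> h \<in> c \<Longrightarrow> c = \<Gamma> #> h"
  unfolding RCOSETS_def using repr_independence[OF _ _ sub] by fastforce

lemma coset_carrier: "c \<in> rcosets \<Gamma> \<Longrightarrow> h \<in> c \<Longrightarrow> h \<in> carrier G"
  using rcosets_part_G[OF sub] by blast

lemma coset_nonempty: "c \<in> rcosets \<Gamma> \<Longrightarrow> \<exists>h. h \<in> c"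
  unfolding RCOSETS_def using rcos_self[OF _ sub] by fastforce

lemma some_in_coset: "c \<in> rcosets \<Gamma> \<Longrightarrow> (SOME h. h \<in> c) \<in> c"
  using coset_nonempty by (rule someI_ex)

lemma coset_of [simp]: "h \<in> carrier G \<Longrightarrow> \<Gamma> #> h \<in> rcosets \<Gamma>"
  using rcosetsI[OF Gamma_carrier] .

lemma self_coset [simp]: "h \<in> carrier G \<Longrightarrow> h \<in> \<Gamma> #> h"
  using rcos_self[OF _ sub] .

lemma coset_mem: "x \<in> \<Gamma> #> h \<longleftrightarrow> (\<exists>\<gamma>\<in>\<Gamma>. x = \<gamma> \<otimes> h)"
  by (auto simp: r_coset_def)

lemma dcoset_mem: "x \<in> (\<Gamma> #> \<sigma>) <#> \<Gamma> \<longleftrightarrow> (\<exists>\<gamma>\<in>\<Gamma>. \<exists>\<delta>\<in>\<Gamma>. x = \<gamma> \<otimes> \<sigma> \<otimes> \<delta>)"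
  by (auto simp: r_coset_def set_mult_def)

lemma r_cancel_inv: "g \<in> carrier G \<Longrightarrow> x \<in> carrier G \<Longrightarrow> g \<otimes> (inv g \<otimes> x) = x"
  by (simp add: m_assoc[symmetric])

lemma dcoset_carrier: "D \<in> double_cosets G \<Gamma> \<Longrightarrow> x \<in> D \<Longrightarrow> x \<in> carrier G"
  by (auto simp: double_cosets_def dcoset_mem)

lemma dcoset_left:
  assumes "D \<in> double_cosets G \<Gamma>" "x \<in> D" "\<gamma> \<in> \<Gamma>" shows "\<gamma> \<otimes> x \<in> D"
proof -
  obtain \<sigma> where \<sigma>: "\<sigma> \<in> carrier G" "D = (\<Gamma> #> \<sigma>) <#> \<Gamma>"
    using assms(1) by (auto simp: double_cosets_def)
  then obtain \<eta> \<delta> where gd: "\<eta> \<in> \<Gamma>" "\<delta> \<in> \<Gamma>" "x = \<eta> \<otimes> \<sigma> \<otimes> \<delta>"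
    using assms(2) by (auto simp: dcoset_mem)
  have "\<gamma> \<otimes> x = (\<gamma> \<otimes> \<eta>) \<otimes> \<sigma> \<otimes> \<delta>"
    using gd \<sigma>(1) assms(3) by (simp add: m_assoc)
  then show ?thesis unfolding \<sigma>(2) dcoset_mem using gd assms(3) Gamma_closed(3) by blast
qed

lemma dcoset_right:
  assumes "D \<in> double_cosets G \<Gamma>" "x \<in> D" "\<gamma> \<in> \<Gamma>" shows "x \<otimes> \<gamma> \<in> D"
proof -
  obtain \<sigma> where \<sigma>: "\<sigma> \<in> carrier G" "D = (\<Gamma> #> \<sigma>) <#> \<Gamma>"
    using assms(1) by (auto simp: double_cosets_def)
  then obtain \<eta> \<delta> where gd: "\<eta> \<in> \<Gamma>" "\<delta> \<in> \<Gamma>" "x = \<eta> \<otimes> \<sigma> \<otimes> \<delta>"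
    using assms(2) by (auto simp: dcoset_mem)
  have "x \<otimes> \<gamma> = \<eta> \<otimes> \<sigma> \<otimes> (\<delta> \<otimes> \<gamma>)"
    using gd \<sigma>(1) assms(3) by (simp add: m_assoc)
  then show ?thesis unfolding \<sigma>(2) dcoset_mem using gd assms(3) Gamma_closed(3) by blast
qed

lemma dcoset_eq:
  assumes "D \<in> double_cosets G \<Gamma>" "x \<in> D" shows "D = (\<Gamma> #> x) <#> \<Gamma>"
proof -
  obtain \<sigma> where \<sigma>: "\<sigma> \<in> carrier G" "D = (\<Gamma> #> \<sigma>) <#> \<Gamma>"
    using assms(1) by (auto simp: double_cosets_def)
  then obtain \<gamma> \<delta> where gd: "\<gamma> \<in> \<Gamma>" "\<delta> \<in> \<Gamma>" "x = \<gamma> \<otimes> \<sigma> \<otimes> \<delta>"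
    using assms(2) by (auto simp: dcoset_mem)
  have "\<sigma> = inv \<gamma> \<otimes> x \<otimes> inv \<delta>"
    using gd \<sigma> by (simp add: m_assoc inv_solve_left)
  then have "\<sigma> \<in> (\<Gamma> #> x) <#> \<Gamma>" unfolding dcoset_mem using gd(1,2) Gamma_closed(2) by blast
  moreover have xD: "(\<Gamma> #> x) <#> \<Gamma> \<in> double_cosets G \<Gamma>"
    using dcoset_carrier[OF assms] by (simp add: double_cosets_def)
  ultimately have "D \<subseteq> (\<Gamma> #> x) <#> \<Gamma>"
    unfolding \<sigma>(2) using dcoset_left[OF xD] dcoset_right[OF xD] by (auto simp: dcoset_mem[of _ \<sigma>])
  moreover have "(\<Gamma> #> x) <#> \<Gamma> \<subseteq> D"
    using dcoset_left[OF assms(1)] dcoset_right[OF assms(1)] assms(2) by (auto simp: dcoset_mem)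
  ultimately show ?thesis by auto
qed

lemma dcoset_of [simp]: "x \<in> carrier G \<Longrightarrow> (\<Gamma> #> x) <#> \<Gamma> \<in> double_cosets G \<Gamma>"
  by (simp add: double_cosets_def)

lemma self_dcoset [simp]: "x \<in> carrier G \<Longrightarrow> x \<in> (\<Gamma> #> x) <#> \<Gamma>"
  unfolding dcoset_mem by (intro bexI[of _ \<one>]) auto

lemma some_in_dcoset: "D \<in> double_cosets G \<Gamma> \<Longrightarrow> (SOME h. h \<in> D) \<in> D"
  by (rule someI_ex) (auto simp: double_cosets_def intro: self_dcoset)

lemma dcoset_unique: "x \<in> carrier G \<Longrightarrow> D \<in> double_cosets G \<Gamma> \<Longrightarrow>
    x \<in> D \<longleftrightarrow> D = (\<Gamma> #> x) <#> \<Gamma>"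
  using dcoset_eq[of D x] self_dcoset[of x] by blast

lemma coset_subset: "D \<in> double_cosets G \<Gamma> \<Longrightarrow> x \<in> carrier G \<Longrightarrow> \<Gamma> #> x \<subseteq> D \<longleftrightarrow> x \<in> D"
  using dcoset_left[of D x] self_coset[of x] unfolding subset_iff coset_mem by blast

lemma coset_translate: "c \<in> rcosets \<Gamma> \<Longrightarrow> h \<in> c \<Longrightarrow> g \<in> carrier G \<Longrightarrow> c #> g = \<Gamma> #> (h \<otimes> g)"
  using coset_eq[of c h] coset_carrier[of c h] Gamma_carrier
  by (simp add: coset_mult_assoc)

lemma inv_dcoset:
  assumes "D \<in> double_cosets G \<Gamma>" shows "(\<lambda>x. inv x) ` D \<in> double_cosets G \<Gamma>"
proof -
  obtain \<sigma> where \<sigma>: "\<sigma> \<in> carrier G" "D = (\<Gamma> #> \<sigma>) <#> \<Gamma>"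
    using assms(1) by (auto simp: double_cosets_def)
  have "(\<lambda>x. inv x) ` D = (\<Gamma> #> inv \<sigma>) <#> \<Gamma>"
  proof (intro equalityI subsetI)
    fix y assume "y \<in> (\<lambda>x. inv x) ` D"
    then obtain \<gamma> \<delta> where "\<gamma> \<in> \<Gamma>" "\<delta> \<in> \<Gamma>" "y = inv (\<gamma> \<otimes> \<sigma> \<otimes> \<delta>)"
      unfolding \<sigma>(2) by (auto simp: dcoset_mem)
    then have "y = inv \<delta> \<otimes> inv \<sigma> \<otimes> inv \<gamma>"
      using \<sigma>(1) by (simp add: inv_mult_group m_assoc)
    then show "y \<in> (\<Gamma> #> inv \<sigma>) <#> \<Gamma>"
      unfolding dcoset_mem using \<open>\<gamma> \<in> \<Gamma>\<close> \<open>\<delta> \<in> \<Gamma>\<close> Gamma_closed(2) by blast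
  next
    fix y assume "y \<in> (\<Gamma> #> inv \<sigma>) <#> \<Gamma>"
    then obtain \<gamma> \<delta> where gd: "\<gamma> \<in> \<Gamma>" "\<delta> \<in> \<Gamma>" "y = \<gamma> \<otimes> inv \<sigma> \<otimes> \<delta>"
      by (auto simp: dcoset_mem)
    then have "y = inv (inv \<delta> \<otimes> \<sigma> \<otimes> inv \<gamma>)"
      using \<sigma>(1) by (simp add: inv_mult_group m_assoc)
    moreover have "inv \<delta> \<otimes> \<sigma> \<otimes> inv \<gamma> \<in> D"
      unfolding \<sigma>(2) dcoset_mem using gd Gamma_closed(2) by blast
    ultimately show "y \<in> (\<lambda>x. inv x) ` D" by blast
  qed
  then show ?thesis using \<sigma> by simp
qed

lemma inv_dcoset_mem:
  assumes "D \<in> double_cosets G \<Gamma>" "x \<in> carrier G"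
  shows "x \<in> (\<lambda>x. inv x) ` D \<longleftrightarrow> inv x \<in> D"
proof
  assume "x \<in> (\<lambda>x. inv x) ` D"
  then show "inv x \<in> D" using dcoset_carrier[OF assms(1)] by auto
next
  assume "inv x \<in> D"
  then have "inv (inv x) \<in> (\<lambda>x. inv x) ` D" by (rule imageI)
  then show "x \<in> (\<lambda>x. inv x) ` D" using assms(2) by simp
qed

lemma inv_inv_dcoset:
  assumes "D \<in> double_cosets G \<Gamma>"
  shows "(\<lambda>x. inv x) ` (\<lambda>x. inv x) ` D = D"
proof -
  have "(\<lambda>x. inv (inv x)) ` D = (\<lambda>x. x) ` D"
    by (rule image_cong) (use dcoset_carrier[OF assms] in auto)
  then show ?thesis by (simp add: image_image)
qed

lemma finite_cosets_in:
  assumes "D \<in> double_cosets G \<Gamma>" shows "finite (cosets_in G \<Gamma> D)"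
proof -
  obtain \<sigma> where \<sigma>: "\<sigma> \<in> carrier G" "D = (\<Gamma> #> \<sigma>) <#> \<Gamma>"
    using assms(1) by (auto simp: double_cosets_def)
  define \<Lambda> where "\<Lambda> = \<Gamma> \<inter> ((inv \<sigma> <# \<Gamma>) #> inv (inv \<sigma>))"
  have fin: "finite (rcosets\<^bsub>G\<lparr>carrier := \<Gamma>\<rparr>\<^esub> \<Lambda>)"
    using alm \<sigma>(1) unfolding almost_normal_def \<Lambda>_def by (meson inv_closed)
  have "cosets_in G \<Gamma> D \<subseteq> (\<lambda>X. (\<Gamma> #> \<sigma>) <#> X) ` (rcosets\<^bsub>G\<lparr>carrier := \<Gamma>\<rparr>\<^esub> \<Lambda>)"
  proof
    fix c assume "c \<in> cosets_in G \<Gamma> D"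
    then have c: "c \<in> rcosets \<Gamma>" "c \<subseteq> D" by (auto simp: cosets_in_def)
    then obtain x where x: "x \<in> c" "x \<in> D" using coset_nonempty by blast
    then obtain \<gamma> \<delta> where gd: "\<gamma> \<in> \<Gamma>" "\<delta> \<in> \<Gamma>" "x = \<gamma> \<otimes> \<sigma> \<otimes> \<delta>"
      using \<sigma>(2) by (auto simp: dcoset_mem)
    have "x \<in> \<Gamma> #> (\<sigma> \<otimes> \<delta>)" unfolding coset_mem using gd \<sigma>(1) by (auto simp: m_assoc)
    then have ceq: "c = \<Gamma> #> (\<sigma> \<otimes> \<delta>)"
      using coset_eq c(1) x(1) gd(2) \<sigma>(1) by (metis Gamma_mem coset_of m_closed)
    have "c = (\<Gamma> #> \<sigma>) <#> (\<Lambda> #> \<delta>)"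
    proof (intro equalityI subsetI)
      fix y assume "y \<in> c"
      then obtain \<eta> where \<eta>: "\<eta> \<in> \<Gamma>" "y = \<eta> \<otimes> \<sigma> \<otimes> (\<one> \<otimes> \<delta>)"
        unfolding ceq coset_mem using gd \<sigma>(1) by (auto simp: m_assoc)
      have "\<one> \<in> \<Lambda>"
        unfolding \<Lambda>_def l_coset_def r_coset_def using \<sigma>(1) by (auto intro!: bexI[of _ \<one>])
      with \<eta> show "y \<in> (\<Gamma> #> \<sigma>) <#> (\<Lambda> #> \<delta>)"
        unfolding set_mult_def r_coset_def by auto
    next
      fix y assume "y \<in> (\<Gamma> #> \<sigma>) <#> (\<Lambda> #> \<delta>)"
      then obtain \<eta> l where \<eta>: "\<eta> \<in> \<Gamma>" "l \<in> \<Lambda>" "y = (\<eta> \<otimes> \<sigma>) \<otimes> (l \<otimes> \<delta>)"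
        unfolding set_mult_def r_coset_def by auto
      then obtain \<kappa> where \<kappa>: "\<kappa> \<in> \<Gamma>" "l = inv \<sigma> \<otimes> \<kappa> \<otimes> \<sigma>"
        unfolding \<Lambda>_def l_coset_def r_coset_def using \<sigma>(1) by auto
      have "y = (\<eta> \<otimes> \<kappa>) \<otimes> (\<sigma> \<otimes> \<delta>)"
        using \<eta> \<kappa> \<sigma>(1) gd 
          r_cancel_inv[of \<sigma>] by (simp add: m_assoc)
      then show "y \<in> c" unfolding ceq coset_mem using \<eta> \<kappa> by auto
    qed
    moreover have "\<Lambda> #> \<delta> \<in> rcosets\<^bsub>G\<lparr>carrier := \<Gamma>\<rparr>\<^esub> \<Lambda>"
      using gd(2) by (auto simp: RCOSETS_def r_coset_def)
    ultimately show "c \<in> (\<lambda>X. (\<Gamma> #> \<sigma>) <#> X) ` (rcosets\<^bsub>G\<lparr>carrier := \<Gamma>\<rparr>\<^esub> \<Lambda>)" by blast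
  qed
  then show ?thesis using fin finite_surj by blast
qed

text \<open>\<open>hecke_rel D c k\<close> holds for \<open>c = \<Gamma>h\<close>, \<open>k = \<Gamma>z\<close> iff \<open>z h\<^sup>-\<^sup>1 \<in> D\<close>: the matrix of \<open>D\<close>.\<close>

definition hecke_rel :: "'a set \<Rightarrow> 'a set \<Rightarrow> 'a set \<Rightarrow> bool" where
  "hecke_rel D c k \<longleftrightarrow> (\<exists>h\<in>c. \<exists>z\<in>k. z \<otimes> inv h \<in> D)"

lemma hecke_rel_iff:
  assumes "D \<in> double_cosets G \<Gamma>" "c \<in> rcosets \<Gamma>" "k \<in> rcosets \<Gamma>" "h \<in> c" "z \<in> k"
  shows "hecke_rel D c k \<longleftrightarrow> z \<otimes> inv h \<in> D"
proof
  assume "hecke_rel D c k"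
  then obtain h' z' where hz: "h' \<in> c" "z' \<in> k" "z' \<otimes> inv h' \<in> D" by (auto simp: hecke_rel_def)
  obtain \<gamma> where \<gamma>: "\<gamma> \<in> \<Gamma>" "h = \<gamma> \<otimes> h'"
    using coset_eq[OF assms(2) hz(1)] assms(4) coset_mem by blast
  obtain \<delta> where \<delta>: "\<delta> \<in> \<Gamma>" "z = \<delta> \<otimes> z'"
    using coset_eq[OF assms(3) hz(2)] assms(5) coset_mem by blast
  have "z \<otimes> inv h = \<delta> \<otimes> (z' \<otimes> inv h') \<otimes> inv \<gamma>"
    using \<gamma> \<delta> coset_carrier[OF assms(2) hz(1)] coset_carrier[OF assms(3) hz(2)]
    by (simp add: inv_mult_group m_assoc)
  then show "z \<otimes> inv h \<in> D"
    using dcoset_left[OF assms(1) hz(3) \<delta>(1)] dcoset_right[OF assms(1)] \<gamma>(1) by simp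
qed (use assms in \<open>auto simp: hecke_rel_def\<close>)

lemma hecke_rel_inv:
  assumes "D \<in> double_cosets G \<Gamma>" "c \<in> rcosets \<Gamma>" "k \<in> rcosets \<Gamma>"
  shows "hecke_rel ((\<lambda>x. inv x) ` D) k c \<longleftrightarrow> hecke_rel D c k"
proof -
  obtain h z where hz: "h \<in> c" "z \<in> k" using coset_nonempty assms by blast
  have hc: "h \<in> carrier G" "z \<in> carrier G" using coset_carrier assms hz by blast+
  have "hecke_rel ((\<lambda>x. inv x) ` D) k c \<longleftrightarrow> h \<otimes> inv z \<in> (\<lambda>x. inv x) ` D"
    by (rule hecke_rel_iff[OF inv_dcoset[OF assms(1)] assms(3,2) hz(2,1)])
  also have "\<dots> \<longleftrightarrow> inv (h \<otimes> inv z) \<in> D" by (rule inv_dcoset_mem) (use assms hc in auto)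
  also have "\<dots> \<longleftrightarrow> z \<otimes> inv h \<in> D" using hc by (simp add: inv_mult_group)
  also have "\<dots> \<longleftrightarrow> hecke_rel D c k" by (rule hecke_rel_iff[OF assms hz, symmetric])
  finally show ?thesis .
qed

lemma bij_translate:
  assumes "D \<in> double_cosets G \<Gamma>" "c \<in> rcosets \<Gamma>" "h \<in> c"
  shows "bij_betw (\<lambda>k. k #> inv h) {k \<in> rcosets \<Gamma>. hecke_rel D c k} (cosets_in G \<Gamma> D)"
proof -
  have hc: "h \<in> carrier G" using coset_carrier assms by blast
  have k1: "k #> inv h = \<Gamma> #> (z \<otimes> inv h)" if "k \<in> rcosets \<Gamma>" "z \<in> k" for k z
    using coset_translate[OF that] hc by simp
  have trback: "k #> g #> inv g = k" if "k \<in> rcosets \<Gamma>" "g \<in> carrier G" for k g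
  proof -
    have "k \<subseteq> carrier G" using that rcosets_part_G[OF sub] by blast
    then show ?thesis using that by (simp add: coset_mult_assoc)
  qed
  show ?thesis
  proof (rule bij_betw_byWitness[where f' = "\<lambda>k. k #> h"]; (intro ballI)?)
    fix k assume "k \<in> {k \<in> rcosets \<Gamma>. hecke_rel D c k}"
    then have k: "k \<in> rcosets \<Gamma>" by simp
    show "k #> inv h #> h = k" using trback[OF k, of "inv h"] hc by simp
  next
    fix k assume k: "k \<in> cosets_in G \<Gamma> D"
    then have kr: "k \<in> rcosets \<Gamma>" by (simp add: cosets_in_def)
    show "k #> h #> inv h = k" using trback[OF kr] hc by simp
  next
    show "(\<lambda>k. k #> h) ` cosets_in G \<Gamma> D \<subseteq> {k \<in> rcosets \<Gamma>. hecke_rel D c k}"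
    proof (intro image_subsetI CollectI conjI)
    fix k assume k: "k \<in> cosets_in G \<Gamma> D"
    then have kr: "k \<in> rcosets \<Gamma>" by (simp add: cosets_in_def)
    obtain z where z: "z \<in> k" using coset_nonempty kr by blast
    then have zc: "z \<in> carrier G" using coset_carrier kr by blast
    have kh: "k #> h = \<Gamma> #> (z \<otimes> h)" using coset_translate[OF kr z hc] .
    then show "k #> h \<in> rcosets \<Gamma>" using zc hc by simp
    have "z \<in> D" using k z by (auto simp: cosets_in_def)
    then show "hecke_rel D c (k #> h)"
      using hecke_rel_iff[OF assms(1,2) _ assms(3), of "k #> h" "z \<otimes> h"] kh zc hc
      by (simp add: m_assoc)
    qed
  next
    show "(\<lambda>k. k #> inv h) ` {k \<in> rcosets \<Gamma>. hecke_rel D c k} \<subseteq> cosets_in G \<Gamma> D"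
    proof (intro image_subsetI)
    fix k assume "k \<in> {k \<in> rcosets \<Gamma>. hecke_rel D c k}"
    then have k: "k \<in> rcosets \<Gamma>" "hecke_rel D c k" by auto
    obtain z where z: "z \<in> k" using coset_nonempty k by blast
    then have zc: "z \<in> carrier G" using coset_carrier k by blast
    show "k #> inv h \<in> cosets_in G \<Gamma> D"
      using hecke_rel_iff[OF assms(1,2) k(1) assms(3) z] k(2) k1[OF k(1) z] zc hc
        coset_subset[OF assms(1), of "z \<otimes> inv h"]
      by (simp add: cosets_in_def)
    qed
  qed
qed

lemma card_rel_right:
  assumes "D \<in> double_cosets G \<Gamma>" "c \<in> rcosets \<Gamma>"
  shows "finite {k \<in> rcosets \<Gamma>. hecke_rel D c k}"
    and "card {k \<in> rcosets \<Gamma>. hecke_rel D c k} = card (cosets_in G \<Gamma> D)"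
proof -
  obtain h where "h \<in> c" using coset_nonempty assms(2) by blast
  note b = bij_translate[OF assms this]
  show "finite {k \<in> rcosets \<Gamma>. hecke_rel D c k}"
    using bij_betw_finite[OF b] finite_cosets_in[OF assms(1)] by simp
  show "card {k \<in> rcosets \<Gamma>. hecke_rel D c k} = card (cosets_in G \<Gamma> D)"
    using bij_betw_same_card[OF b] .
qed

lemma card_rel_left:
  assumes "D \<in> double_cosets G \<Gamma>" "k \<in> rcosets \<Gamma>"
  shows "finite {c \<in> rcosets \<Gamma>. hecke_rel D c k}"
    and "card {c \<in> rcosets \<Gamma>. hecke_rel D c k} = card (cosets_in G \<Gamma> ((\<lambda>x. inv x) ` D))"
proof -
  have "{c \<in> rcosets \<Gamma>. hecke_rel D c k} = {c \<in> rcosets \<Gamma>. hecke_rel ((\<lambda>x. inv x) ` D) k c}"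
    using hecke_rel_inv[OF assms(1) _ assms(2)] by blast
  then show "finite {c \<in> rcosets \<Gamma>. hecke_rel D c k}"
    and "card {c \<in> rcosets \<Gamma>. hecke_rel D c k} = card (cosets_in G \<Gamma> ((\<lambda>x. inv x) ` D))"
    using card_rel_right[OF inv_dcoset[OF assms(1)] assms(2)] by simp_all
qed

lemma hecke_basis_image_eq:
  assumes "D \<in> double_cosets G \<Gamma>" "c \<in> rcosets \<Gamma>"
  shows "hecke_basis_image G \<Gamma> D c k = (if k \<in> rcosets \<Gamma> \<and> hecke_rel D c k then 1 else 0)"
proof -
  define h where "h = (SOME h. h \<in> c)"
  have h: "h \<in> c" unfolding h_def using some_in_coset assms(2) .
  have hc: "h \<in> carrier G" using coset_carrier assms h by blast
  have "(\<Sum>c'\<in>cosets_in G \<Gamma> D. ell2_delta (c' #> h) k)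
      = (\<Sum>k'\<in>{k \<in> rcosets \<Gamma>. hecke_rel D c k}. ell2_delta (k' #> inv h #> h) k)"
    by (rule sum.reindex_bij_betw[OF bij_translate[OF assms h], symmetric])
  also have "\<dots> = (\<Sum>k'\<in>{k \<in> rcosets \<Gamma>. hecke_rel D c k}. if k = k' then 1 else 0)"
  proof (rule sum.cong[OF refl])
    fix k' assume "k' \<in> {k \<in> rcosets \<Gamma>. hecke_rel D c k}"
    then have "k' \<subseteq> carrier G" using rcosets_part_G[OF sub] by auto
    then show "ell2_delta (k' #> inv h #> h) k = (if k = k' then 1 else 0)"
      using hc by (simp add: coset_mult_assoc ell2_delta_def)
  qed
  also have "\<dots> = (if k \<in> rcosets \<Gamma> \<and> hecke_rel D c k then 1 else 0)"
    using card_rel_right(1)[OF assms] by (subst sum.delta') auto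
  finally show ?thesis unfolding hecke_basis_image_def h_def .
qed

lemma hecke_basis_sum:
  assumes "D \<in> double_cosets G \<Gamma>"
  shows "(\<Sum>\<^sub>\<infinity>c\<in>rcosets \<Gamma>. f c * hecke_basis_image G \<Gamma> D c k) =
    (if k \<in> rcosets \<Gamma> then \<Sum>c | c \<in> rcosets \<Gamma> \<and> hecke_rel D c k. f c else 0)"
proof (cases "k \<in> rcosets \<Gamma>")
  case True
  have "(\<Sum>\<^sub>\<infinity>c\<in>rcosets \<Gamma>. f c * hecke_basis_image G \<Gamma> D c k)
      = (\<Sum>\<^sub>\<infinity>c\<in>{c \<in> rcosets \<Gamma>. hecke_rel D c k}. f c)"
    using True assms by (intro infsum_cong_neutral) (auto simp: hecke_basis_image_eq)
  then show ?thesis using True card_rel_left(1)[OF assms True] by simp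
next
  case False
  then show ?thesis using assms by (auto intro!: infsum_0 simp: hecke_basis_image_eq)
qed

end

abbreviation (input) ell2_sq :: "'x set \<Rightarrow> ('x \<Rightarrow> complex) \<Rightarrow> real" where
  "ell2_sq X f \<equiv> (\<Sum>\<^sub>\<infinity>x\<in>X. (cmod (f x))\<^sup>2)"

lemma ell2_sq_nonneg: "0 \<le> ell2_sq X f"
  by (rule infsum_nonneg) auto

lemma ell2_bddI:
  assumes "\<And>F. finite F \<Longrightarrow> F \<subseteq> X \<Longrightarrow> (\<Sum>x\<in>F. (cmod (f x))\<^sup>2) \<le> B"
    and "\<And>x. x \<notin> X \<Longrightarrow> f x = 0"
  shows "f \<in> ell2 X" and "ell2_sq X f \<le> B"
proof -
  have s: "(\<lambda>x. (cmod (f x))\<^sup>2) summable_on X"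
    by (rule nonneg_bdd_above_summable_on) (use assms(1) in \<open>auto intro!: bdd_aboveI[of _ B]\<close>)
  then show "f \<in> ell2 X" using assms(2) by (simp add: ell2_def)
  show "ell2_sq X f \<le> B"
    using s assms(1) by (rule infsum_le_finite_sums)
qed

lemma ell2_add:
  assumes "f \<in> ell2 X" "g \<in> ell2 X"
  shows "(\<lambda>x. f x + g x) \<in> ell2 X" and "ell2_sq X (\<lambda>x. f x + g x) \<le> 2 * ell2_sq X f + 2 * ell2_sq X g"
proof -
  have sf: "(\<lambda>x. (cmod (f x))\<^sup>2) summable_on X" "(\<lambda>x. (cmod (g x))\<^sup>2) summable_on X"
    using assms by (auto simp: ell2_def)
  have "(\<Sum>x\<in>F. (cmod (f x + g x))\<^sup>2) \<le> 2 * ell2_sq X f + 2 * ell2_sq X g"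
    if F: "finite F" "F \<subseteq> X" for F
  proof -
    have "(cmod (f x + g x))\<^sup>2 \<le> 2 * (cmod (f x))\<^sup>2 + 2 * (cmod (g x))\<^sup>2" for x
    proof -
      have "(cmod (f x + g x))\<^sup>2 \<le> (cmod (f x) + cmod (g x))\<^sup>2"
        by (intro power_mono norm_triangle_ineq) auto
      also have "\<dots> \<le> 2 * (cmod (f x))\<^sup>2 + 2 * (cmod (g x))\<^sup>2"
        using sum_squares_bound[of "cmod (f x)" "cmod (g x)"] by (simp add: power2_sum)
      finally show ?thesis .
    qed
    then have "(\<Sum>x\<in>F. (cmod (f x + g x))\<^sup>2) \<le> (\<Sum>x\<in>F. 2 * (cmod (f x))\<^sup>2 + 2 * (cmod (g x))\<^sup>2)"
      by (intro sum_mono)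
    also have "\<dots> = 2 * (\<Sum>x\<in>F. (cmod (f x))\<^sup>2) + 2 * (\<Sum>x\<in>F. (cmod (g x))\<^sup>2)"
      by (simp add: sum.distrib sum_distrib_left)
    also have "\<dots> \<le> 2 * ell2_sq X f + 2 * ell2_sq X g"
      using F sf by (intro add_mono mult_left_mono finite_sum_le_infsum) auto
    finally show ?thesis .
  qed
  note b = ell2_bddI[OF this]
  show "(\<lambda>x. f x + g x) \<in> ell2 X" by (rule b) (use assms in \<open>auto simp: ell2_def\<close>)
  show "ell2_sq X (\<lambda>x. f x + g x) \<le> 2 * ell2_sq X f + 2 * ell2_sq X g"
    by (rule b) (use assms in \<open>auto simp: ell2_def\<close>)
qed

lemma ell2_scale:
  assumes "f \<in> ell2 X"
  shows "(\<lambda>x. c * f x) \<in> ell2 X" and "ell2_sq X (\<lambda>x. c * f x) = (cmod c)\<^sup>2 * ell2_sq X f"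
proof -
  have s: "(\<lambda>x. (cmod (f x))\<^sup>2) summable_on X" "\<And>x. x \<notin> X \<Longrightarrow> f x = 0"
    using assms by (auto simp: ell2_def)
  show "(\<lambda>x. c * f x) \<in> ell2 X"
    using s summable_on_cmult_right[OF s(1)] by (simp add: ell2_def norm_mult power_mult_distrib)
  show "ell2_sq X (\<lambda>x. c * f x) = (cmod c)\<^sup>2 * ell2_sq X f"
    unfolding norm_mult power_mult_distrib by (rule infsum_cmult_right[OF s(1)])
qed

lemma ell2_zero: "(\<lambda>x. 0) \<in> ell2 X"
  by (simp add: ell2_def)

lemma ell2_lincomb:
  assumes "finite A"
    and "\<And>D. D \<in> A \<Longrightarrow> \<exists>C\<ge>0. \<forall>f\<in>ell2 X. T D f \<in> ell2 X \<and> ell2_sq X (T D f) \<le> C * ell2_sq X f"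
  shows "\<exists>C\<ge>0. \<forall>f\<in>ell2 X. (\<lambda>x. \<Sum>D\<in>A. a D * T D f x) \<in> ell2 X \<and>
    ell2_sq X (\<lambda>x. \<Sum>D\<in>A. a D * T D f x) \<le> C * ell2_sq X f"
  using assms
proof (induction A rule: finite_induct)
  case empty
  then show ?case by (intro exI[of _ 0]) (simp add: ell2_zero)
next
  case (insert E A)
  have "\<exists>C\<ge>0. \<forall>f\<in>ell2 X. (\<lambda>x. \<Sum>D\<in>A. a D * T D f x) \<in> ell2 X \<and>
      ell2_sq X (\<lambda>x. \<Sum>D\<in>A. a D * T D f x) \<le> C * ell2_sq X f"
    by (rule insert.IH, rule insert.prems, rule insertI2)
  then obtain C where C: "C \<ge> 0" "\<And>f. f \<in> ell2 X \<Longrightarrow> (\<lambda>x. \<Sum>D\<in>A. a D * T D f x) \<in> ell2 X"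
    "\<And>f. f \<in> ell2 X \<Longrightarrow> ell2_sq X (\<lambda>x. \<Sum>D\<in>A. a D * T D f x) \<le> C * ell2_sq X f" by blast
  have "\<exists>C\<ge>0. \<forall>f\<in>ell2 X. T E f \<in> ell2 X \<and> ell2_sq X (T E f) \<le> C * ell2_sq X f"
    by (rule insert.prems, rule insertI1)
  then obtain C' where C': "C' \<ge> 0" "\<And>f. f \<in> ell2 X \<Longrightarrow> T E f \<in> ell2 X"
    "\<And>f. f \<in> ell2 X \<Longrightarrow> ell2_sq X (T E f) \<le> C' * ell2_sq X f" by blast
  have eq: "(\<Sum>D\<in>insert E A. a D * T D f x) = a E * T E f x + (\<Sum>D\<in>A. a D * T D f x)" for f x
    using insert.hyps by simp
  show ?case
  proof (intro exI[of _ "2 * (cmod (a E))\<^sup>2 * C' + 2 * C"] conjI ballI)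
    show "0 \<le> 2 * (cmod (a E))\<^sup>2 * C' + 2 * C" using C(1) C'(1) by auto
    fix f assume f: "f \<in> ell2 X"
    show "(\<lambda>x. \<Sum>D\<in>insert E A. a D * T D f x) \<in> ell2 X"
      unfolding eq by (intro ell2_add(1) ell2_scale(1) C(2) C'(2) f)
    have "ell2_sq X (\<lambda>x. a E * T E f x + (\<Sum>D\<in>A. a D * T D f x))
        \<le> 2 * ell2_sq X (\<lambda>x. a E * T E f x) + 2 * ell2_sq X (\<lambda>x. \<Sum>D\<in>A. a D * T D f x)"
      by (intro ell2_add(2) ell2_scale(1) C(2) C'(2) f)
    also have "\<dots> = 2 * ((cmod (a E))\<^sup>2 * ell2_sq X (T E f)) + 2 * ell2_sq X (\<lambda>x. \<Sum>D\<in>A. a D * T D f x)"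
      by (simp add: ell2_scale(2)[OF C'(2)[OF f]])
    also have "\<dots> \<le> 2 * ((cmod (a E))\<^sup>2 * (C' * ell2_sq X f)) + 2 * (C * ell2_sq X f)"
      by (intro add_mono mult_left_mono C(3) C'(3) f) auto
    finally show "ell2_sq X (\<lambda>x. \<Sum>D\<in>insert E A. a D * T D f x)
        \<le> (2 * (cmod (a E))\<^sup>2 * C' + 2 * C) * ell2_sq X f"
      unfolding eq by (simp add: algebra_simps)
  qed
qed

lemma ell2_inner_abs:
  assumes "f \<in> ell2 X" "g \<in> ell2 X"
  shows "(\<lambda>x. cmod (f x) * cmod (g x)) summable_on X"
proof (rule summable_on_comparison_test[where f = "\<lambda>x. (cmod (f x))\<^sup>2 + (cmod (g x))\<^sup>2"])
  show "(\<lambda>x. (cmod (f x))\<^sup>2 + (cmod (g x))\<^sup>2) summable_on X"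
    using assms by (intro summable_on_add) (auto simp: ell2_def)
  show "cmod (f x) * cmod (g x) \<le> (cmod (f x))\<^sup>2 + (cmod (g x))\<^sup>2" for x
  proof -
    have "0 \<le> cmod (f x) * cmod (g x)" by simp
    with sum_squares_bound[of "cmod (f x)" "cmod (g x)"] show ?thesis by linarith
  qed
qed auto

lemma ell2_inner_summable:
  assumes "f \<in> ell2 X" "g \<in> ell2 X"
  shows "(\<lambda>x. f x * cnj (g x)) summable_on X"
  by (rule Infinite_Sum.abs_summable_summable) (simp add: norm_mult ell2_inner_abs[OF assms])

lemma ell2_inner_cnj: "ell2_inner X g f = cnj (ell2_inner X f g)"
proof -
  have "cnj (ell2_inner X f g) = (\<Sum>\<^sub>\<infinity>x\<in>X. cnj (f x * cnj (g x)))"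
    unfolding ell2_inner_def by (rule infsum_cnj[symmetric])
  then show ?thesis by (simp add: ell2_inner_def mult.commute)
qed

lemma ell2_inner_sum_left:
  fixes a :: "'d \<Rightarrow> complex"
  assumes "finite A" "\<And>D. D \<in> A \<Longrightarrow> v D \<in> ell2 X" "g \<in> ell2 X"
  shows "ell2_inner X (\<lambda>x. \<Sum>D\<in>A. a D * v D x) g = (\<Sum>D\<in>A. a D * ell2_inner X (v D) g)"
proof -
  have "((\<lambda>x. \<Sum>D\<in>A. a D * (v D x * cnj (g x))) has_sum (\<Sum>D\<in>A. a D * ell2_inner X (v D) g)) X"
    using assms(1,2)
  proof (induction A rule: finite_induct)
    case (insert E A)
    have "((\<lambda>x. a E * (v E x * cnj (g x))) has_sum (a E * ell2_inner X (v E) g)) X"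
      unfolding ell2_inner_def using insert.prems assms(3)
      by (intro has_sum_cmult_right has_sum_infsum ell2_inner_summable) auto
    from has_sum_add[OF this insert.IH] insert show ?case by simp
  qed simp
  then show ?thesis
    unfolding ell2_inner_def[of X "\<lambda>x. \<Sum>D\<in>A. a D * v D x"]
    by (intro infsumI) (simp add: sum_distrib_right mult.assoc)
qed

lemma ell2_inner_sum_right:
  fixes a :: "'d \<Rightarrow> complex"
  assumes "finite A" "\<And>D. D \<in> A \<Longrightarrow> v D \<in> ell2 X" "g \<in> ell2 X"
  shows "ell2_inner X g (\<lambda>x. \<Sum>D\<in>A. a D * v D x) = (\<Sum>D\<in>A. cnj (a D) * ell2_inner X g (v D))"
proof -
  have "cnj (ell2_inner X (\<lambda>x. \<Sum>D\<in>A. a D * v D x) g) = (\<Sum>D\<in>A. cnj (a D) * cnj (ell2_inner X (v D) g))"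
    using ell2_inner_sum_left[OF assms, where a = a] by simp
  then show ?thesis by (simp only: ell2_inner_cnj[symmetric])
qed

lemma ell2_delta_mem:
  assumes "x \<in> X" shows "ell2_delta x \<in> ell2 X"
proof -
  have "(\<lambda>y. (cmod (ell2_delta x y))\<^sup>2) summable_on X \<longleftrightarrow> (\<lambda>y. (cmod (ell2_delta x y))\<^sup>2) summable_on {x}"
    by (rule summable_on_cong_neutral) (use assms in \<open>auto simp: ell2_delta_def\<close>)
  then show ?thesis using assms by (auto simp: ell2_def ell2_delta_def)
qed

lemma ell2_inner_delta: "x \<in> X \<Longrightarrow> ell2_inner X (ell2_delta x) g = cnj (g x)"
proof -
  assume x: "x \<in> X"
  have "ell2_inner X (ell2_delta x) g = (\<Sum>\<^sub>\<infinity>y\<in>{x}. ell2_delta x y * cnj (g y))"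
    unfolding ell2_inner_def using x by (intro infsum_cong_neutral) (auto simp: ell2_delta_def)
  then show ?thesis by (simp add: ell2_delta_def)
qed

lemma op_adjoint_eqI:
  assumes S: "S \<in> bounded_ops X"
    and adj: "\<And>f g. f \<in> ell2 X \<Longrightarrow> g \<in> ell2 X \<Longrightarrow> ell2_inner X (T f) g = ell2_inner X f (S g)"
  shows "op_adjoint X T = S"
  unfolding op_adjoint_def
proof (rule the_equality)
  show "S \<in> bounded_ops X \<and> (\<forall>f\<in>ell2 X. \<forall>g\<in>ell2 X. ell2_inner X (T f) g = ell2_inner X f (S g))"
    using assms by blast
  fix S' assume S': "S' \<in> bounded_ops X \<and>
    (\<forall>f\<in>ell2 X. \<forall>g\<in>ell2 X. ell2_inner X (T f) g = ell2_inner X f (S' g))"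
  show "S' = S"
  proof
    fix g show "S' g = S g"
    proof (cases "g \<in> ell2 X")
      case True
      show ?thesis
      proof
        fix x show "S' g x = S g x"
        proof (cases "x \<in> X")
          case xX: True
          have "ell2_inner X (ell2_delta x) (S' g) = ell2_inner X (ell2_delta x) (S g)"
            using S'[THEN conjunct2, rule_format, OF ell2_delta_mem[OF xX] True]
              adj[OF ell2_delta_mem[OF xX] True] by (rule trans[OF sym])
          then show ?thesis by (simp add: ell2_inner_delta[OF xX])
        next
          case False
          have "S' g \<in> ell2 X" "S g \<in> ell2 X" using S S' True by (auto simp: bounded_ops_def)
          then show ?thesis using False by (simp add: ell2_def)
        qed
      qed
    next
      case False
      then show ?thesis using S S' by (simp add: bounded_ops_def PiE_def extensional_def)
    qed
  qed
qed

context hecke_pair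
begin

definition single_rep :: "'a set \<Rightarrow> ('a set \<Rightarrow> complex) \<Rightarrow> 'a set \<Rightarrow> complex" where
  "single_rep D f = (\<lambda>k. if k \<in> rcosets \<Gamma> then \<Sum>c | c \<in> rcosets \<Gamma> \<and> hecke_rel D c k. f c else 0)"

lemma hecke_rep_single:
  assumes "a \<in> hecke_algebra G \<Gamma>" "f \<in> ell2 (rcosets \<Gamma>)"
  shows "hecke_rep G \<Gamma> a f = (\<lambda>k. \<Sum>D | a D \<noteq> 0. a D * single_rep D f k)"
proof
  fix k
  have "(\<Sum>\<^sub>\<infinity>c\<in>rcosets \<Gamma>. f c * hecke_basis_image G \<Gamma> D c k) = single_rep D f k" if "a D \<noteq> 0" for D
    unfolding single_rep_def using assms that by (intro hecke_basis_sum) (auto simp: hecke_algebra_def)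
  then show "hecke_rep G \<Gamma> a f k = (\<Sum>D | a D \<noteq> 0. a D * single_rep D f k)"
    unfolding hecke_rep_def using assms(2) by simp
qed

lemma single_rep_bounded:
  assumes D: "D \<in> double_cosets G \<Gamma>"
  shows "\<exists>C\<ge>0. \<forall>f\<in>ell2 (rcosets \<Gamma>). single_rep D f \<in> ell2 (rcosets \<Gamma>) \<and>
    ell2_sq (rcosets \<Gamma>) (single_rep D f) \<le> C * ell2_sq (rcosets \<Gamma>) f"
proof -
  define L where "L = (\<lambda>k. {c \<in> rcosets \<Gamma>. hecke_rel D c k})"
  define N where "N = card (cosets_in G \<Gamma> D)"
  define M where "M = card (cosets_in G \<Gamma> ((\<lambda>x. inv x) ` D))"
  have finL: "finite (L k)" "card (L k) = M" if "k \<in> rcosets \<Gamma>" for k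
    using card_rel_left[OF D that] by (auto simp: L_def M_def)
  have bd: "(\<Sum>k\<in>F. (cmod (single_rep D f k))\<^sup>2) \<le> (real M * real N) * ell2_sq (rcosets \<Gamma>) f"
    if f: "f \<in> ell2 (rcosets \<Gamma>)" and F: "finite F" "F \<subseteq> rcosets \<Gamma>" for f F
  proof -
    define A where "A = (\<Union>k\<in>F. L k)"
    have A: "finite A" "A \<subseteq> rcosets \<Gamma>" using F finL unfolding A_def by (auto simp: L_def)
    have "(\<Sum>k\<in>F. (cmod (single_rep D f k))\<^sup>2) \<le> (\<Sum>k\<in>F. real M * (\<Sum>c\<in>L k. (cmod (f c))\<^sup>2))"
    proof (rule sum_mono)
      fix k assume "k \<in> F"
      then have k: "k \<in> rcosets \<Gamma>" using F by blast
      have "(cmod (single_rep D f k))\<^sup>2 \<le> (\<Sum>c\<in>L k. cmod (f c))\<^sup>2"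
        using k by (auto simp: single_rep_def L_def intro!: power_mono norm_sum)
      also have "\<dots> \<le> (\<Sum>c\<in>L k. (cmod (f c))\<^sup>2) * card (L k)" by (rule sum_squared_le_sum_of_squares)
      finally show "(cmod (single_rep D f k))\<^sup>2 \<le> real M * (\<Sum>c\<in>L k. (cmod (f c))\<^sup>2)"
        using finL(2)[OF k] by (simp add: mult.commute)
    qed
    also have "\<dots> = real M * (\<Sum>k\<in>F. \<Sum>c\<in>{c. c \<in> A \<and> hecke_rel D c k}. (cmod (f c))\<^sup>2)"
    proof -
      have "L k = {c. c \<in> A \<and> hecke_rel D c k}" if "k \<in> F" for k
        using that by (auto simp: A_def L_def)
      then show ?thesis by (simp add: sum_distrib_left)
    qed
    also have "\<dots> = real M * (\<Sum>c\<in>A. \<Sum>k\<in>{k. k \<in> F \<and> hecke_rel D c k}. (cmod (f c))\<^sup>2)"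
      by (subst sum.swap_restrict[OF F(1) A(1)]) simp
    also have "\<dots> \<le> real M * (\<Sum>c\<in>A. real N * (cmod (f c))\<^sup>2)"
    proof (intro mult_left_mono sum_mono)
      fix c assume "c \<in> A"
      then have c: "c \<in> rcosets \<Gamma>" using A by blast
      have "card {k. k \<in> F \<and> hecke_rel D c k} \<le> N"
        unfolding N_def card_rel_right(2)[OF D c, symmetric]
        using F by (intro card_mono card_rel_right(1)[OF D c]) auto
      then show "(\<Sum>k\<in>{k. k \<in> F \<and> hecke_rel D c k}. (cmod (f c))\<^sup>2) \<le> real N * (cmod (f c))\<^sup>2"
        by (simp add: mult_right_mono)
    qed auto
    also have "\<dots> = (real M * real N) * (\<Sum>c\<in>A. (cmod (f c))\<^sup>2)" by (simp add: sum_distrib_left mult.assoc)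
    also have "\<dots> \<le> (real M * real N) * ell2_sq (rcosets \<Gamma>) f"
      using f A by (intro mult_left_mono finite_sum_le_infsum) (auto simp: ell2_def)
    finally show ?thesis .
  qed
  show ?thesis
  proof (intro exI[of _ "real M * real N"] conjI ballI)
    fix f assume f: "f \<in> ell2 (rcosets \<Gamma>)"
    show "single_rep D f \<in> ell2 (rcosets \<Gamma>)"
      by (rule ell2_bddI(1)[OF bd[OF f]]) (auto simp: single_rep_def)
    show "ell2_sq (rcosets \<Gamma>) (single_rep D f) \<le> real M * real N * ell2_sq (rcosets \<Gamma>) f"
      by (rule ell2_bddI(2)[OF bd[OF f]]) (auto simp: single_rep_def)
  qed auto
qed

lemma single_rep_ell2:
  "D \<in> double_cosets G \<Gamma> \<Longrightarrow> f \<in> ell2 (rcosets \<Gamma>) \<Longrightarrow> single_rep D f \<in> ell2 (rcosets \<Gamma>)"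
  using single_rep_bounded by blast

lemma single_rep_add: "single_rep D (\<lambda>x. f x + g x) k = single_rep D f k + single_rep D g k"
  by (simp add: single_rep_def sum.distrib)

lemma single_rep_scale: "single_rep D (\<lambda>x. c * f x) k = c * single_rep D f k"
  by (simp add: single_rep_def sum_distrib_left)

theorem hecke_rep_bounded:
  assumes a: "a \<in> hecke_algebra G \<Gamma>"
  shows "hecke_rep G \<Gamma> a \<in> bounded_ops (rcosets \<Gamma>)"
proof -
  have fin: "finite {D. a D \<noteq> 0}" and dc: "\<And>D. a D \<noteq> 0 \<Longrightarrow> D \<in> double_cosets G \<Gamma>"
    using a by (auto simp: hecke_algebra_def)
  note r = hecke_rep_single[OF a]
  have "\<exists>C\<ge>0. \<forall>f\<in>ell2 (rcosets \<Gamma>). (\<lambda>k. \<Sum>D\<in>{D. a D \<noteq> 0}. a D * single_rep D f k) \<in> ell2 (rcosets \<Gamma>) \<and>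
    ell2_sq (rcosets \<Gamma>) (\<lambda>k. \<Sum>D\<in>{D. a D \<noteq> 0}. a D * single_rep D f k) \<le> C * ell2_sq (rcosets \<Gamma>) f"
    by (rule ell2_lincomb[OF fin]) (use single_rep_bounded dc in auto)
  then obtain C where C: "C \<ge> 0"
    "\<And>f. f \<in> ell2 (rcosets \<Gamma>) \<Longrightarrow> hecke_rep G \<Gamma> a f \<in> ell2 (rcosets \<Gamma>)"
    "\<And>f. f \<in> ell2 (rcosets \<Gamma>) \<Longrightarrow>
      ell2_sq (rcosets \<Gamma>) (hecke_rep G \<Gamma> a f) \<le> C * ell2_sq (rcosets \<Gamma>) f"
    using r by auto
  have "linear_on_space (ell2 (rcosets \<Gamma>)) (hecke_rep G \<Gamma> a)"
    unfolding linear_on_space_def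
    by (auto simp: r ell2_add(1) ell2_scale(1) single_rep_add single_rep_scale algebra_simps
        sum.distrib sum_distrib_left fun_eq_iff)
  moreover have "ell2_norm (rcosets \<Gamma>) (hecke_rep G \<Gamma> a f) \<le> sqrt C * ell2_norm (rcosets \<Gamma>) f"
    if "f \<in> ell2 (rcosets \<Gamma>)" for f
    using C(3)[OF that] by (simp add: ell2_norm_def flip: real_sqrt_mult)
  moreover have "hecke_rep G \<Gamma> a \<in> ell2 (rcosets \<Gamma>) \<rightarrow>\<^sub>E ell2 (rcosets \<Gamma>)"
    using C(2) by (auto simp: hecke_rep_def)
  ultimately show ?thesis unfolding bounded_ops_def by blast
qed

lemma single_rep_adjoint:
  assumes D: "D \<in> double_cosets G \<Gamma>" and f: "f \<in> ell2 (rcosets \<Gamma>)" and g: "g \<in> ell2 (rcosets \<Gamma>)"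
  shows "ell2_inner (rcosets \<Gamma>) (single_rep D f) g
    = ell2_inner (rcosets \<Gamma>) f (single_rep ((\<lambda>x. inv x) ` D) g)"
proof -
  define L where "L = (\<lambda>k. {c \<in> rcosets \<Gamma>. hecke_rel D c k})"
  define L' where "L' = (\<lambda>c. {k \<in> rcosets \<Gamma>. hecke_rel D c k})"
  have finL: "k \<in> rcosets \<Gamma> \<Longrightarrow> finite (L k)" for k using card_rel_left[OF D] by (auto simp: L_def)
  have finL': "c \<in> rcosets \<Gamma> \<Longrightarrow> finite (L' c)" for c using card_rel_right[OF D] by (auto simp: L'_def)
  define af where "af = (\<lambda>c. complex_of_real (cmod (f c)))"
  have af: "af \<in> ell2 (rcosets \<Gamma>)" using f by (simp add: ell2_def af_def)
  have abs: "(\<lambda>p. norm (case p of (k, c) \<Rightarrow> f c * cnj (g k))) summable_on Sigma (rcosets \<Gamma>) L"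
  proof (rule summable_on_SigmaI)
    show "((\<lambda>c. norm (case (k, c) of (k, c) \<Rightarrow> f c * cnj (g k))) has_sum
        (cmod (single_rep D af k) * cmod (g k))) (L k)" if k: "k \<in> rcosets \<Gamma>" for k
    proof -
      have "single_rep D af k = complex_of_real (\<Sum>c\<in>L k. cmod (f c))"
        using k by (simp add: single_rep_def L_def af_def)
      then have "cmod (single_rep D af k) = (\<Sum>c\<in>L k. cmod (f c))"
        by (simp only: norm_of_real) (simp add: sum_nonneg)
      then have "cmod (single_rep D af k) * cmod (g k) = (\<Sum>c\<in>L k. norm (case (k, c) of (k, c) \<Rightarrow> f c * cnj (g k)))"
        by (simp add: sum_distrib_right norm_mult)
      then show ?thesis by (simp only: has_sum_finite[OF finL[OF k]])
    qed
    show "(\<lambda>k. cmod (single_rep D af k) * cmod (g k)) summable_on rcosets \<Gamma>"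
      by (rule ell2_inner_abs[OF single_rep_ell2[OF D af] g])
  qed auto
  then have sum: "(\<lambda>(k, c). f c * cnj (g k)) summable_on Sigma (rcosets \<Gamma>) L"
    by (rule Infinite_Sum.abs_summable_summable)
  have swap: "Sigma (rcosets \<Gamma>) L = prod.swap ` Sigma (rcosets \<Gamma>) L'"
    by (auto simp: L_def L'_def image_iff)
  have sum': "(\<lambda>(c, k). f c * cnj (g k)) summable_on Sigma (rcosets \<Gamma>) L'"
    using sum unfolding swap by (subst (asm) summable_on_reindex) (auto simp: o_def case_prod_unfold)
  have "ell2_inner (rcosets \<Gamma>) (single_rep D f) g
      = (\<Sum>\<^sub>\<infinity>k\<in>rcosets \<Gamma>. \<Sum>\<^sub>\<infinity>c\<in>L k. f c * cnj (g k))"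
    unfolding ell2_inner_def
    by (rule infsum_cong) (use finL in \<open>simp add: single_rep_def L_def sum_distrib_right\<close>)
  also have "\<dots> = infsum (\<lambda>(k, c). f c * cnj (g k)) (Sigma (rcosets \<Gamma>) L)"
    by (rule infsum_Sigma'_banach[OF sum])
  also have "\<dots> = infsum (\<lambda>(c, k). f c * cnj (g k)) (Sigma (rcosets \<Gamma>) L')"
    unfolding swap by (subst infsum_reindex) (auto simp: o_def case_prod_unfold)
  also have "\<dots> = (\<Sum>\<^sub>\<infinity>c\<in>rcosets \<Gamma>. \<Sum>\<^sub>\<infinity>k\<in>L' c. f c * cnj (g k))"
    by (rule infsum_Sigma'_banach[OF sum', symmetric])
  also have "\<dots> = ell2_inner (rcosets \<Gamma>) f (single_rep ((\<lambda>x. inv x) ` D) g)"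
    unfolding ell2_inner_def
  proof (rule infsum_cong)
    fix c assume c: "c \<in> rcosets \<Gamma>"
    have "L' c = {k. k \<in> rcosets \<Gamma> \<and> hecke_rel ((\<lambda>x. inv x) ` D) k c}"
      using hecke_rel_inv[OF D c] by (auto simp: L'_def)
    then show "(\<Sum>\<^sub>\<infinity>k\<in>L' c. f c * cnj (g k)) = f c * cnj (single_rep ((\<lambda>x. inv x) ` D) g c)"
      using c finL'[OF c] by (simp add: single_rep_def sum_distrib_left)
  qed
  finally show ?thesis .
qed

lemma hecke_star_closed:
  assumes a: "a \<in> hecke_algebra G \<Gamma>" shows "hecke_star G \<Gamma> a \<in> hecke_algebra G \<Gamma>"
    and "{D. hecke_star G \<Gamma> a D \<noteq> 0} = (\<lambda>D. (\<lambda>x. inv x) ` D) ` {D. a D \<noteq> 0}"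
proof -
  have dc: "\<And>D. a D \<noteq> 0 \<Longrightarrow> D \<in> double_cosets G \<Gamma>" using a by (auto simp: hecke_algebra_def)
  show *: "{D. hecke_star G \<Gamma> a D \<noteq> 0} = (\<lambda>D. (\<lambda>x. inv x) ` D) ` {D. a D \<noteq> 0}"
  proof (intro equalityI subsetI)
    fix D assume "D \<in> {D. hecke_star G \<Gamma> a D \<noteq> 0}"
    then have "D \<in> double_cosets G \<Gamma>" "a ((\<lambda>x. inv x) ` D) \<noteq> 0"
      by (auto simp: hecke_star_def split: if_splits)
    then show "D \<in> (\<lambda>D. (\<lambda>x. inv x) ` D) ` {D. a D \<noteq> 0}"
      by (intro image_eqI[of _ _ "(\<lambda>x. inv x) ` D"]) (auto simp: inv_inv_dcoset)
  next
    fix D assume "D \<in> (\<lambda>D. (\<lambda>x. inv x) ` D) ` {D. a D \<noteq> 0}"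
    then obtain E where "D = (\<lambda>x. inv x) ` E" "a E \<noteq> 0" by blast
    then show "D \<in> {D. hecke_star G \<Gamma> a D \<noteq> 0}"
      using dc[of E] by (simp add: hecke_star_def inv_dcoset inv_inv_dcoset)
  qed
  show "hecke_star G \<Gamma> a \<in> hecke_algebra G \<Gamma>"
    unfolding hecke_algebra_def mem_Collect_eq *
  proof
    show "finite ((\<lambda>D. (\<lambda>x. inv x) ` D) ` {D. a D \<noteq> 0})"
      using a by (simp add: hecke_algebra_def)
    show "(\<lambda>D. (\<lambda>x. inv x) ` D) ` {D. a D \<noteq> 0} \<subseteq> double_cosets G \<Gamma>"
      by (intro image_subsetI inv_dcoset dc) simp
  qed
qed

theorem hecke_rep_star:
  assumes a: "a \<in> hecke_algebra G \<Gamma>"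
  shows "hecke_rep G \<Gamma> (hecke_star G \<Gamma> a) = op_adjoint (rcosets \<Gamma>) (hecke_rep G \<Gamma> a)"
proof (rule op_adjoint_eqI[symmetric])
  show "hecke_rep G \<Gamma> (hecke_star G \<Gamma> a) \<in> bounded_ops (rcosets \<Gamma>)"
    by (rule hecke_rep_bounded[OF hecke_star_closed(1)[OF a]])
  fix f g assume f: "f \<in> ell2 (rcosets \<Gamma>)" and g: "g \<in> ell2 (rcosets \<Gamma>)"
  have fin: "finite {D. a D \<noteq> 0}" and dc: "\<And>D. a D \<noteq> 0 \<Longrightarrow> D \<in> double_cosets G \<Gamma>"
    using a by (auto simp: hecke_algebra_def)
  let ?I = "\<lambda>D. (\<lambda>x. inv x) ` D"
  have inj: "inj_on ?I {D. a D \<noteq> 0}"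
    by (rule inj_on_inverseI[where g = ?I]) (simp add: dc inv_inv_dcoset)
  have "hecke_rep G \<Gamma> (hecke_star G \<Gamma> a) g
      = (\<lambda>k. \<Sum>D | a D \<noteq> 0. hecke_star G \<Gamma> a (?I D) * single_rep (?I D) g k)"
    unfolding hecke_rep_single[OF hecke_star_closed(1)[OF a] g] hecke_star_closed(2)[OF a]
    by (subst sum.reindex[OF inj]) simp
  also have "\<dots> = (\<lambda>k. \<Sum>D | a D \<noteq> 0. cnj (a D) * single_rep (?I D) g k)"
    using dc by (intro ext sum.cong) (auto simp: hecke_star_def inv_dcoset inv_inv_dcoset)
  finally have star: "hecke_rep G \<Gamma> (hecke_star G \<Gamma> a) g
    = (\<lambda>k. \<Sum>D | a D \<noteq> 0. cnj (a D) * single_rep (?I D) g k)" .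
  have "ell2_inner (rcosets \<Gamma>) (hecke_rep G \<Gamma> a f) g
      = (\<Sum>D | a D \<noteq> 0. a D * ell2_inner (rcosets \<Gamma>) (single_rep D f) g)"
    unfolding hecke_rep_single[OF a f] using fin dc f g
    by (intro ell2_inner_sum_left single_rep_ell2) auto
  also have "\<dots> = (\<Sum>D | a D \<noteq> 0. cnj (cnj (a D)) * ell2_inner (rcosets \<Gamma>) f (single_rep (?I D) g))"
    using dc f g by (intro sum.cong) (auto simp: single_rep_adjoint)
  also have "\<dots> = ell2_inner (rcosets \<Gamma>) f (hecke_rep G \<Gamma> (hecke_star G \<Gamma> a) g)"
    unfolding star using fin dc f g
    by (intro ell2_inner_sum_right[symmetric] single_rep_ell2 inv_dcoset) auto
  finally show "ell2_inner (rcosets \<Gamma>) (hecke_rep G \<Gamma> a f) g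
    = ell2_inner (rcosets \<Gamma>) f (hecke_rep G \<Gamma> (hecke_star G \<Gamma> a) g)" .
qed

end

context hecke_pair
begin

lemma product_in_coset_iff:
  assumes D: "D \<in> double_cosets G \<Gamma>" and w: "w \<in> carrier G" and c: "c \<in> rcosets \<Gamma>" and \<theta>: "\<theta> \<in> c"
  shows "(\<exists>\<theta>\<^sub>1\<in>D. \<exists>\<theta>\<^sub>2\<in>c. w = \<theta>\<^sub>1 \<otimes> \<theta>\<^sub>2) \<longleftrightarrow> w \<otimes> inv \<theta> \<in> D"
proof
  have \<theta>c: "\<theta> \<in> carrier G" using coset_carrier[OF c \<theta>] .
  assume "\<exists>\<theta>\<^sub>1\<in>D. \<exists>\<theta>\<^sub>2\<in>c. w = \<theta>\<^sub>1 \<otimes> \<theta>\<^sub>2"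
  then obtain x y where xy: "x \<in> D" "y \<in> c" "w = x \<otimes> y" by blast
  obtain \<gamma> where \<gamma>: "\<gamma> \<in> \<Gamma>" "y = \<gamma> \<otimes> \<theta>" using coset_eq[OF c \<theta>] xy(2) coset_mem by blast
  have "w \<otimes> inv \<theta> = x \<otimes> \<gamma>"
    using xy \<gamma> \<theta>c dcoset_carrier[OF D xy(1)] by (simp add: m_assoc)
  then show "w \<otimes> inv \<theta> \<in> D" using dcoset_right[OF D xy(1) \<gamma>(1)] by simp
next
  have \<theta>c: "\<theta> \<in> carrier G" using coset_carrier[OF c \<theta>] .
  assume "w \<otimes> inv \<theta> \<in> D"
  moreover have "w = (w \<otimes> inv \<theta>) \<otimes> \<theta>" using w \<theta>c by (simp add: m_assoc)
  ultimately show "\<exists>\<theta>\<^sub>1\<in>D. \<exists>\<theta>\<^sub>2\<in>c. w = \<theta>\<^sub>1 \<otimes> \<theta>\<^sub>2" using \<theta> by blast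
qed

lemma hecke_const_count:
  assumes D1: "D1 \<in> double_cosets G \<Gamma>" and D2: "D2 \<in> double_cosets G \<Gamma>"
    and c: "c \<in> rcosets \<Gamma>" and k: "k \<in> rcosets \<Gamma>" and h: "h \<in> c" and z: "z \<in> k"
  shows "card {c1 \<in> rcosets \<Gamma>. hecke_rel D1 c1 k \<and> hecke_rel D2 c c1}
    = hecke_const G \<Gamma> D1 D2 (z \<otimes> inv h)"
proof -
  have hc: "h \<in> carrier G" using coset_carrier[OF c h] .
  have zc: "z \<in> carrier G" using coset_carrier[OF k z] .
  let ?P = "\<lambda>c2. \<exists>\<theta>\<^sub>1\<in>D1. \<exists>\<theta>\<^sub>2\<in>c2. z \<otimes> inv h = \<theta>\<^sub>1 \<otimes> \<theta>\<^sub>2"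
  have P: "?P (c1 #> inv h) \<longleftrightarrow> hecke_rel D1 c1 k" if c1: "c1 \<in> rcosets \<Gamma>" for c1
  proof -
    obtain u where u: "u \<in> c1" using coset_nonempty[OF c1] by blast
    have uc: "u \<in> carrier G" using coset_carrier[OF c1 u] .
    have e: "c1 #> inv h = \<Gamma> #> (u \<otimes> inv h)" using coset_translate[OF c1 u] hc by simp
    have "?P (c1 #> inv h) \<longleftrightarrow> (z \<otimes> inv h) \<otimes> inv (u \<otimes> inv h) \<in> D1"
      by (rule product_in_coset_iff[OF D1]) (use e uc hc zc in auto)
    also have "(z \<otimes> inv h) \<otimes> inv (u \<otimes> inv h) = z \<otimes> inv u"
      using uc hc zc r_cancel_inv[of "inv h" "inv u"] by (simp add: inv_mult_group m_assoc)
    also have "z \<otimes> inv u \<in> D1 \<longleftrightarrow> hecke_rel D1 c1 k" by (rule hecke_rel_iff[OF D1 c1 k u z, symmetric])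
    finally show ?thesis .
  qed
  note b = bij_translate[OF D2 c h]
  have inj: "inj_on (\<lambda>k. k #> inv h) {c1 \<in> rcosets \<Gamma>. hecke_rel D1 c1 k \<and> hecke_rel D2 c c1}"
    using bij_betw_imp_inj_on[OF b] by (rule inj_on_subset) blast
  have "(\<lambda>k. k #> inv h) ` {c1 \<in> rcosets \<Gamma>. hecke_rel D1 c1 k \<and> hecke_rel D2 c c1}
      = {c2 \<in> cosets_in G \<Gamma> D2. ?P c2}"
  proof (intro equalityI subsetI)
    fix y assume "y \<in> (\<lambda>k. k #> inv h) ` {c1 \<in> rcosets \<Gamma>. hecke_rel D1 c1 k \<and> hecke_rel D2 c c1}"
    then obtain c1 where c1: "c1 \<in> rcosets \<Gamma>" "hecke_rel D1 c1 k" "hecke_rel D2 c c1" "y = c1 #> inv h"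
      by blast
    then have "y \<in> cosets_in G \<Gamma> D2" using bij_betw_imp_surj_on[OF b] by blast
    then show "y \<in> {c2 \<in> cosets_in G \<Gamma> D2. ?P c2}" using P[OF c1(1)] c1 by simp
  next
    fix y assume y: "y \<in> {c2 \<in> cosets_in G \<Gamma> D2. ?P c2}"
    then obtain c1 where c1: "c1 \<in> rcosets \<Gamma>" "hecke_rel D2 c c1" "y = c1 #> inv h"
      using bij_betw_imp_surj_on[OF b] by blast
    then have "hecke_rel D1 c1 k" using y P[OF c1(1)] by simp
    then show "y \<in> (\<lambda>k. k #> inv h) ` {c1 \<in> rcosets \<Gamma>. hecke_rel D1 c1 k \<and> hecke_rel D2 c c1}"
      using c1 by blast
  qed
  then show ?thesis unfolding hecke_const_def using card_image[OF inj] by simp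
qed

lemma hecke_const_cong:
  assumes D1: "D1 \<in> double_cosets G \<Gamma>" and D2: "D2 \<in> double_cosets G \<Gamma>"
    and E: "E \<in> double_cosets G \<Gamma>" and w: "w \<in> E" and w': "w' \<in> E"
  shows "hecke_const G \<Gamma> D1 D2 w = hecke_const G \<Gamma> D1 D2 w'"
proof -
  have wc: "w \<in> carrier G" using dcoset_carrier[OF E w] .
  obtain \<gamma> \<delta> where gd: "\<gamma> \<in> \<Gamma>" "\<delta> \<in> \<Gamma>" "w' = \<gamma> \<otimes> w \<otimes> \<delta>"
    using w' dcoset_eq[OF E w] dcoset_mem by blast
  have G1: "\<Gamma> \<in> rcosets \<Gamma>" using coset_of[OF one_closed] Gamma_carrier by simp
  have kw: "\<Gamma> #> w \<in> rcosets \<Gamma>" using wc by simp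
  have zk: "\<gamma> \<otimes> w \<in> \<Gamma> #> w" using gd(1) coset_mem by blast
  have "hecke_const G \<Gamma> D1 D2 (w \<otimes> inv \<one>) = hecke_const G \<Gamma> D1 D2 (\<gamma> \<otimes> w \<otimes> inv (inv \<delta>))"
    using hecke_const_count[OF D1 D2 G1 kw Gamma_closed(1) self_coset[OF wc]]
      hecke_const_count[OF D1 D2 G1 kw Gamma_closed(2)[OF gd(2)] zk] by simp
  then show ?thesis using gd wc by simp
qed

lemma hecke_const_finite:
  assumes D1: "D1 \<in> double_cosets G \<Gamma>" and D2: "D2 \<in> double_cosets G \<Gamma>"
  shows "finite {E \<in> double_cosets G \<Gamma>. hecke_const G \<Gamma> D1 D2 (SOME z. z \<in> E) \<noteq> 0}"
proof (rule finite_subset)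
  let ?r = "\<lambda>c. SOME h. h \<in> c"
  show "finite ((\<lambda>(c1, c2). (c1 #> ?r c2) <#> \<Gamma>) ` (cosets_in G \<Gamma> D1 \<times> cosets_in G \<Gamma> D2))"
    using finite_cosets_in[OF D1] finite_cosets_in[OF D2] by simp
  show "{E \<in> double_cosets G \<Gamma>. hecke_const G \<Gamma> D1 D2 (SOME z. z \<in> E) \<noteq> 0}
    \<subseteq> (\<lambda>(c1, c2). (c1 #> ?r c2) <#> \<Gamma>) ` (cosets_in G \<Gamma> D1 \<times> cosets_in G \<Gamma> D2)"
  proof
    fix E assume "E \<in> {E \<in> double_cosets G \<Gamma>. hecke_const G \<Gamma> D1 D2 (SOME z. z \<in> E) \<noteq> 0}"
    then have E: "E \<in> double_cosets G \<Gamma>" "hecke_const G \<Gamma> D1 D2 (SOME z. z \<in> E) \<noteq> 0" by auto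
    define w where "w = (SOME z. z \<in> E)"
    have w: "w \<in> E" unfolding w_def by (rule some_in_dcoset[OF E(1)])
    have wc: "w \<in> carrier G" by (rule dcoset_carrier[OF E(1) w])
    have "{c \<in> cosets_in G \<Gamma> D2. \<exists>\<theta>\<^sub>1\<in>D1. \<exists>\<theta>\<^sub>2\<in>c. w = \<theta>\<^sub>1 \<otimes> \<theta>\<^sub>2} \<noteq> {}"
      using E(2) unfolding hecke_const_def w_def[symmetric] by (metis (no_types, lifting) card.empty)
    then obtain c2 where c2: "c2 \<in> cosets_in G \<Gamma> D2" "\<exists>\<theta>\<^sub>1\<in>D1. \<exists>\<theta>\<^sub>2\<in>c2. w = \<theta>\<^sub>1 \<otimes> \<theta>\<^sub>2" by blast
    have c2r: "c2 \<in> rcosets \<Gamma>" using c2(1) by (simp add: cosets_in_def)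
    define h where "h = ?r c2"
    have h: "h \<in> c2" unfolding h_def by (rule some_in_coset[OF c2r])
    have hc: "h \<in> carrier G" by (rule coset_carrier[OF c2r h])
    have wh: "w \<otimes> inv h \<in> D1" using product_in_coset_iff[OF D1 wc c2r h] c2(2) by blast
    have "(\<Gamma> #> (w \<otimes> inv h)) #> h = \<Gamma> #> w"
      using wc hc Gamma_carrier by (simp add: coset_mult_assoc m_assoc)
    then have "E = ((\<Gamma> #> (w \<otimes> inv h)) #> ?r c2) <#> \<Gamma>"
      using dcoset_eq[OF E(1) w] by (simp add: h_def)
    moreover have "\<Gamma> #> (w \<otimes> inv h) \<in> cosets_in G \<Gamma> D1"
      using wh wc hc coset_subset[OF D1, of "w \<otimes> inv h"] by (simp add: cosets_in_def)
    ultimately show "E \<in> (\<lambda>(c1, c2). (c1 #> ?r c2) <#> \<Gamma>) ` (cosets_in G \<Gamma> D1 \<times> cosets_in G \<Gamma> D2)"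
      using c2(1) by (intro image_eqI[of _ _ "(\<Gamma> #> (w \<otimes> inv h), c2)"]) auto
  qed
qed

theorem hecke_mult_closed:
  assumes a: "a \<in> hecke_algebra G \<Gamma>" and b: "b \<in> hecke_algebra G \<Gamma>"
  shows "hecke_mult G \<Gamma> a b \<in> hecke_algebra G \<Gamma>"
proof -
  have fin: "finite {D. a D \<noteq> 0}" "finite {D. b D \<noteq> 0}"
    and dc: "\<And>D. a D \<noteq> 0 \<Longrightarrow> D \<in> double_cosets G \<Gamma>" "\<And>D. b D \<noteq> 0 \<Longrightarrow> D \<in> double_cosets G \<Gamma>"
    using a b by (auto simp: hecke_algebra_def)
  have "{E. hecke_mult G \<Gamma> a b E \<noteq> 0} \<subseteq> (\<Union>D1\<in>{D. a D \<noteq> 0}. \<Union>D2\<in>{D. b D \<noteq> 0}.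
      {E \<in> double_cosets G \<Gamma>. hecke_const G \<Gamma> D1 D2 (SOME z. z \<in> E) \<noteq> 0})" (is "_ \<subseteq> ?U")
  proof
    fix E assume "E \<in> {E. hecke_mult G \<Gamma> a b E \<noteq> 0}"
    then have E: "E \<in> double_cosets G \<Gamma>" "(\<Sum>D1 | a D1 \<noteq> 0. \<Sum>D2 | b D2 \<noteq> 0.
       a D1 * b D2 * of_nat (hecke_const G \<Gamma> D1 D2 (SOME z. z \<in> E))) \<noteq> 0"
      by (auto simp: hecke_mult_def split: if_splits)
    from E(2) obtain D1 where D1: "D1 \<in> {D. a D \<noteq> 0}"
      "(\<Sum>D2 | b D2 \<noteq> 0. a D1 * b D2 * of_nat (hecke_const G \<Gamma> D1 D2 (SOME z. z \<in> E))) \<noteq> 0"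
      by (rule sum.not_neutral_contains_not_neutral)
    from D1(2) obtain D2 where D2: "D2 \<in> {D. b D \<noteq> 0}"
      "a D1 * b D2 * of_nat (hecke_const G \<Gamma> D1 D2 (SOME z. z \<in> E)) \<noteq> 0"
      by (rule sum.not_neutral_contains_not_neutral)
    then have "hecke_const G \<Gamma> D1 D2 (SOME z. z \<in> E) \<noteq> 0" by (metis mult_zero_right of_nat_0)
    then show "E \<in> ?U" using D1(1) D2(1) E(1) by blast
  qed
  moreover have "finite ?U"
    using fin dc by (intro finite_UN_I hecke_const_finite) auto
  ultimately have "finite {E. hecke_mult G \<Gamma> a b E \<noteq> 0}" by (rule finite_subset)
  then show ?thesis unfolding hecke_algebra_def by (auto simp: hecke_mult_def split: if_splits)
qed

theorem hecke_rep_mult: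
  assumes a: "a \<in> hecke_algebra G \<Gamma>" and b: "b \<in> hecke_algebra G \<Gamma>"
  shows "hecke_rep G \<Gamma> (hecke_mult G \<Gamma> a b)
    = op_comp (rcosets \<Gamma>) (hecke_rep G \<Gamma> a) (hecke_rep G \<Gamma> b)"
proof
  fix f
  let ?R = "rcosets \<Gamma>" and ?m = "hecke_mult G \<Gamma> a b"
  show "hecke_rep G \<Gamma> ?m f = op_comp ?R (hecke_rep G \<Gamma> a) (hecke_rep G \<Gamma> b) f"
  proof (cases "f \<in> ell2 ?R")
    case False
    then show ?thesis by (simp add: op_comp_def compose_def hecke_rep_def)
  next
    case f: True
    note m = hecke_mult_closed[OF a b]
    define A B M where "A = {D. a D \<noteq> 0}" and "B = {D. b D \<noteq> 0}" and "M = {D. ?m D \<noteq> 0}"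
    have fin: "finite A" "finite B" "finite M" and
      dc: "\<And>D. D \<in> A \<Longrightarrow> D \<in> double_cosets G \<Gamma>" "\<And>D. D \<in> B \<Longrightarrow> D \<in> double_cosets G \<Gamma>"
        "\<And>D. D \<in> M \<Longrightarrow> D \<in> double_cosets G \<Gamma>"
      using a b m by (auto simp: hecke_algebra_def A_def B_def M_def)
    have bf: "hecke_rep G \<Gamma> b f \<in> ell2 ?R"
      using hecke_rep_bounded[OF b] f by (auto simp: bounded_ops_def)
    have comp: "op_comp ?R (hecke_rep G \<Gamma> a) (hecke_rep G \<Gamma> b) f
        = (\<lambda>k. \<Sum>D1\<in>A. a D1 * single_rep D1 (hecke_rep G \<Gamma> b f) k)"
      using f hecke_rep_single[OF a bf] by (simp add: op_comp_def compose_def A_def)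
    have lhs: "hecke_rep G \<Gamma> ?m f = (\<lambda>k. \<Sum>E\<in>M. ?m E * single_rep E f k)"
      using hecke_rep_single[OF m f] by (simp add: M_def)
    have "(\<Sum>E\<in>M. ?m E * single_rep E f k) = (\<Sum>D1\<in>A. a D1 * single_rep D1 (hecke_rep G \<Gamma> b f) k)" for k
    proof (cases "k \<in> ?R")
      case False
      then show ?thesis by (simp add: single_rep_def)
    next
      case k: True
      obtain z where z: "z \<in> k" using coset_nonempty[OF k] by blast
      have zc: "z \<in> carrier G" using coset_carrier[OF k z] .
      define L where "L = (\<lambda>D k. {c \<in> ?R. hecke_rel D c k})"
      have finL: "finite (L D k)" if "D \<in> double_cosets G \<Gamma>" "k \<in> ?R" for D k
        unfolding L_def by (rule card_rel_left(1)[OF that])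
      define C where "C = (\<Union>E\<in>M. L E k) \<union> (\<Union>D1\<in>A. \<Union>c1\<in>L D1 k. \<Union>D2\<in>B. L D2 c1)"
      have L_R: "c \<in> ?R" if "c \<in> L D k" for c D k using that by (simp add: L_def)
      have "finite (\<Union>E\<in>M. L E k)" using fin dc k by (intro finite_UN_I finL) auto
      moreover have "finite (\<Union>D1\<in>A. \<Union>c1\<in>L D1 k. \<Union>D2\<in>B. L D2 c1)"
      proof (intro finite_UN_I)
        show "finite A" "finite B" by fact+
        fix D1 assume "D1 \<in> A" then show "finite (L D1 k)" using dc k finL by blast
        fix c1 D2 assume "c1 \<in> L D1 k" "D2 \<in> B" then show "finite (L D2 c1)" using dc L_R finL by blast
      qed
      ultimately have C: "finite C" unfolding C_def by simp
      have CR: "C \<subseteq> ?R" unfolding C_def using L_R by blast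
      define h where "h = (\<lambda>c. SOME h. h \<in> (c :: 'a set))"
      have h: "h c \<in> c" if "c \<in> ?R" for c unfolding h_def by (rule some_in_coset[OF that])
      have hc: "h c \<in> carrier G" if "c \<in> ?R" for c by (rule coset_carrier[OF that h[OF that]])
      define E where "E = (\<lambda>c. (\<Gamma> #> (z \<otimes> inv h c)) <#> \<Gamma>)"
      have E: "E c \<in> double_cosets G \<Gamma>" "z \<otimes> inv h c \<in> E c" if "c \<in> ?R" for c
        unfolding E_def using zc hc[OF that] by simp_all
      have mE: "?m (E c) = (\<Sum>D1\<in>A. \<Sum>D2\<in>B. a D1 * b D2 * of_nat (hecke_const G \<Gamma> D1 D2 (z \<otimes> inv h c)))"
        if c: "c \<in> ?R" for c
      proof -
        have "?m (E c) = (\<Sum>D1\<in>A. \<Sum>D2\<in>B. a D1 * b D2 * of_nat (hecke_const G \<Gamma> D1 D2 (SOME z. z \<in> E c)))"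
          using E(1)[OF c] by (simp add: hecke_mult_def A_def B_def)
        also have "\<dots> = (\<Sum>D1\<in>A. \<Sum>D2\<in>B. a D1 * b D2 * of_nat (hecke_const G \<Gamma> D1 D2 (z \<otimes> inv h c)))"
          using hecke_const_cong[OF dc(1) dc(2) E(1)[OF c] some_in_dcoset[OF E(1)[OF c]] E(2)[OF c]]
          by (intro sum.cong refl) simp
        finally show ?thesis .
      qed
      have "(\<Sum>E\<in>M. ?m E * single_rep E f k) = (\<Sum>E\<in>M. \<Sum>c\<in>{c. c \<in> C \<and> hecke_rel E c k}. ?m E * f c)"
      proof (rule sum.cong[OF refl])
        fix E assume "E \<in> M"
        then have "{c. c \<in> ?R \<and> hecke_rel E c k} = {c. c \<in> C \<and> hecke_rel E c k}"
          using CR by (auto simp: C_def L_def)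
        then show "?m E * single_rep E f k = (\<Sum>c\<in>{c. c \<in> C \<and> hecke_rel E c k}. ?m E * f c)"
          using k by (simp add: single_rep_def sum_distrib_left)
      qed
      also have "\<dots> = (\<Sum>c\<in>C. \<Sum>E\<in>{E. E \<in> M \<and> hecke_rel E c k}. ?m E * f c)"
        by (rule sum.swap_restrict[OF fin(3) C])
      also have "\<dots> = (\<Sum>c\<in>C. ?m (E c) * f c)"
      proof (rule sum.cong[OF refl])
        fix c assume "c \<in> C"
        then have c: "c \<in> ?R" using CR by blast
        have "hecke_rel F c k \<longleftrightarrow> F = E c" if "F \<in> M" for F
          unfolding hecke_rel_iff[OF dc(3)[OF that] c k h[OF c] z] E_def
          using dcoset_unique[OF _ dc(3)[OF that]] zc hc[OF c] by simp
        then have "{F. F \<in> M \<and> hecke_rel F c k} = (if E c \<in> M then {E c} else {})" by auto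
        then show "(\<Sum>F\<in>{F. F \<in> M \<and> hecke_rel F c k}. ?m F * f c) = ?m (E c) * f c"
          by (simp add: M_def)
      qed
      also have "\<dots> = (\<Sum>c\<in>C. \<Sum>D1\<in>A. \<Sum>D2\<in>B. a D1 * b D2 *
          of_nat (hecke_const G \<Gamma> D1 D2 (z \<otimes> inv h c)) * f c)"
        using mE CR by (intro sum.cong refl) (auto simp: sum_distrib_right)
      also have "\<dots> = (\<Sum>D1\<in>A. \<Sum>c\<in>C. \<Sum>D2\<in>B. a D1 * b D2 *
          of_nat (hecke_const G \<Gamma> D1 D2 (z \<otimes> inv h c)) * f c)"
        by (rule sum.swap)
      also have "\<dots> = (\<Sum>D1\<in>A. a D1 * single_rep D1 (hecke_rep G \<Gamma> b f) k)"
      proof (rule sum.cong[OF refl])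
        fix D1 assume D1: "D1 \<in> A"
        have "single_rep D1 (hecke_rep G \<Gamma> b f) k = (\<Sum>c1\<in>L D1 k. \<Sum>D2\<in>B. b D2 * single_rep D2 f c1)"
          using k by (simp add: single_rep_def L_def hecke_rep_single[OF b f] B_def)
        also have "\<dots> = (\<Sum>D2\<in>B. \<Sum>c1\<in>L D1 k. b D2 * single_rep D2 f c1)" by (rule sum.swap)
        also have "\<dots> = (\<Sum>D2\<in>B. \<Sum>c\<in>C. b D2 * of_nat (hecke_const G \<Gamma> D1 D2 (z \<otimes> inv h c)) * f c)"
        proof (rule sum.cong[OF refl])
          fix D2 assume D2: "D2 \<in> B"
          have "(\<Sum>c1\<in>L D1 k. b D2 * single_rep D2 f c1)
              = (\<Sum>c1\<in>L D1 k. \<Sum>c\<in>{c. c \<in> C \<and> hecke_rel D2 c c1}. b D2 * f c)"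
          proof (rule sum.cong[OF refl])
            fix c1 assume c1: "c1 \<in> L D1 k"
            then have "{c. c \<in> ?R \<and> hecke_rel D2 c c1} = {c. c \<in> C \<and> hecke_rel D2 c c1}"
              using CR D1 D2 by (auto simp: C_def L_def)
            then show "b D2 * single_rep D2 f c1 = (\<Sum>c\<in>{c. c \<in> C \<and> hecke_rel D2 c c1}. b D2 * f c)"
              using L_R[OF c1] by (simp add: single_rep_def sum_distrib_left)
          qed
          also have "\<dots> = (\<Sum>c\<in>C. \<Sum>c1\<in>{c1. c1 \<in> L D1 k \<and> hecke_rel D2 c c1}. b D2 * f c)"
            by (rule sum.swap_restrict[OF finL[OF dc(1)[OF D1] k] C])
          also have "\<dots> = (\<Sum>c\<in>C. b D2 * of_nat (hecke_const G \<Gamma> D1 D2 (z \<otimes> inv h c)) * f c)"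
          proof (rule sum.cong[OF refl])
            fix c assume "c \<in> C"
            then have c: "c \<in> ?R" using CR by blast
            have "{c1. c1 \<in> L D1 k \<and> hecke_rel D2 c c1} = {c1 \<in> ?R. hecke_rel D1 c1 k \<and> hecke_rel D2 c c1}"
              by (auto simp: L_def)
            then have "card {c1. c1 \<in> L D1 k \<and> hecke_rel D2 c c1} = hecke_const G \<Gamma> D1 D2 (z \<otimes> inv h c)"
              using hecke_const_count[OF dc(1)[OF D1] dc(2)[OF D2] c k h[OF c] z] by simp
            then show "(\<Sum>c1\<in>{c1. c1 \<in> L D1 k \<and> hecke_rel D2 c c1}. b D2 * f c)
                = b D2 * of_nat (hecke_const G \<Gamma> D1 D2 (z \<otimes> inv h c)) * f c"
              by simp
          qed
          finally show "(\<Sum>c1\<in>L D1 k. b D2 * single_rep D2 f c1)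
            = (\<Sum>c\<in>C. b D2 * of_nat (hecke_const G \<Gamma> D1 D2 (z \<otimes> inv h c)) * f c)" .
        qed
        also have "\<dots> = (\<Sum>c\<in>C. \<Sum>D2\<in>B. b D2 * of_nat (hecke_const G \<Gamma> D1 D2 (z \<otimes> inv h c)) * f c)"
          by (rule sum.swap)
        finally show "(\<Sum>c\<in>C. \<Sum>D2\<in>B. a D1 * b D2 * of_nat (hecke_const G \<Gamma> D1 D2 (z \<otimes> inv h c)) * f c)
            = a D1 * single_rep D1 (hecke_rep G \<Gamma> b f) k"
          by (simp add: sum_distrib_left mult.assoc)
      qed
      finally show ?thesis .
    qed
    then show ?thesis unfolding lhs comp by (rule ext)
  qed
qed

lemma double_coset_one: "\<Gamma> \<in> double_cosets G \<Gamma>"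
proof -
  have "(\<Gamma> #> \<one>) <#> \<Gamma> = \<Gamma>"
  proof (intro equalityI subsetI)
    fix x assume "x \<in> (\<Gamma> #> \<one>) <#> \<Gamma>"
    then obtain \<gamma> \<delta> where "\<gamma> \<in> \<Gamma>" "\<delta> \<in> \<Gamma>" "x = \<gamma> \<otimes> \<one> \<otimes> \<delta>" unfolding dcoset_mem by blast
    then show "x \<in> \<Gamma>" by simp
  next
    fix x assume x: "x \<in> \<Gamma>"
    then have "x = x \<otimes> \<one> \<otimes> \<one>" by simp
    then show "x \<in> (\<Gamma> #> \<one>) <#> \<Gamma>" unfolding dcoset_mem using x Gamma_closed(1) by blast
  qed
  then show ?thesis using dcoset_of[OF one_closed] by simp
qed

lemma hecke_delta_closed: "D \<in> double_cosets G \<Gamma> \<Longrightarrow> ell2_delta D \<in> hecke_algebra G \<Gamma>"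
  by (auto simp: hecke_algebra_def ell2_delta_def)

theorem hecke_rep_one: "hecke_rep G \<Gamma> (ell2_delta \<Gamma>) = op_id (rcosets \<Gamma>)"
proof
  fix f show "hecke_rep G \<Gamma> (ell2_delta \<Gamma>) f = op_id (rcosets \<Gamma>) f"
  proof (cases "f \<in> ell2 (rcosets \<Gamma>)")
    case False
    then show ?thesis by (simp add: op_id_def hecke_rep_def)
  next
    case f: True
    have supp: "{D. ell2_delta \<Gamma> D \<noteq> 0} = {\<Gamma>}" by (auto simp: ell2_delta_def)
    have "single_rep \<Gamma> f k = f k" for k
    proof (cases "k \<in> rcosets \<Gamma>")
      case False
      then show ?thesis using f by (simp add: single_rep_def ell2_def)
    next
      case k: True
      have "hecke_rel \<Gamma> c k \<longleftrightarrow> c = k" if c: "c \<in> rcosets \<Gamma>" for c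
      proof -
        obtain x where x: "x \<in> c" using coset_nonempty[OF c] by blast
        obtain z where z: "z \<in> k" using coset_nonempty[OF k] by blast
        have xz: "x \<in> carrier G" "z \<in> carrier G" using coset_carrier c k x z by blast+
        have "z \<otimes> inv x \<in> \<Gamma> \<longleftrightarrow> z \<in> \<Gamma> #> x"
        proof
          assume "z \<otimes> inv x \<in> \<Gamma>"
          moreover have "z = (z \<otimes> inv x) \<otimes> x" using xz by (simp add: m_assoc)
          ultimately show "z \<in> \<Gamma> #> x" unfolding coset_mem by blast
        next
          assume "z \<in> \<Gamma> #> x"
          then obtain \<gamma> where "\<gamma> \<in> \<Gamma>" "z = \<gamma> \<otimes> x" unfolding coset_mem by blast
          then show "z \<otimes> inv x \<in> \<Gamma>" using xz by (simp add: m_assoc)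
        qed
        also have "\<dots> \<longleftrightarrow> c = k" using coset_eq[OF c x] coset_eq[OF k z] coset_eq[OF c] z by metis
        finally show ?thesis using hecke_rel_iff[OF double_coset_one c k x z] by simp
      qed
      then have "{c. c \<in> rcosets \<Gamma> \<and> hecke_rel \<Gamma> c k} = {k}" using k by blast
      then show ?thesis using k by (simp add: single_rep_def)
    qed
    then show ?thesis
      using hecke_rep_single[OF hecke_delta_closed[OF double_coset_one] f] f
      by (simp add: supp op_id_def) (simp add: ell2_delta_def)
  qed
qed

theorem hecke_rep_basis:
  assumes D: "D \<in> double_cosets G \<Gamma>" and h: "h \<in> carrier G"
  shows "hecke_rep G \<Gamma> (ell2_delta D) (ell2_delta (\<Gamma> #> h))
    = (\<lambda>k. \<Sum>c\<in>cosets_in G \<Gamma> D. ell2_delta (c #> h) k)"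
proof
  fix k
  let ?c = "\<Gamma> #> h"
  have supp: "{E. ell2_delta D E \<noteq> 0} = {D}" by (auto simp: ell2_delta_def)
  have c: "?c \<in> rcosets \<Gamma>" using h by simp
  have "hecke_rep G \<Gamma> (ell2_delta D) (ell2_delta ?c) k = single_rep D (ell2_delta ?c) k"
    using hecke_rep_single[OF hecke_delta_closed[OF D] ell2_delta_mem[OF c]]
    by (simp add: supp) (simp add: ell2_delta_def)
  also have "\<dots> = (if k \<in> rcosets \<Gamma> \<and> hecke_rel D ?c k then 1 else 0)"
    using card_rel_left(1)[OF D] c by (auto simp: single_rep_def ell2_delta_def)
  also have "\<dots> = (\<Sum>k'\<in>{k \<in> rcosets \<Gamma>. hecke_rel D ?c k}. if k = k' then 1 else 0)"
    using card_rel_right(1)[OF D c] by (subst sum.delta') auto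
  also have "\<dots> = (\<Sum>k'\<in>{k \<in> rcosets \<Gamma>. hecke_rel D ?c k}. ell2_delta (k' #> inv h #> h) k)"
  proof (rule sum.cong[OF refl])
    fix k' assume "k' \<in> {k \<in> rcosets \<Gamma>. hecke_rel D ?c k}"
    then have "k' \<subseteq> carrier G" using rcosets_part_G[OF sub] by auto
    then show "(if k = k' then 1 else 0) = ell2_delta (k' #> inv h #> h) k"
      using h by (simp add: coset_mult_assoc ell2_delta_def)
  qed
  also have "\<dots> = (\<Sum>c\<in>cosets_in G \<Gamma> D. ell2_delta (c #> h) k)"
    by (rule sum.reindex_bij_betw[OF bij_translate[OF D c self_coset[OF h]]])
  finally show "hecke_rep G \<Gamma> (ell2_delta D) (ell2_delta ?c) k
    = (\<Sum>c\<in>cosets_in G \<Gamma> D. ell2_delta (c #> h) k)" .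
qed

end

end

theory Submission
  imports Defs
begin

text \<open>
  The map \<open>\<delta>\<^sub>g \<mapsto> \<pi>(g\<^sup>-\<^sup>1)e \<otimes> [\<Gamma>g]\<close> extends to a unitary \<open>W\<close> from \<open>\<ell>\<^sup>2(G)\<close> onto
  \<open>\<ell>\<^sup>2(\<Gamma>) \<otimes> \<ell>\<^sup>2(\<Gamma>\G)\<close>: over a fixed coset \<open>\<Gamma>g\<close> the vectors
  \<open>\<pi>((\<gamma>g)\<^sup>-\<^sup>1)e = \<pi>(g\<^sup>-\<^sup>1)\<delta>\<^bsub>\<gamma>\<^sup>-\<^sup>1\<^esub>\<close> form an orthonormal basis because \<open>\<pi>\<close> restricts to the regular
  representation. Hence \<open>\<rho>(x) = W\<^sup>-\<^sup>1(1 \<otimes> x)W\<close> is a spatial, so normal and injective,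
  unital *-homomorphism on all of \<open>B(\<ell>\<^sup>2(\<Gamma>\G))\<close>. Its matrix entries are
  \<open>\<langle>\<rho>(x)\<delta>\<^sub>g, \<delta>\<^sub>h\<rangle> = t(hg\<^sup>-\<^sup>1) \<langle>x[\<Gamma>g], [\<Gamma>h]\<rangle>\<close>. Elements of the Hecke von Neumann algebra commute with right
  translations, so for them this depends on \<open>hg\<^sup>-\<^sup>1\<close> only and \<open>\<rho>(x)\<close> is a left convolver; for
  \<open>x = [\<Gamma>\<sigma>\<Gamma>]\<close> its symbol is \<open>t\<^sup>\<alpha>\<close>. Finally \<open>W t\<^sup>c = e \<otimes> [c]\<close>, so \<open>W\<close> carries \<open>K\<close> onto
  \<open>e \<otimes> \<ell>\<^sup>2(\<Gamma>\G)\<close>.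
\<close>

section \<open>Hilbert space facts\<close>

lemma ell2_outside: "f \<in> ell2 X \<Longrightarrow> x \<notin> X \<Longrightarrow> f x = 0"
  by (simp add: ell2_def)

lemma ell2_summable: "f \<in> ell2 X \<Longrightarrow> (\<lambda>x. (cmod (f x))\<^sup>2) summable_on X"
  by (simp add: ell2_def)

lemma ell2_norm_nonneg: "0 \<le> ell2_norm X f"
  by (simp add: ell2_norm_def ell2_sq_nonneg)

lemma ell2_norm_power2: "(ell2_norm X f)\<^sup>2 = ell2_sq X f"
  by (simp add: ell2_norm_def ell2_sq_nonneg)

lemma ell2_inner_self:
  assumes "f \<in> ell2 X" shows "ell2_inner X f f = of_real ((ell2_norm X f)\<^sup>2)"
proof -
  have "((\<lambda>x. of_real ((cmod (f x))\<^sup>2) :: complex) has_sum of_real (ell2_sq X f)) X"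
    by (intro has_sum_of_real has_sum_infsum ell2_summable assms)
  then show ?thesis
    unfolding ell2_inner_def ell2_norm_power2 complex_norm_square by (rule infsumI)
qed

lemma ell2_diff:
  assumes "f \<in> ell2 X" "g \<in> ell2 X" shows "(\<lambda>x. f x - g x) \<in> ell2 X"
  using ell2_add(1)[OF assms(1) ell2_scale(1)[OF assms(2), of "-1"]] by simp

lemma ell2_sum:
  assumes "finite A" "\<And>i. i \<in> A \<Longrightarrow> v i \<in> ell2 X"
  shows "(\<lambda>x. \<Sum>i\<in>A. a i * v i x) \<in> ell2 X"
  using assms
proof (induction A rule: finite_induct)
  case (insert j A)
  then have "(\<lambda>x. a j * v j x + (\<Sum>i\<in>A. a i * v i x)) \<in> ell2 X"
    by (intro ell2_add(1) ell2_scale(1)) auto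
  then show ?case using insert by simp
qed (simp add: ell2_zero)

lemma ell2_point_bound:
  assumes "f \<in> ell2 X" shows "cmod (f x) \<le> ell2_norm X f"
proof (cases "x \<in> X")
  case True
  have "(\<Sum>y\<in>{x}. (cmod (f y))\<^sup>2) \<le> ell2_sq X f"
    using True assms by (intro finite_sum_le_infsum ell2_summable) auto
  then show ?thesis unfolding ell2_norm_def by (simp add: real_le_rsqrt)
qed (simp add: ell2_outside[OF assms] ell2_norm_nonneg)

lemma ell2_norm_eq_0:
  assumes "f \<in> ell2 X" "ell2_norm X f = 0" shows "f = (\<lambda>x. 0)"
proof
  fix x show "f x = 0" using ell2_point_bound[OF assms(1), of x] assms(2) by simp
qed

lemma ell2_inner_add_left:
  assumes "f \<in> ell2 X" "g \<in> ell2 X" "h \<in> ell2 X"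
  shows "ell2_inner X (\<lambda>x. f x + g x) h = ell2_inner X f h + ell2_inner X g h"
  unfolding ell2_inner_def distrib_right using assms
  by (intro infsum_add ell2_inner_summable)

lemma ell2_inner_scale_left: "ell2_inner X (\<lambda>x. c * f x) h = c * ell2_inner X f h"
  unfolding ell2_inner_def mult.assoc by (rule infsum_cmult_right')

lemma ell2_inner_delta_right: "x \<in> X \<Longrightarrow> ell2_inner X f (ell2_delta x) = f x"
  by (subst ell2_inner_cnj) (simp add: ell2_inner_delta)

text \<open>Passes to finite partial sums, where the finite-dimensional inequality applies and each
  factor is bounded by the full norm.\<close>

lemma ell2_cauchy_schwarz:
  assumes f: "f \<in> ell2 X" and g: "g \<in> ell2 X"
  shows "cmod (ell2_inner X f g) \<le> ell2_norm X f * ell2_norm X g"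
proof -
  have "cmod (ell2_inner X f g) \<le> (\<Sum>\<^sub>\<infinity>x\<in>X. cmod (f x * cnj (g x)))"
    unfolding ell2_inner_def using ell2_inner_abs[OF f g]
    by (intro norm_infsum_bound) (simp add: norm_mult)
  also have "\<dots> = (\<Sum>\<^sub>\<infinity>x\<in>X. cmod (f x) * cmod (g x))" by (simp add: norm_mult)
  also have "\<dots> \<le> ell2_norm X f * ell2_norm X g"
  proof (rule infsum_le_finite_sums[OF ell2_inner_abs[OF f g]])
    fix F assume F: "finite F" "F \<subseteq> X"
    have le: "L2_set (\<lambda>x. cmod (h x)) F \<le> ell2_norm X h" if "h \<in> ell2 X" for h
      unfolding L2_set_def ell2_norm_def using F that
      by (intro real_sqrt_le_mono finite_sum_le_infsum ell2_summable) auto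
    have "(\<Sum>x\<in>F. cmod (f x) * cmod (g x)) \<le> L2_set (\<lambda>x. cmod (f x)) F * L2_set (\<lambda>x. cmod (g x)) F"
      using L2_set_mult_ineq[of "\<lambda>x. cmod (f x)" "\<lambda>x. cmod (g x)" F] by simp
    also have "\<dots> \<le> ell2_norm X f * ell2_norm X g"
      by (intro mult_mono le f g L2_set_nonneg ell2_norm_nonneg)
    finally show "(\<Sum>x\<in>F. cmod (f x) * cmod (g x)) \<le> ell2_norm X f * ell2_norm X g" .
  qed
  finally show ?thesis .
qed

lemma sum_delta_apply:
  "finite F \<Longrightarrow> (\<Sum>x\<in>F. a x * ell2_delta x y) = (if y \<in> F then a y else 0)"
  by (simp add: ell2_delta_def if_distrib[where f = "\<lambda>c. _ * c"] cong: if_cong)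

text \<open>Truncating f to F leaves exactly the tail of its square sum, which is small for a
  suitable finite F.\<close>

lemma ell2_approx:
  assumes f: "f \<in> ell2 X" and e: "\<epsilon> > 0"
  shows "\<exists>F. finite F \<and> F \<subseteq> X \<and> ell2_norm X (\<lambda>y. f y - (\<Sum>x\<in>F. f x * ell2_delta x y)) < \<epsilon>"
proof -
  \<comment> \<open>The approximation below is non-strict, so half of the square is requested to end
    with a strict bound.\<close>
  have "\<epsilon>\<^sup>2 / 2 > 0" using e by simp
  from infsum_finite_approximation[OF ell2_summable[OF f] this]
  obtain F where F: "finite F" "F \<subseteq> X" and
    d: "dist (\<Sum>x\<in>F. (cmod (f x))\<^sup>2) (ell2_sq X f) \<le> \<epsilon>\<^sup>2 / 2" by blast
  have "ell2_sq X (\<lambda>y. f y - (\<Sum>x\<in>F. f x * ell2_delta x y)) = (\<Sum>\<^sub>\<infinity>x\<in>X - F. (cmod (f x))\<^sup>2)"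
    using F by (intro infsum_cong_neutral) (auto simp: sum_delta_apply)
  also have "\<dots> = ell2_sq X f - (\<Sum>x\<in>F. (cmod (f x))\<^sup>2)"
    using F by (subst infsum_Diff[OF ell2_summable[OF f]]) auto
  also have "\<dots> < \<epsilon>\<^sup>2" using d \<open>\<epsilon>\<^sup>2 / 2 > 0\<close> unfolding dist_real_def by linarith
  finally have "ell2_norm X (\<lambda>y. f y - (\<Sum>x\<in>F. f x * ell2_delta x y)) < \<epsilon>"
    unfolding ell2_norm_def using e by (simp add: real_less_lsqrt)
  then show ?thesis using F by blast
qed

section \<open>Linear and bounded operators, density of finite combinations, adjoints\<close>

lemma linear_on_spaceD:
  assumes "linear_on_space K T"
  shows "f \<in> K \<Longrightarrow> g \<in> K \<Longrightarrow> T (\<lambda>x. f x + g x) = (\<lambda>y. T f y + T g y)"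
    and "f \<in> K \<Longrightarrow> T (\<lambda>x. c * f x) = (\<lambda>y. c * T f y)"
  using assms by (simp_all add: linear_on_space_def)

lemma linear_zero:
  assumes "linear_on_space (ell2 X) T" shows "T (\<lambda>x. 0) = (\<lambda>y. 0)"
  using linear_on_spaceD(2)[OF assms ell2_zero, of 0] by simp

lemma linear_diff:
  assumes T: "linear_on_space (ell2 X) T" and "f \<in> ell2 X" "g \<in> ell2 X"
  shows "T (\<lambda>x. f x - g x) = (\<lambda>y. T f y - T g y)"
  using linear_on_spaceD(1)[OF T assms(2) ell2_scale(1)[OF assms(3), of "-1"]]
    linear_on_spaceD(2)[OF T assms(3), of "-1"] by simp

lemma linear_sum:
  assumes T: "linear_on_space (ell2 X) T" and "finite A" "\<And>i. i \<in> A \<Longrightarrow> v i \<in> ell2 X"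
  shows "T (\<lambda>x. \<Sum>i\<in>A. a i * v i x) = (\<lambda>y. \<Sum>i\<in>A. a i * T (v i) y)"
  using assms(2,3)
proof (induction A rule: finite_induct)
  case (insert j A)
  have "T (\<lambda>x. a j * v j x + (\<Sum>i\<in>A. a i * v i x)) = (\<lambda>y. a j * T (v j) y + (\<Sum>i\<in>A. a i * T (v i) y))"
    using insert
    by (subst linear_on_spaceD(1)[OF T]) (auto intro: ell2_scale(1) ell2_sum simp: linear_on_spaceD(2)[OF T])
  then show ?case using insert by simp
qed (simp add: linear_zero[OF T])

lemma bounded_opsD:
  assumes "T \<in> bounded_ops X"
  shows "f \<in> ell2 X \<Longrightarrow> T f \<in> ell2 X" "linear_on_space (ell2 X) T" "T \<in> extensional (ell2 X)"
  using assms by (auto simp: bounded_ops_def PiE_def)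

lemma bounded_ops_bound:
  assumes "T \<in> bounded_ops X"
  obtains C where "C \<ge> 0" "\<And>f. f \<in> ell2 X \<Longrightarrow> ell2_norm X (T f) \<le> C * ell2_norm X f"
proof -
  obtain C where C: "\<forall>f\<in>ell2 X. ell2_norm X (T f) \<le> C * ell2_norm X f"
    using assms by (auto simp: bounded_ops_def)
  show thesis
  \<comment> \<open>The constant in \<open>bounded_ops\<close> carries no sign condition; its
    maximum with 0 can be used as a monotone factor.\<close>
  proof (rule that[of "max C 0"])
    fix f assume "f \<in> ell2 X"
    then have "ell2_norm X (T f) \<le> C * ell2_norm X f" using C by blast
    also have "\<dots> \<le> max C 0 * ell2_norm X f" by (intro mult_right_mono ell2_norm_nonneg) simp
    finally show "ell2_norm X (T f) \<le> max C 0 * ell2_norm X f" .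
  qed simp
qed

lemma bounded_opsI:
  assumes "T \<in> extensional (ell2 X)" "\<And>f. f \<in> ell2 X \<Longrightarrow> T f \<in> ell2 X"
    and "linear_on_space (ell2 X) T"
    and "\<And>f. f \<in> ell2 X \<Longrightarrow> ell2_norm X (T f) \<le> C * ell2_norm X f"
  shows "T \<in> bounded_ops X"
  using assms by (auto simp: bounded_ops_def PiE_def)

text \<open>The point masses span a dense subspace, so they determine a bounded functional.
  Linearity and boundedness are separate hypotheses, which lets expressions such as
  \<open>ell2_inner X (T f) g\<close> be used directly as functionals of f.\<close>

lemma bounded_functional_ext:
  fixes \<phi> \<psi> :: "('x \<Rightarrow> complex) \<Rightarrow> complex"
  assumes add: "\<And>f g. f \<in> ell2 X \<Longrightarrow> g \<in> ell2 X \<Longrightarrow> \<phi> (\<lambda>x. f x + g x) = \<phi> f + \<phi> g"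
      "\<And>f g. f \<in> ell2 X \<Longrightarrow> g \<in> ell2 X \<Longrightarrow> \<psi> (\<lambda>x. f x + g x) = \<psi> f + \<psi> g"
    and scale: "\<And>c f. f \<in> ell2 X \<Longrightarrow> \<phi> (\<lambda>x. c * f x) = c * \<phi> f"
      "\<And>c f. f \<in> ell2 X \<Longrightarrow> \<psi> (\<lambda>x. c * f x) = c * \<psi> f"
    and bound: "\<And>f. f \<in> ell2 X \<Longrightarrow> cmod (\<phi> f) \<le> B * ell2_norm X f"
      "\<And>f. f \<in> ell2 X \<Longrightarrow> cmod (\<psi> f) \<le> C * ell2_norm X f"
    and eq: "\<And>x. x \<in> X \<Longrightarrow> \<phi> (ell2_delta x) = \<psi> (ell2_delta x)"
    and f: "f \<in> ell2 X"
  shows "\<phi> f = \<psi> f"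
proof -
  have fin: "\<phi> (\<lambda>y. \<Sum>x\<in>F. f x * ell2_delta x y) = \<psi> (\<lambda>y. \<Sum>x\<in>F. f x * ell2_delta x y)"
    if "finite F" "F \<subseteq> X" for F
    using that
  proof (induction F rule: finite_induct)
    case empty
    then show ?case using scale[OF ell2_zero, of 0] by simp
  next
    case (insert a F)
    have d: "ell2_delta a \<in> ell2 X" using insert by (intro ell2_delta_mem) simp
    have s: "(\<lambda>y. \<Sum>x\<in>F. f x * ell2_delta x y) \<in> ell2 X"
      using insert by (intro ell2_sum ell2_delta_mem) auto
    show ?case
      using insert add[OF ell2_scale(1)[OF d, of "f a"] s] scale[OF d, of "f a"] eq[of a] by simp
  qed
  \<comment> \<open>f splits into a finite combination, on which both functionals agree, and a
    remainder of norm below \<epsilon>. Absolute values are taken because B and C may have any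
    sign.\<close>
  have small: "cmod (\<phi> f - \<psi> f) \<le> (\<bar>B\<bar> + \<bar>C\<bar>) * \<epsilon>" if e: "\<epsilon> > 0" for \<epsilon>
  proof -
    obtain F where F: "finite F" "F \<subseteq> X" and
      n: "ell2_norm X (\<lambda>y. f y - (\<Sum>x\<in>F. f x * ell2_delta x y)) < \<epsilon>"
      using ell2_approx[OF f e] by blast
    let ?g = "\<lambda>y. \<Sum>x\<in>F. f x * ell2_delta x y"
    let ?d = "\<lambda>y. f y - ?g y"
    have g: "?g \<in> ell2 X" using F by (intro ell2_sum ell2_delta_mem) auto
    have d: "?d \<in> ell2 X" by (rule ell2_diff[OF f g])
    have "\<phi> f = \<phi> ?d + \<phi> ?g" "\<psi> f = \<psi> ?d + \<psi> ?g" using add[OF d g] by simp_all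
    then have "cmod (\<phi> f - \<psi> f) = cmod (\<phi> ?d - \<psi> ?d)" using fin[OF F] by simp
    also have "\<dots> \<le> cmod (\<phi> ?d) + cmod (\<psi> ?d)" by (rule norm_triangle_ineq4)
    also have "\<dots> \<le> B * ell2_norm X ?d + C * ell2_norm X ?d" by (intro add_mono bound d)
    also have "\<dots> \<le> \<bar>B\<bar> * ell2_norm X ?d + \<bar>C\<bar> * ell2_norm X ?d"
      by (intro add_mono mult_right_mono ell2_norm_nonneg) auto
    also have "\<dots> \<le> \<bar>B\<bar> * \<epsilon> + \<bar>C\<bar> * \<epsilon>" using n by (intro add_mono mult_left_mono) auto
    finally show ?thesis by (simp add: distrib_right)
  qed
  have "cmod (\<phi> f - \<psi> f) \<le> 0"
  proof (rule field_le_epsilon)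
    fix e :: real assume e: "e > 0"
    \<comment> \<open>The summand 1 keeps the denominator positive when both bounds are 0.\<close>
    have pos: "\<bar>B\<bar> + \<bar>C\<bar> + 1 > 0" by linarith
    then have "cmod (\<phi> f - \<psi> f) \<le> (\<bar>B\<bar> + \<bar>C\<bar>) * (e / (\<bar>B\<bar> + \<bar>C\<bar> + 1))"
      using e by (intro small) simp
    also have "\<dots> \<le> (\<bar>B\<bar> + \<bar>C\<bar> + 1) * (e / (\<bar>B\<bar> + \<bar>C\<bar> + 1))"
      using e pos by (intro mult_right_mono) auto
    also have "\<dots> = e" using pos by simp
    finally show "cmod (\<phi> f - \<psi> f) \<le> 0 + e" by simp
  qed
  then show ?thesis by simp
qed

text \<open>The coordinates of the adjoint are forced: \<open>S g x\<close> must be the inner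
  product of g with \<open>T (ell2_delta x)\<close>. Square summability comes from testing T on the
  truncation u of \<open>S g\<close> to a finite set: the partial sum s equals the inner product of
  \<open>T u\<close> with g, hence is at most C * sqrt s times the norm of g. The adjoint identity
  holds on point masses and extends by density.\<close>

lemma bounded_ops_adjoint_exists:
  assumes T: "T \<in> bounded_ops X"
  shows "\<exists>S\<in>bounded_ops X. \<forall>f\<in>ell2 X. \<forall>g\<in>ell2 X. ell2_inner X (T f) g = ell2_inner X f (S g)"
proof -
  obtain C where C: "C \<ge> 0" "\<And>f. f \<in> ell2 X \<Longrightarrow> ell2_norm X (T f) \<le> C * ell2_norm X f"
    using bounded_ops_bound[OF T] by blast
  note TX = bounded_opsD(1)[OF T] and lin = bounded_opsD(2)[OF T]
  define S where "S = (\<lambda>g\<in>ell2 X. \<lambda>x. if x \<in> X then ell2_inner X g (T (ell2_delta x)) else 0)"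
  have fin: "(\<Sum>x\<in>F. (cmod (S g x))\<^sup>2) \<le> (C * ell2_norm X g)\<^sup>2"
    if g: "g \<in> ell2 X" and F: "finite F" "F \<subseteq> X" for g F
  proof -
    define s where "s = (\<Sum>x\<in>F. (cmod (S g x))\<^sup>2)"
    define u where "u = (\<lambda>y. \<Sum>x\<in>F. S g x * ell2_delta x y)"
    have d: "ell2_delta x \<in> ell2 X" if "x \<in> F" for x using that F by (intro ell2_delta_mem) blast
    have u: "u \<in> ell2 X" unfolding u_def using F d by (intro ell2_sum) auto
    have "ell2_sq X u = (\<Sum>\<^sub>\<infinity>x\<in>F. (cmod (S g x))\<^sup>2)"
      unfolding u_def using F by (intro infsum_cong_neutral) (auto simp: sum_delta_apply)
    then have nu: "ell2_norm X u = sqrt s" using F by (simp add: ell2_norm_def s_def)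
    have s0: "s \<ge> 0" unfolding s_def by (intro sum_nonneg) simp
    have Tu: "T u = (\<lambda>y. \<Sum>x\<in>F. S g x * T (ell2_delta x) y)"
      unfolding u_def by (rule linear_sum[OF lin F(1) d])
    have "ell2_inner X (T u) g = (\<Sum>x\<in>F. S g x * ell2_inner X (T (ell2_delta x)) g)"
      unfolding Tu using F d g TX by (intro ell2_inner_sum_left) auto
    also have "\<dots> = (\<Sum>x\<in>F. of_real ((cmod (S g x))\<^sup>2))"
    proof (rule sum.cong[OF refl])
      fix x assume "x \<in> F"
      then have "ell2_inner X (T (ell2_delta x)) g = cnj (S g x)"
        using F g unfolding S_def by (subst ell2_inner_cnj) auto
      then show "S g x * ell2_inner X (T (ell2_delta x)) g = of_real ((cmod (S g x))\<^sup>2)"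
        by (simp only: complex_norm_square)
    qed
    also have "\<dots> = of_real s" by (simp add: s_def)
    finally have "s = cmod (ell2_inner X (T u) g)" using s0 by simp
    also have "\<dots> \<le> ell2_norm X (T u) * ell2_norm X g" by (intro ell2_cauchy_schwarz TX u g)
    also have "\<dots> \<le> (C * sqrt s) * ell2_norm X g"
      using C(2)[OF u] by (intro mult_right_mono ell2_norm_nonneg) (simp add: nu)
    \<comment> \<open>One factor \<open>sqrt s\<close> is cancelled next; for s = 0 the bound is
      trivial.\<close>
    finally have "sqrt s * sqrt s \<le> sqrt s * (C * ell2_norm X g)" using s0 by (simp add: mult_ac)
    then have "sqrt s \<le> C * ell2_norm X g"
      using s0 C(1) ell2_norm_nonneg[of X g] mult_left_le_imp_le[of "sqrt s" "sqrt s"]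
      by (cases "s = 0") auto
    then have "(sqrt s)\<^sup>2 \<le> (C * ell2_norm X g)\<^sup>2" using s0 by (intro power_mono) auto
    then show ?thesis using s0 by (simp add: s_def)
  qed
  have SX: "S g \<in> ell2 X" and "ell2_norm X (S g) \<le> C * ell2_norm X g" if g: "g \<in> ell2 X" for g
  proof -
    have out: "S g x = 0" if "x \<notin> X" for x using that g by (simp add: S_def)
    show "S g \<in> ell2 X" by (rule ell2_bddI(1)[OF fin[OF g] out])
    have "ell2_sq X (S g) \<le> (C * ell2_norm X g)\<^sup>2" by (rule ell2_bddI(2)[OF fin[OF g] out])
    then show "ell2_norm X (S g) \<le> C * ell2_norm X g"
      unfolding ell2_norm_def[of X "S g"]
      by (rule real_le_lsqrt[rotated]) (simp add: C(1) ell2_norm_nonneg)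
  qed
  moreover have "linear_on_space (ell2 X) S"
    unfolding linear_on_space_def S_def
    by (auto simp: fun_eq_iff ell2_add(1) ell2_scale(1) ell2_inner_scale_left TX ell2_delta_mem
        intro!: ell2_inner_add_left)
  ultimately have S: "S \<in> bounded_ops X" by (intro bounded_opsI[where C = C]) (auto simp: S_def)
  have "ell2_inner X (T f) g = ell2_inner X f (S g)" if f: "f \<in> ell2 X" and g: "g \<in> ell2 X" for f g
  proof (rule bounded_functional_ext[where \<phi> = "\<lambda>f. ell2_inner X (T f) g"
        and \<psi> = "\<lambda>f. ell2_inner X f (S g)" and B = "C * ell2_norm X g" and C = "ell2_norm X (S g)"])
    fix f assume f: "f \<in> ell2 X"
    have "cmod (ell2_inner X (T f) g) \<le> ell2_norm X (T f) * ell2_norm X g"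
      by (intro ell2_cauchy_schwarz TX f g)
    also have "\<dots> \<le> (C * ell2_norm X f) * ell2_norm X g"
      by (intro mult_right_mono C(2) f ell2_norm_nonneg)
    finally show "cmod (ell2_inner X (T f) g) \<le> C * ell2_norm X g * ell2_norm X f"
      by (simp add: mult_ac)
    show "cmod (ell2_inner X f (S g)) \<le> ell2_norm X (S g) * ell2_norm X f"
      using ell2_cauchy_schwarz[OF f SX[OF g]] by (simp add: mult.commute)
  next
    fix x assume x: "x \<in> X"
    show "ell2_inner X (T (ell2_delta x)) g = ell2_inner X (ell2_delta x) (S g)"
      using x g unfolding ell2_inner_delta[OF x] by (subst ell2_inner_cnj) (simp add: S_def)
  qed (use f g SX TX in \<open>simp_all add: linear_on_spaceD[OF lin] ell2_inner_add_left ell2_inner_scale_left\<close>)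
  then show ?thesis using S by blast
qed

lemma op_adjoint_bounded:
  assumes T: "T \<in> bounded_ops X"
  shows "op_adjoint X T \<in> bounded_ops X"
    and "f \<in> ell2 X \<Longrightarrow> g \<in> ell2 X \<Longrightarrow> ell2_inner X (T f) g = ell2_inner X f (op_adjoint X T g)"
proof -
  obtain S where S: "S \<in> bounded_ops X"
    "\<forall>f\<in>ell2 X. \<forall>g\<in>ell2 X. ell2_inner X (T f) g = ell2_inner X f (S g)"
    using bounded_ops_adjoint_exists[OF T] by blast
  then have "op_adjoint X T = S" by (intro op_adjoint_eqI) auto
  with S show "op_adjoint X T \<in> bounded_ops X"
    "f \<in> ell2 X \<Longrightarrow> g \<in> ell2 X \<Longrightarrow> ell2_inner X (T f) g = ell2_inner X f (op_adjoint X T g)" by auto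
qed

text \<open>Evaluation at x is the inner product with a point mass. Moving T across as its adjoint
  turns the coordinate into a single inner product with f, whose defining sum is the matrix
  expansion.\<close>

lemma bounded_ops_matrix:
  assumes T: "T \<in> bounded_ops X" and f: "f \<in> ell2 X" and x: "x \<in> X"
  shows "T f x = (\<Sum>\<^sub>\<infinity>y\<in>X. f y * T (ell2_delta y) x)"
proof -
  let ?g = "op_adjoint X T (ell2_delta x)"
  have adj: "h \<in> ell2 X \<Longrightarrow> T h x = ell2_inner X h ?g" for h
    using op_adjoint_bounded(2)[OF T _ ell2_delta_mem[OF x]] by (simp add: ell2_inner_delta_right[OF x])
  have "T (ell2_delta y) x = cnj (?g y)" if "y \<in> X" for y
    using adj[OF ell2_delta_mem[OF that]] that by (simp add: ell2_inner_delta)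
  then show ?thesis unfolding adj[OF f] ell2_inner_def by (intro infsum_cong) simp
qed

section \<open>Square summable functions on a product, slice by slice\<close>

text \<open>The squared moduli are nonnegative, so summability over the product is iterated
  summability: the space is the Hilbert direct sum over A of copies of
  \<open>ell2 B\<close>.\<close>

lemma ell2_Times_iff:
  "F \<in> ell2 (A \<times> B) \<longleftrightarrow> (\<forall>a\<in>A. (\<lambda>b. F (a, b)) \<in> ell2 B) \<and>
     (\<lambda>a. (ell2_norm B (\<lambda>b. F (a, b)))\<^sup>2) summable_on A \<and> (\<forall>p. p \<notin> A \<times> B \<longrightarrow> F p = 0)"
  using Infinite_Sum.abs_summable_on_Sigma_iff[where f = "\<lambda>p. (cmod (F p))\<^sup>2" and A = A and B = "\<lambda>_. B"]
  by (auto simp: ell2_def ell2_norm_power2 ell2_sq_nonneg)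

lemma ell2_norm_Times:
  assumes "F \<in> ell2 (A \<times> B)"
  shows "(ell2_norm (A \<times> B) F)\<^sup>2 = (\<Sum>\<^sub>\<infinity>a\<in>A. (ell2_norm B (\<lambda>b. F (a, b)))\<^sup>2)"
  unfolding ell2_norm_power2 using infsum_Sigma_banach[OF ell2_summable[OF assms]] by simp

lemma ell2_inner_Times:
  assumes "F \<in> ell2 (A \<times> B)" "H \<in> ell2 (A \<times> B)"
  shows "ell2_inner (A \<times> B) F H = (\<Sum>\<^sub>\<infinity>a\<in>A. ell2_inner B (\<lambda>b. F (a, b)) (\<lambda>b. H (a, b)))"
  unfolding ell2_inner_def using infsum_Sigma_banach[OF ell2_inner_summable[OF assms]] by simp

section \<open>Unitaries between \<open>\<ell>\<^sup>2\<close> spaces\<close>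

lemma unitary_betweenD:
  assumes "unitary_between X K Y L U"
  shows "linear_on_space K U" "bij_betw U K L" "f \<in> K \<Longrightarrow> U f \<in> L"
    "f \<in> K \<Longrightarrow> g \<in> K \<Longrightarrow> ell2_inner Y (U f) (U g) = ell2_inner X f g"
  using assms by (auto simp: unitary_between_def bij_betwE)

lemma unitary_norm:
  assumes U: "unitary_between X (ell2 X) Y (ell2 Y) U" and f: "f \<in> ell2 X"
  shows "ell2_norm Y (U f) = ell2_norm X f"
proof -
  have "(of_real ((ell2_norm Y (U f))\<^sup>2) :: complex) = of_real ((ell2_norm X f)\<^sup>2)"
    using unitary_betweenD(4)[OF U f f]
    by (simp only: ell2_inner_self[OF f] ell2_inner_self[OF unitary_betweenD(3)[OF U f]])
  then have "(ell2_norm Y (U f))\<^sup>2 = (ell2_norm X f)\<^sup>2" by (simp only: of_real_eq_iff)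
  then show ?thesis by (simp add: ell2_norm_nonneg)
qed

lemma unitary_between_comp:
  assumes U: "unitary_between X K Y L U" and V: "unitary_between Y L Z M V"
  shows "unitary_between X K Z M (\<lambda>f. V (U f))"
  unfolding unitary_between_def
proof (intro conjI ballI)
  show "linear_on_space K (\<lambda>f. V (U f))"
    using unitary_betweenD(1)[OF U] unitary_betweenD(1)[OF V] unitary_betweenD(3)[OF U]
    by (simp add: linear_on_space_def)
  show "bij_betw (\<lambda>f. V (U f)) K M"
    using bij_betw_trans[OF unitary_betweenD(2)[OF U] unitary_betweenD(2)[OF V]] by (simp add: o_def)
qed (simp add: unitary_betweenD[OF U] unitary_betweenD[OF V])

section \<open>Reindexing along a bijection\<close>

text \<open>This is pullback, so a bijection from A to B induces a unitary in the opposite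
  direction; the value 0 off A keeps the result in \<open>ell2 A\<close>.\<close>

definition ell2_relabel :: "'a set \<Rightarrow> ('a \<Rightarrow> 'b) \<Rightarrow> ('b \<Rightarrow> complex) \<Rightarrow> ('a \<Rightarrow> complex)" where
  "ell2_relabel A \<phi> f = (\<lambda>a. if a \<in> A then f (\<phi> a) else 0)"

lemma ell2_relabel_mem:
  assumes "bij_betw \<phi> A B" "f \<in> ell2 B" shows "ell2_relabel A \<phi> f \<in> ell2 A"
proof -
  have "(\<lambda>a. (cmod (f (\<phi> a)))\<^sup>2) summable_on A"
    using summable_on_reindex_bij_betw[OF assms(1), of "\<lambda>b. (cmod (f b))\<^sup>2"] ell2_summable[OF assms(2)]
    by simp
  then show ?thesis by (simp add: ell2_def ell2_relabel_def cong: summable_on_cong)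
qed

lemma unitary_relabel:
  assumes \<phi>: "bij_betw \<phi> A B"
  shows "unitary_between B (ell2 B) A (ell2 A) (ell2_relabel A \<phi>)"
  unfolding unitary_between_def
proof (intro conjI ballI)
  show "linear_on_space (ell2 B) (ell2_relabel A \<phi>)"
    by (auto simp: linear_on_space_def ell2_relabel_def)
  show "bij_betw (ell2_relabel A \<phi>) (ell2 B) (ell2 A)"
  proof (rule bij_betw_byWitness[where f' = "ell2_relabel B (inv_into A \<phi>)"])
    show "\<forall>f\<in>ell2 B. ell2_relabel B (inv_into A \<phi>) (ell2_relabel A \<phi> f) = f"
      using \<phi> by (auto simp: ell2_relabel_def fun_eq_iff ell2_outside bij_betw_inv_into_right
          bij_betw_apply[OF bij_betw_inv_into[OF \<phi>]])
    show "\<forall>f\<in>ell2 A. ell2_relabel A \<phi> (ell2_relabel B (inv_into A \<phi>) f) = f"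
      using \<phi> by (auto simp: ell2_relabel_def fun_eq_iff ell2_outside bij_betw_inv_into_left
          bij_betw_apply[OF \<phi>])
  qed (use ell2_relabel_mem[OF \<phi>] ell2_relabel_mem[OF bij_betw_inv_into[OF \<phi>]] in auto)
  fix f g
  show "ell2_inner A (ell2_relabel A \<phi> f) (ell2_relabel A \<phi> g) = ell2_inner B f g"
    unfolding ell2_inner_def infsum_reindex_bij_betw[OF \<phi>, symmetric]
    by (intro infsum_cong) (simp add: ell2_relabel_def)
qed

section \<open>Block-diagonal operators\<close>

text \<open>The direct sum of the operators \<open>V a\<close>; for a constant family V it is the
  operator 1 \<otimes> V.\<close>

definition ell2_blockdiag ::
    "'a set \<Rightarrow> ('a \<Rightarrow> 'b ell2_op) \<Rightarrow> ('a \<times> 'b) ell2_op" where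
  "ell2_blockdiag A V F = (\<lambda>(a, b). if a \<in> A then V a (\<lambda>b. F (a, b)) b else 0)"

lemma ell2_blockdiag_slice: "a \<in> A \<Longrightarrow> (\<lambda>b. ell2_blockdiag A V F (a, b)) = V a (\<lambda>b. F (a, b))"
  by (simp add: ell2_blockdiag_def)

lemma ell2_slice: "F \<in> ell2 (A \<times> B) \<Longrightarrow> a \<in> A \<Longrightarrow> (\<lambda>b. F (a, b)) \<in> ell2 B"
  by (simp add: ell2_Times_iff)

lemma ell2_slice_summable:
  "F \<in> ell2 (A \<times> B) \<Longrightarrow> (\<lambda>a. (ell2_norm B (\<lambda>b. F (a, b)))\<^sup>2) summable_on A"
  by (simp add: ell2_Times_iff)

text \<open>A bound common to all blocks passes to the direct sum: compare the squared norms of the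
  slices and sum over A.\<close>

lemma ell2_blockdiag_bounded:
  assumes V: "\<And>a f. a \<in> A \<Longrightarrow> f \<in> ell2 B \<Longrightarrow> V a f \<in> ell2 B"
    and b: "\<And>a f. a \<in> A \<Longrightarrow> f \<in> ell2 B \<Longrightarrow> ell2_norm B (V a f) \<le> C * ell2_norm B f"
    and C: "C \<ge> 0" and F: "F \<in> ell2 (A \<times> B)"
  shows "ell2_blockdiag A V F \<in> ell2 (A \<times> B)"
    and "ell2_norm (A \<times> B) (ell2_blockdiag A V F) \<le> C * ell2_norm (A \<times> B) F"
proof -
  let ?n = "\<lambda>a. (ell2_norm B (\<lambda>b. F (a, b)))\<^sup>2"
  have le: "(ell2_norm B (\<lambda>b. ell2_blockdiag A V F (a, b)))\<^sup>2 \<le> C\<^sup>2 * ?n a" if a: "a \<in> A" for a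
    using power_mono[OF b[OF a ell2_slice[OF F a]] ell2_norm_nonneg, of 2]
    by (simp add: ell2_blockdiag_slice[OF a] power_mult_distrib)
  have s: "(\<lambda>a. C\<^sup>2 * ?n a) summable_on A" by (intro summable_on_cmult_right ell2_slice_summable F)
  have s': "(\<lambda>a. (ell2_norm B (\<lambda>b. ell2_blockdiag A V F (a, b)))\<^sup>2) summable_on A"
    by (rule summable_on_comparison_test[OF s le]) auto
  have out: "ell2_blockdiag A V F p = 0" if "p \<notin> A \<times> B" for p
    using that by (cases p) (auto simp: ell2_blockdiag_def intro: ell2_outside[OF V[OF _ ell2_slice[OF F]]])
  show mem: "ell2_blockdiag A V F \<in> ell2 (A \<times> B)"
    unfolding ell2_Times_iff using out s' V[OF _ ell2_slice[OF F]] by (simp add: ell2_blockdiag_slice)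
  have "(ell2_norm (A \<times> B) (ell2_blockdiag A V F))\<^sup>2 \<le> (\<Sum>\<^sub>\<infinity>a\<in>A. C\<^sup>2 * ?n a)"
    unfolding ell2_norm_Times[OF mem] by (rule infsum_mono[OF s' s le])
  also have "\<dots> = (C * ell2_norm (A \<times> B) F)\<^sup>2"
    unfolding power_mult_distrib ell2_norm_Times[OF F] by (rule infsum_cmult_right')
  finally show "ell2_norm (A \<times> B) (ell2_blockdiag A V F) \<le> C * ell2_norm (A \<times> B) F"
    by (rule power2_le_imp_le) (simp add: C ell2_norm_nonneg)
qed

lemma linear_blockdiag:
  assumes "\<And>a. a \<in> A \<Longrightarrow> linear_on_space (ell2 B) (V a)"
  shows "linear_on_space (ell2 (A \<times> B)) (ell2_blockdiag A V)"
proof -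
  have "ell2_blockdiag A V (\<lambda>p. F p + H p) = (\<lambda>p. ell2_blockdiag A V F p + ell2_blockdiag A V H p)"
    if "F \<in> ell2 (A \<times> B)" "H \<in> ell2 (A \<times> B)" for F H
    using that by (auto simp: fun_eq_iff ell2_blockdiag_def linear_on_spaceD(1)[OF assms] ell2_slice)
  moreover have "ell2_blockdiag A V (\<lambda>p. c * F p) = (\<lambda>p. c * ell2_blockdiag A V F p)"
    if "F \<in> ell2 (A \<times> B)" for F c
    using that by (auto simp: fun_eq_iff ell2_blockdiag_def linear_on_spaceD(2)[OF assms] ell2_slice)
  ultimately show ?thesis by (simp add: linear_on_space_def)
qed

text \<open>The inverse is the direct sum of the inverse blocks, which are isometric and so share
  the bound 1. Inner products are preserved because they are sums over slices.\<close>

lemma unitary_blockdiag: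
  assumes V: "\<And>a. a \<in> A \<Longrightarrow> unitary_between B (ell2 B) B (ell2 B) (V a)"
  shows "unitary_between (A \<times> B) (ell2 (A \<times> B)) (A \<times> B) (ell2 (A \<times> B)) (ell2_blockdiag A V)"
  unfolding unitary_between_def
proof (intro conjI ballI)
  define V' where "V' a = inv_into (ell2 B) (V a)" for a
  have V': "V' a f \<in> ell2 B" "V a (V' a f) = f" "V' a (V a f) = f" if "a \<in> A" "f \<in> ell2 B" for a f
    using unitary_betweenD(2)[OF V[OF that(1)]] that unfolding V'_def
    by (auto simp: bij_betw_inv_into_right bij_betw_inv_into_left bij_betw_apply[OF bij_betw_inv_into])
  have nV': "ell2_norm B (V' a f) = ell2_norm B f" if "a \<in> A" "f \<in> ell2 B" for a f
    using unitary_norm[OF V[OF that(1)] V'(1)[OF that]] V'(2)[OF that] by simp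
  have mem: "ell2_blockdiag A V F \<in> ell2 (A \<times> B)" if "F \<in> ell2 (A \<times> B)" for F
    using that unitary_betweenD(3)[OF V] unitary_norm[OF V] by (intro ell2_blockdiag_bounded(1)[where C = 1]) auto
  have mem': "ell2_blockdiag A V' F \<in> ell2 (A \<times> B)" if "F \<in> ell2 (A \<times> B)" for F
    using that V'(1) nV' by (intro ell2_blockdiag_bounded(1)[where C = 1]) auto
  show "linear_on_space (ell2 (A \<times> B)) (ell2_blockdiag A V)"
    by (intro linear_blockdiag unitary_betweenD(1)[OF V])
  have inv1: "ell2_blockdiag A V (ell2_blockdiag A V' F) = F"
    and inv2: "ell2_blockdiag A V' (ell2_blockdiag A V F) = F" if F: "F \<in> ell2 (A \<times> B)" for F
    using F by (auto simp: fun_eq_iff ell2_blockdiag_def V'(2,3) ell2_slice ell2_outside)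
  show "bij_betw (ell2_blockdiag A V) (ell2 (A \<times> B)) (ell2 (A \<times> B))"
    by (rule bij_betw_byWitness[where f' = "ell2_blockdiag A V'"]) (use mem mem' inv1 inv2 in auto)
  fix F H assume F: "F \<in> ell2 (A \<times> B)" and H: "H \<in> ell2 (A \<times> B)"
  show "ell2_inner (A \<times> B) (ell2_blockdiag A V F) (ell2_blockdiag A V H) = ell2_inner (A \<times> B) F H"
    unfolding ell2_inner_Times[OF mem[OF F] mem[OF H]] ell2_inner_Times[OF F H]
    using F H by (intro infsum_cong) (simp add: ell2_blockdiag_slice unitary_betweenD(4)[OF V] ell2_slice)
qed

section \<open>Bounded operators and square summable families\<close>

text \<open>Links the ordered series of the ultraweak topology with the unordered sums that can be
  rearranged and iterated.\<close>

lemma suminf_eq_infsum: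
  fixes f :: "nat \<Rightarrow> 'a :: {comm_monoid_add, t2_space}"
  shows "f summable_on UNIV \<Longrightarrow> (\<Sum>n. f n) = infsum f UNIV"
  by (metis has_sum_imp_sums has_sum_infsum sums_unique)

text \<open>By Cauchy-Schwarz and p q \<le> p^2 + q^2 the terms are dominated by a multiple of the
  two summable families.\<close>

lemma inner_family_summable:
  assumes T: "T \<in> bounded_ops X"
    and u: "\<And>i. i \<in> I \<Longrightarrow> u i \<in> ell2 X" "(\<lambda>i. (ell2_norm X (u i))\<^sup>2) summable_on I"
    and v: "\<And>i. i \<in> I \<Longrightarrow> v i \<in> ell2 X" "(\<lambda>i. (ell2_norm X (v i))\<^sup>2) summable_on I"
  shows "(\<lambda>i. ell2_inner X (T (u i)) (v i)) summable_on I"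
proof -
  obtain C where C: "C \<ge> 0" "\<And>f. f \<in> ell2 X \<Longrightarrow> ell2_norm X (T f) \<le> C * ell2_norm X f"
    using bounded_ops_bound[OF T] by blast
  let ?b = "\<lambda>i. C * ((ell2_norm X (u i))\<^sup>2 + (ell2_norm X (v i))\<^sup>2)"
  have "cmod (ell2_inner X (T (u i)) (v i)) \<le> ?b i" if i: "i \<in> I" for i
  proof -
    let ?p = "ell2_norm X (u i)" and ?q = "ell2_norm X (v i)"
    have "cmod (ell2_inner X (T (u i)) (v i)) \<le> ell2_norm X (T (u i)) * ?q"
      by (intro ell2_cauchy_schwarz bounded_opsD(1)[OF T] u(1) v(1) i)
    also have "\<dots> \<le> C * (?p * ?q)"
      using mult_right_mono[OF C(2)[OF u(1)[OF i]] ell2_norm_nonneg[of X "v i"]] by (simp add: mult.assoc)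
    also have "\<dots> \<le> ?b i"
    proof (intro mult_left_mono C(1))
      have "0 \<le> ?p * ?q" by (intro mult_nonneg_nonneg ell2_norm_nonneg)
      then show "?p * ?q \<le> ?p\<^sup>2 + ?q\<^sup>2" using sum_squares_bound[of ?p ?q] by linarith
    qed
    finally show ?thesis .
  qed
  then have "(\<lambda>i. cmod (ell2_inner X (T (u i)) (v i))) summable_on I"
    by (rule summable_on_comparison_test[where f = ?b, rotated])
      (auto intro!: summable_on_cmult_right summable_on_add u v)
  then show ?thesis by (rule Infinite_Sum.abs_summable_summable)
qed

text \<open>
  A square summable family has countable support, so it may be rearranged into a sequence even
  when its index set is uncountable.
\<close>

lemma square_summable_enumeration:
  fixes u v :: "'i \<Rightarrow> 'x \<Rightarrow> complex"
  assumes u: "\<And>i. i \<in> I \<Longrightarrow> u i \<in> ell2 X" "(\<lambda>i. (ell2_norm X (u i))\<^sup>2) summable_on I"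
    and v: "\<And>i. i \<in> I \<Longrightarrow> v i \<in> ell2 X" "(\<lambda>i. (ell2_norm X (v i))\<^sup>2) summable_on I"
  obtains F G where "F \<in> square_summable_seqs X" "G \<in> square_summable_seqs X"
    "\<And>T. T \<in> bounded_ops X \<Longrightarrow>
      (\<Sum>n. ell2_inner X (T (F n)) (G n)) = (\<Sum>\<^sub>\<infinity>i\<in>I. ell2_inner X (T (u i)) (v i))"
proof -
  \<comment> \<open>Both families vanish off N, and N is countable since a summable real family has
    countable support.\<close>
  define N where "N = {i\<in>I. (ell2_norm X (u i))\<^sup>2 \<noteq> 0} \<union> {i\<in>I. (ell2_norm X (v i))\<^sup>2 \<noteq> 0}"
  have N: "countable N" "N \<subseteq> I"
    unfolding N_def using summable_countable_real[OF u(2)] summable_countable_real[OF v(2)] by auto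
  define e where "e = to_nat_on N"
  have inj: "inj_on e N" unfolding e_def by (rule inj_on_to_nat_on[OF N(1)])
  \<comment> \<open>Indices outside the image of the enumeration receive the zero vector, which also
    covers a finite N.\<close>
  define seq :: "('i \<Rightarrow> 'x \<Rightarrow> complex) \<Rightarrow> nat \<Rightarrow> 'x \<Rightarrow> complex" where
    "seq w n = (if n \<in> e ` N then w (inv_into N e n) else (\<lambda>x. 0))" for w n
  have seq_e: "seq w (e i) = w i" if "i \<in> N" for w i
    using that inj by (simp add: seq_def)
  have off: "w i = (\<lambda>x. 0)" if "i \<in> I - N" "w \<in> {u, v}" for i w
    using that u(1) v(1) by (auto simp: N_def intro: ell2_norm_eq_0)
  have norm0: "ell2_norm X (\<lambda>x. 0) = 0" by (simp add: ell2_norm_def)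
  have sq: "seq w \<in> square_summable_seqs X"
    if w: "\<And>i. i \<in> I \<Longrightarrow> w i \<in> ell2 X" "(\<lambda>i. (ell2_norm X (w i))\<^sup>2) summable_on I" for w
  proof -
    have mem: "seq w n \<in> ell2 X" for n
      using N(2) w(1) inv_into_into[of n e N] by (auto simp: seq_def ell2_zero)
    have "(\<lambda>i. (ell2_norm X (w i))\<^sup>2) summable_on N"
      using w(2) N(2) by (rule summable_on_subset_banach)
    then have "(\<lambda>n. (ell2_norm X (seq w n))\<^sup>2) \<circ> e summable_on N"
      by (simp add: o_def seq_e cong: summable_on_cong)
    then have "(\<lambda>n. (ell2_norm X (seq w n))\<^sup>2) summable_on e ` N"
      by (simp only: summable_on_reindex[OF inj])
    moreover have "(\<lambda>n. (ell2_norm X (seq w n))\<^sup>2) summable_on UNIV \<longleftrightarrow>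
        (\<lambda>n. (ell2_norm X (seq w n))\<^sup>2) summable_on e ` N"
      by (rule summable_on_cong_neutral) (auto simp: seq_def norm0)
    ultimately have "summable (\<lambda>n. (ell2_norm X (seq w n))\<^sup>2)"
      using summable_on_imp_summable by blast
    then show ?thesis using mem by (simp add: square_summable_seqs_def)
  qed
  have su: "seq u \<in> square_summable_seqs X" and sv: "seq v \<in> square_summable_seqs X"
    using sq u v by blast+
  show thesis
  proof (rule that[OF su sv])
    fix T assume T: "T \<in> bounded_ops X"
    let ?f = "\<lambda>n. ell2_inner X (T (seq u n)) (seq v n)"
    have "?f summable_on UNIV"
    proof (rule inner_family_summable[OF T])
      show "(\<lambda>n. (ell2_norm X (seq u n))\<^sup>2) summable_on UNIV" "(\<lambda>n. (ell2_norm X (seq v n))\<^sup>2) summable_on UNIV"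
        using su sv by (auto simp: square_summable_seqs_def intro: summable_nonneg_imp_summable_on)
    qed (use su sv in \<open>auto simp: square_summable_seqs_def\<close>)
    then have "(\<Sum>n. ?f n) = infsum ?f UNIV" by (rule suminf_eq_infsum)
    also have "\<dots> = infsum ?f (e ` N)"
      by (rule infsum_cong_neutral) (auto simp: seq_def ell2_inner_def)
    also have "\<dots> = (\<Sum>\<^sub>\<infinity>i\<in>N. ell2_inner X (T (u i)) (v i))"
      by (simp add: infsum_reindex[OF inj] o_def seq_e cong: infsum_cong)
    also have "\<dots> = (\<Sum>\<^sub>\<infinity>i\<in>I. ell2_inner X (T (u i)) (v i))"
      by (rule infsum_cong_neutral) (use N(2) off[of _ v] in \<open>auto simp: ell2_inner_def\<close>)
    finally show "(\<Sum>n. ?f n) = (\<Sum>\<^sub>\<infinity>i\<in>I. ell2_inner X (T (u i)) (v i))" .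
  qed
qed

section \<open>Boundedness of sums, multiples and products\<close>

lemma op_plus_bounded:
  assumes "S \<in> bounded_ops X" "T \<in> bounded_ops X" shows "op_plus X S T \<in> bounded_ops X"
proof -
  obtain B where B: "\<And>f. f \<in> ell2 X \<Longrightarrow> ell2_norm X (S f) \<le> B * ell2_norm X f"
    using bounded_ops_bound[OF assms(1)] by blast
  obtain C where C: "\<And>f. f \<in> ell2 X \<Longrightarrow> ell2_norm X (T f) \<le> C * ell2_norm X f"
    using bounded_ops_bound[OF assms(2)] by blast
  note S = bounded_opsD[OF assms(1)] and T = bounded_opsD[OF assms(2)]
  show ?thesis
  \<comment> \<open>The constant comes from \<open>ell2_add(2)\<close>, which bounds the squared
    norm of a sum by twice the sum of the squared norms.\<close>
  proof (rule bounded_opsI[where C = "sqrt (2 * B\<^sup>2 + 2 * C\<^sup>2)"])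
    fix f assume f: "f \<in> ell2 X"
    have "(ell2_norm X (S f))\<^sup>2 \<le> (B * ell2_norm X f)\<^sup>2" "(ell2_norm X (T f))\<^sup>2 \<le> (C * ell2_norm X f)\<^sup>2"
      by (intro power_mono B C f ell2_norm_nonneg)+
    moreover have "(ell2_norm X (op_plus X S T f))\<^sup>2 \<le> 2 * (ell2_norm X (S f))\<^sup>2 + 2 * (ell2_norm X (T f))\<^sup>2"
      unfolding ell2_norm_power2 using ell2_add(2)[OF S(1)[OF f] T(1)[OF f]] f by (simp add: op_plus_def)
    ultimately have "(ell2_norm X (op_plus X S T f))\<^sup>2 \<le> (2 * B\<^sup>2 + 2 * C\<^sup>2) * (ell2_norm X f)\<^sup>2"
      by (simp add: power_mult_distrib distrib_right)
    then show "ell2_norm X (op_plus X S T f) \<le> sqrt (2 * B\<^sup>2 + 2 * C\<^sup>2) * ell2_norm X f"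
      by (metis abs_of_nonneg ell2_norm_nonneg real_le_rsqrt real_sqrt_abs real_sqrt_mult)
  qed (auto simp: op_plus_def linear_on_space_def ell2_add(1) ell2_scale(1) S(1) T(1)
      linear_on_spaceD[OF S(2)] linear_on_spaceD[OF T(2)] algebra_simps)
qed

lemma op_scale_bounded:
  assumes "T \<in> bounded_ops X" shows "op_scale X c T \<in> bounded_ops X"
proof -
  obtain C where C: "\<And>f. f \<in> ell2 X \<Longrightarrow> ell2_norm X (T f) \<le> C * ell2_norm X f"
    using bounded_ops_bound[OF assms] by blast
  note T = bounded_opsD[OF assms]
  show ?thesis
  proof (rule bounded_opsI[where C = "cmod c * C"])
    fix f assume f: "f \<in> ell2 X"
    have "ell2_norm X (op_scale X c T f) = cmod c * ell2_norm X (T f)"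
      using f ell2_scale(2)[OF T(1)[OF f], of c] by (simp add: op_scale_def ell2_norm_def real_sqrt_mult)
    then show "ell2_norm X (op_scale X c T f) \<le> cmod c * C * ell2_norm X f"
      using mult_left_mono[OF C[OF f], of "cmod c"] by (simp add: mult.assoc)
  qed (auto simp: op_scale_def linear_on_space_def ell2_add(1) ell2_scale(1) T(1)
      linear_on_spaceD[OF T(2)] algebra_simps)
qed

lemma op_comp_bounded:
  assumes "S \<in> bounded_ops X" "T \<in> bounded_ops X" shows "op_comp X S T \<in> bounded_ops X"
proof -
  obtain B where B: "B \<ge> 0" "\<And>f. f \<in> ell2 X \<Longrightarrow> ell2_norm X (S f) \<le> B * ell2_norm X f"
    using bounded_ops_bound[OF assms(1)] by blast
  obtain C where C: "\<And>f. f \<in> ell2 X \<Longrightarrow> ell2_norm X (T f) \<le> C * ell2_norm X f"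
    using bounded_ops_bound[OF assms(2)] by blast
  note S = bounded_opsD[OF assms(1)] and T = bounded_opsD[OF assms(2)]
  show ?thesis
  proof (rule bounded_opsI[where C = "B * C"])
    fix f assume f: "f \<in> ell2 X"
    show "ell2_norm X (op_comp X S T f) \<le> B * C * ell2_norm X f"
      using order_trans[OF B(2)[OF T(1)[OF f]] mult_left_mono[OF C[OF f] B(1)]] f
      by (simp add: op_comp_def compose_def mult.assoc)
  qed (auto simp: op_comp_def compose_def linear_on_space_def ell2_add(1) ell2_scale(1) S(1) T(1)
      linear_on_spaceD[OF S(2)] linear_on_spaceD[OF T(2)])
qed

lemma op_id_bounded: "op_id X \<in> bounded_ops X"
  by (rule bounded_opsI[where C = 1])
    (auto simp: op_id_def linear_on_space_def ell2_add(1) ell2_scale(1))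

section \<open>Amplifications\<close>

text \<open>Isolates the part of the argument that uses only a unitary onto a tensor product. It is
  later instantiated with X the right cosets, Y the group, J = \<Gamma> and W =
  \<open>untwist\<close>.\<close>

locale amplification =
  fixes X :: "'x set" and Y :: "'y set" and J :: "'j set" and W
  assumes W: "unitary_between Y (ell2 Y) (J \<times> X) (ell2 (J \<times> X)) W"
begin

text \<open>The operator \<open>W\<^sup>-\<^sup>1 (1 \<otimes> T) W\<close>, where \<open>\<ell>\<^sup>2(J \<times> X)\<close> is viewed as \<open>\<ell>\<^sup>2(J) \<otimes> \<ell>\<^sup>2(X)\<close>.\<close>

definition amplify :: "'x ell2_op \<Rightarrow> 'y ell2_op" where
  "amplify T = (\<lambda>f\<in>ell2 Y. inv_into (ell2 Y) W (ell2_blockdiag J (\<lambda>_. T) (W f)))"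

section \<open>Amplified operators in terms of slices\<close>

lemma W_mem: "f \<in> ell2 Y \<Longrightarrow> W f \<in> ell2 (J \<times> X)"
  by (rule unitary_betweenD(3)[OF W])

lemma W_slice: "f \<in> ell2 Y \<Longrightarrow> j \<in> J \<Longrightarrow> (\<lambda>x. W f (j, x)) \<in> ell2 X"
  by (rule ell2_slice[OF W_mem])

lemma W_inj: "f \<in> ell2 Y \<Longrightarrow> g \<in> ell2 Y \<Longrightarrow> W f = W g \<Longrightarrow> f = g"
  using unitary_betweenD(2)[OF W] by (auto simp: bij_betw_def inj_on_def)

lemma W_surj: "F \<in> ell2 (J \<times> X) \<Longrightarrow> \<exists>f\<in>ell2 Y. W f = F"
  using bij_betw_imp_surj_on[OF unitary_betweenD(2)[OF W]] by (metis imageE)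

lemmas W_linear = linear_on_spaceD[OF unitary_betweenD(1)[OF W]]

lemma blockdiag_mem:
  assumes T: "T \<in> bounded_ops X" and F: "F \<in> ell2 (J \<times> X)"
  shows "ell2_blockdiag J (\<lambda>_. T) F \<in> ell2 (J \<times> X)"
proof -
  obtain C where "C \<ge> 0" "\<And>f. f \<in> ell2 X \<Longrightarrow> ell2_norm X (T f) \<le> C * ell2_norm X f"
    using bounded_ops_bound[OF T] by blast
  then show ?thesis using bounded_opsD(1)[OF T] F by (intro ell2_blockdiag_bounded(1)[where C = C]) auto
qed

lemma amplify_mem:
  assumes T: "T \<in> bounded_ops X" and f: "f \<in> ell2 Y"
  shows "amplify T f \<in> ell2 Y" and "W (amplify T f) = ell2_blockdiag J (\<lambda>_. T) (W f)"
proof -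
  have F: "ell2_blockdiag J (\<lambda>_. T) (W f) \<in> ell2 (J \<times> X)" by (intro blockdiag_mem T W_mem f)
  then show "amplify T f \<in> ell2 Y" "W (amplify T f) = ell2_blockdiag J (\<lambda>_. T) (W f)"
    using f unitary_betweenD(2)[OF W] bij_betw_apply[OF bij_betw_inv_into[OF unitary_betweenD(2)[OF W]]]
    by (simp_all add: amplify_def bij_betw_inv_into_right)
qed

lemma W_amplify_slice:
  "T \<in> bounded_ops X \<Longrightarrow> f \<in> ell2 Y \<Longrightarrow> j \<in> J \<Longrightarrow> (\<lambda>x. W (amplify T f) (j, x)) = T (\<lambda>x. W f (j, x))"
  by (simp add: amplify_mem(2) ell2_blockdiag_slice)

text \<open>Slices at indices outside J vanish on both sides, so injectivity of W leaves only those
  in J to compare.\<close>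

lemma W_eqI:
  assumes f: "f \<in> ell2 Y" and g: "g \<in> ell2 Y"
    and eq: "\<And>j. j \<in> J \<Longrightarrow> (\<lambda>x. W f (j, x)) = (\<lambda>x. W g (j, x))"
  shows "f = g"
proof (rule W_inj[OF f g], rule ext)
  fix p :: "'j \<times> 'x"
  obtain j x where p: "p = (j, x)" by (cases p)
  show "W f p = W g p"
  proof (cases "j \<in> J")
    case True
    then show ?thesis using fun_cong[OF eq[OF True], of x] by (simp add: p)
  next
    case False
    then show ?thesis using ell2_outside[OF W_mem[OF f], of p] ell2_outside[OF W_mem[OF g], of p] by (simp add: p)
  qed
qed

text \<open>W is unitary and the amplified operator acts as T on every slice, so its coefficients
  are sums of coefficients of T. Adjoints, normality and the matrix entries all rest on this
  formula.\<close>

lemma amplify_inner: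
  assumes T: "T \<in> bounded_ops X" and f: "f \<in> ell2 Y" and g: "g \<in> ell2 Y"
  shows "ell2_inner Y (amplify T f) g
    = (\<Sum>\<^sub>\<infinity>j\<in>J. ell2_inner X (T (\<lambda>x. W f (j, x))) (\<lambda>x. W g (j, x)))"
proof -
  have "ell2_inner Y (amplify T f) g = ell2_inner (J \<times> X) (W (amplify T f)) (W g)"
    using unitary_betweenD(4)[OF W amplify_mem(1)[OF T f] g] by simp
  also have "\<dots> = (\<Sum>\<^sub>\<infinity>j\<in>J. ell2_inner X (T (\<lambda>x. W f (j, x))) (\<lambda>x. W g (j, x)))"
    unfolding ell2_inner_Times[OF W_mem[OF amplify_mem(1)[OF T f]] W_mem[OF g]]
    by (intro infsum_cong) (simp add: W_amplify_slice[OF T f])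
  finally show ?thesis .
qed

text \<open>The bound of T survives because W is isometric and all blocks are equal; linearity is
  checked after applying the injective W.\<close>

lemma amplify_bounded:
  assumes T: "T \<in> bounded_ops X" shows "amplify T \<in> bounded_ops Y"
proof -
  obtain C where C: "C \<ge> 0" "\<And>f. f \<in> ell2 X \<Longrightarrow> ell2_norm X (T f) \<le> C * ell2_norm X f"
    using bounded_ops_bound[OF T] by blast
  show ?thesis
  proof (rule bounded_opsI[where C = C])
    show "amplify T \<in> extensional (ell2 Y)" by (simp add: amplify_def)
    show "amplify T f \<in> ell2 Y" if "f \<in> ell2 Y" for f by (rule amplify_mem(1)[OF T that])
    show "ell2_norm Y (amplify T f) \<le> C * ell2_norm Y f" if f: "f \<in> ell2 Y" for f
      using ell2_blockdiag_bounded(2)[where V = "\<lambda>_. T" and C = C, OF _ _ _ W_mem[OF f]] C bounded_opsD(1)[OF T]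
      by (simp add: unitary_norm[OF W, symmetric] amplify_mem[OF T] f)
    note lin = linear_on_spaceD[OF linear_blockdiag[where V = "\<lambda>_. T" and A = J, OF bounded_opsD(2)[OF T]]]
    have "amplify T (\<lambda>x. f x + g x) = (\<lambda>y. amplify T f y + amplify T g y)"
      if f: "f \<in> ell2 Y" and g: "g \<in> ell2 Y" for f g
      by (rule W_inj) (simp_all add: f g amplify_mem[OF T] ell2_add(1) W_linear W_mem lin)
    moreover have "amplify T (\<lambda>x. c * f x) = (\<lambda>y. c * amplify T f y)" if f: "f \<in> ell2 Y" for f c
      by (rule W_inj) (simp_all add: f amplify_mem[OF T] ell2_scale(1) W_linear W_mem lin)
    ultimately show "linear_on_space (ell2 Y) (amplify T)" by (simp add: linear_on_space_def)
  qed
qed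

text \<open>Reduces the algebraic identities below to slices, where an amplified operator is T
  itself.\<close>

lemma op_eqI:
  assumes "S \<in> extensional (ell2 Y)" "T \<in> extensional (ell2 Y)"
    and "\<And>f. f \<in> ell2 Y \<Longrightarrow> S f \<in> ell2 Y" "\<And>f. f \<in> ell2 Y \<Longrightarrow> T f \<in> ell2 Y"
    and "\<And>f j. f \<in> ell2 Y \<Longrightarrow> j \<in> J \<Longrightarrow> (\<lambda>x. W (S f) (j, x)) = (\<lambda>x. W (T f) (j, x))"
  shows "S = T"
  using assms by (intro extensionalityI[of S "ell2 Y"] W_eqI) auto


section \<open>Amplification is an injective unital *-homomorphism\<close>

lemma amplify_plus:
  assumes "S \<in> bounded_ops X" "T \<in> bounded_ops X"
  shows "amplify (op_plus X S T) = op_plus Y (amplify S) (amplify T)"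
proof (rule op_eqI)
  note [simp] = assms op_plus_bounded[OF assms]
  show "amplify (op_plus X S T) \<in> extensional (ell2 Y)" "op_plus Y (amplify S) (amplify T) \<in> extensional (ell2 Y)"
    by (simp_all add: amplify_def op_plus_def)
  fix f assume f: "f \<in> ell2 Y"
  show "amplify (op_plus X S T) f \<in> ell2 Y" "op_plus Y (amplify S) (amplify T) f \<in> ell2 Y"
    using f by (simp_all add: amplify_mem op_plus_def[of Y] ell2_add(1))
  fix j assume j: "j \<in> J"
  show "(\<lambda>x. W (amplify (op_plus X S T) f) (j, x)) = (\<lambda>x. W (op_plus Y (amplify S) (amplify T) f) (j, x))"
    using f j W_slice[OF f j]
    by (simp add: amplify_mem op_plus_def[of Y] W_linear ell2_blockdiag_def) (simp add: op_plus_def)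
qed

lemma amplify_scale:
  assumes "T \<in> bounded_ops X"
  shows "amplify (op_scale X c T) = op_scale Y c (amplify T)"
proof (rule op_eqI)
  note [simp] = assms op_scale_bounded[OF assms]
  show "amplify (op_scale X c T) \<in> extensional (ell2 Y)" "op_scale Y c (amplify T) \<in> extensional (ell2 Y)"
    by (simp_all add: amplify_def op_scale_def)
  fix f assume f: "f \<in> ell2 Y"
  show "amplify (op_scale X c T) f \<in> ell2 Y" "op_scale Y c (amplify T) f \<in> ell2 Y"
    using f by (simp_all add: amplify_mem op_scale_def[of Y] ell2_scale(1))
  fix j assume j: "j \<in> J"
  show "(\<lambda>x. W (amplify (op_scale X c T) f) (j, x)) = (\<lambda>x. W (op_scale Y c (amplify T) f) (j, x))"
    using f j W_slice[OF f j]
    by (simp add: amplify_mem op_scale_def[of Y] W_linear ell2_blockdiag_def) (simp add: op_scale_def)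
qed

lemma amplify_comp:
  assumes "S \<in> bounded_ops X" "T \<in> bounded_ops X"
  shows "amplify (op_comp X S T) = op_comp Y (amplify S) (amplify T)"
proof (rule op_eqI)
  note [simp] = assms op_comp_bounded[OF assms]
  show "amplify (op_comp X S T) \<in> extensional (ell2 Y)" "op_comp Y (amplify S) (amplify T) \<in> extensional (ell2 Y)"
    by (simp_all add: amplify_def op_comp_def)
  fix f assume f: "f \<in> ell2 Y"
  show "amplify (op_comp X S T) f \<in> ell2 Y" "op_comp Y (amplify S) (amplify T) f \<in> ell2 Y"
    using f by (simp_all add: amplify_mem op_comp_def[of Y] compose_def)
  fix j assume j: "j \<in> J"
  show "(\<lambda>x. W (amplify (op_comp X S T) f) (j, x)) = (\<lambda>x. W (op_comp Y (amplify S) (amplify T) f) (j, x))"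
    using f j W_slice[OF f j]
    by (simp add: amplify_mem op_comp_def[of Y] compose_def ell2_blockdiag_def)
      (simp add: op_comp_def compose_def)
qed

lemma amplify_id: "amplify (op_id X) = op_id Y"
proof (rule op_eqI)
  show "amplify (op_id X) \<in> extensional (ell2 Y)" "op_id Y \<in> extensional (ell2 Y)"
    by (simp_all add: amplify_def op_id_def)
  fix f assume f: "f \<in> ell2 Y"
  show "amplify (op_id X) f \<in> ell2 Y" "op_id Y f \<in> ell2 Y"
    using f by (simp_all add: amplify_mem op_id_bounded) (simp add: op_id_def)
  fix j assume j: "j \<in> J"
  show "(\<lambda>x. W (amplify (op_id X) f) (j, x)) = (\<lambda>x. W (op_id Y f) (j, x))"
    using W_amplify_slice[OF op_id_bounded f j] W_slice[OF f j] f by (simp add: op_id_def)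
qed

text \<open>The adjoint is moved across inside each summand of \<open>amplify_inner\<close>;
  uniqueness of adjoints then identifies the operator.\<close>

lemma amplify_adjoint:
  assumes T: "T \<in> bounded_ops X"
  shows "amplify (op_adjoint X T) = op_adjoint Y (amplify T)"
proof (rule op_adjoint_eqI[symmetric])
  note T' = op_adjoint_bounded(1)[OF T]
  show "amplify (op_adjoint X T) \<in> bounded_ops Y" by (rule amplify_bounded[OF T'])
  fix f g assume f: "f \<in> ell2 Y" and g: "g \<in> ell2 Y"
  have "ell2_inner Y (amplify T f) g = (\<Sum>\<^sub>\<infinity>j\<in>J. ell2_inner X (T (\<lambda>x. W f (j, x))) (\<lambda>x. W g (j, x)))"
    by (rule amplify_inner[OF T f g])
  also have "\<dots> = (\<Sum>\<^sub>\<infinity>j\<in>J. cnj (ell2_inner X (op_adjoint X T (\<lambda>x. W g (j, x))) (\<lambda>x. W f (j, x))))"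
    by (intro infsum_cong) (simp only: op_adjoint_bounded(2)[OF T W_slice[OF f] W_slice[OF g]] ell2_inner_cnj[symmetric])
  also have "\<dots> = cnj (ell2_inner Y (amplify (op_adjoint X T) g) f)"
    unfolding amplify_inner[OF T' g f] by (rule infsum_cnj)
  finally show "ell2_inner Y (amplify T f) g = ell2_inner Y f (amplify (op_adjoint X T) g)"
    by (simp only: ell2_inner_cnj[symmetric])
qed

text \<open>The function is the elementary tensor of the point mass at j with h. Its preimage under
  W is used as a test vector for injectivity and for surjectivity of the slice map.\<close>

lemma tensor_mem:
  assumes j: "j \<in> J" and h: "h \<in> ell2 X"
  shows "(\<lambda>(i, x). if i = j then h x else 0) \<in> ell2 (J \<times> X)" (is "?F \<in> _")
proof -
  have "(\<lambda>i. (ell2_norm X (\<lambda>x. ?F (i, x)))\<^sup>2) summable_on J \<longleftrightarrow>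
      (\<lambda>i. (ell2_norm X h)\<^sup>2) summable_on {j}"
    by (rule summable_on_cong_neutral) (use j in \<open>auto simp: ell2_norm_def\<close>)
  moreover have "(\<lambda>x. ?F (i, x)) \<in> ell2 X" for i using h by (cases "i = j") (simp_all add: ell2_zero)
  ultimately show ?thesis unfolding ell2_Times_iff using j by (auto simp: ell2_outside[OF h])
qed

text \<open>On the preimage of the elementary tensor at j, slice j of the amplified operator
  recovers \<open>T h\<close>.\<close>

lemma amplify_inj:
  assumes j: "j \<in> J" shows "inj_on amplify (bounded_ops X)"
proof (rule inj_onI)
  fix S T assume S: "S \<in> bounded_ops X" and T: "T \<in> bounded_ops X" and eq: "amplify S = amplify T"
  show "S = T"
  proof (rule extensionalityI[OF bounded_opsD(3)[OF S] bounded_opsD(3)[OF T]])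
    fix h assume h: "h \<in> ell2 X"
    obtain f where f: "f \<in> ell2 Y" "W f = (\<lambda>(i, x). if i = j then h x else 0)"
      using W_surj[OF tensor_mem[OF j h]] by blast
    show "S h = T h"
      using W_amplify_slice[OF S f(1) j] W_amplify_slice[OF T f(1) j] eq by (simp add: f(2))
  qed
qed

section \<open>Normality of amplification\<close>

text \<open>An ultraweak functional pulls back to a double sum over n and over j in J of
  coefficients of T. Since W is isometric, the squared slice norms of \<open>F n\<close> sum to its
  squared norm, so the slices form square summable families over pairs (n, j); these are then
  rearranged into sequences.\<close>

lemma amplify_ultraweak:
  assumes F: "F \<in> square_summable_seqs Y" and G: "G \<in> square_summable_seqs Y"
  obtains F' G' where "F' \<in> square_summable_seqs X" "G' \<in> square_summable_seqs X"
    "\<And>T. T \<in> bounded_ops X \<Longrightarrow>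
      (\<Sum>n. ell2_inner Y (amplify T (F n)) (G n)) = (\<Sum>n. ell2_inner X (T (F' n)) (G' n))"
proof -
  let ?w = "\<lambda>F (n, j) x. W (F n) (j, x)"
  have w: "?w F p \<in> ell2 X" if "F \<in> square_summable_seqs Y" "p \<in> UNIV \<times> J" for F p
    using that W_slice by (auto simp: square_summable_seqs_def)
  have s: "(\<lambda>p. (ell2_norm X (?w F p))\<^sup>2) summable_on UNIV \<times> J" if F: "F \<in> square_summable_seqs Y" for F
  proof (rule summable_on_SigmaI[where g = "\<lambda>n. (ell2_norm Y (F n))\<^sup>2"])
    fix n :: nat
    have Fn: "F n \<in> ell2 Y" using F by (simp add: square_summable_seqs_def)
    have "((\<lambda>j. (ell2_norm X (\<lambda>x. W (F n) (j, x)))\<^sup>2) has_sum (ell2_norm (J \<times> X) (W (F n)))\<^sup>2) J"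
      unfolding ell2_norm_Times[OF W_mem[OF Fn]] by (intro has_sum_infsum ell2_slice_summable W_mem Fn)
    then show "((\<lambda>j. (ell2_norm X (?w F (n, j)))\<^sup>2) has_sum (ell2_norm Y (F n))\<^sup>2) J"
      by (simp add: unitary_norm[OF W Fn])
    show "(\<lambda>n. (ell2_norm Y (F n))\<^sup>2) summable_on UNIV"
      using F by (auto simp: square_summable_seqs_def intro: summable_nonneg_imp_summable_on)
  qed simp
  obtain F' G' where FG: "F' \<in> square_summable_seqs X" "G' \<in> square_summable_seqs X"
    and eq: "\<And>T. T \<in> bounded_ops X \<Longrightarrow> (\<Sum>n. ell2_inner X (T (F' n)) (G' n))
      = (\<Sum>\<^sub>\<infinity>p\<in>UNIV \<times> J. ell2_inner X (T (?w F p)) (?w G p))"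
    using square_summable_enumeration[OF w[OF F] s[OF F] w[OF G] s[OF G]] by blast
  show thesis
  proof (rule that[OF FG])
    fix T assume T: "T \<in> bounded_ops X"
    let ?f = "\<lambda>p. ell2_inner X (T (?w F p)) (?w G p)"
    have sf: "?f summable_on UNIV \<times> J"
      by (rule inner_family_summable[OF T w[OF F] s[OF F] w[OF G] s[OF G]])
    have in_eq: "ell2_inner Y (amplify T (F n)) (G n) = (\<Sum>\<^sub>\<infinity>j\<in>J. ?f (n, j))" for n
      using F G amplify_inner[OF T, of "F n" "G n"] by (simp add: square_summable_seqs_def)
    have "(\<lambda>n. \<Sum>\<^sub>\<infinity>j\<in>J. ?f (n, j)) summable_on UNIV"
      using summable_on_Sigma_banach[of "\<lambda>n j. ?f (n, j)" UNIV "\<lambda>_. J"] sf by (simp add: case_prod_unfold)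
    then have "(\<Sum>n. ell2_inner Y (amplify T (F n)) (G n)) = (\<Sum>\<^sub>\<infinity>n. \<Sum>\<^sub>\<infinity>j\<in>J. ?f (n, j))"
      unfolding in_eq by (rule suminf_eq_infsum)
    also have "\<dots> = infsum ?f (UNIV \<times> J)" by (rule infsum_Sigma_banach[OF sf])
    finally show "(\<Sum>n. ell2_inner Y (amplify T (F n)) (G n)) = (\<Sum>n. ell2_inner X (T (F' n)) (G' n))"
      by (simp only: eq[OF T])
  qed
qed

text \<open>Continuity into an initial topology is tested on the defining functionals, and each of
  them pulls back to an ultraweak functional.\<close>

lemma amplify_normal:
  assumes M: "M \<subseteq> bounded_ops X" and N: "amplify ` M \<subseteq> N"
  shows "normal_map X M Y N amplify"
proof -
  let ?S = "square_summable_seqs Y \<times> square_summable_seqs Y"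
  let ?t = "subtopology (ultraweak_topology X) M"
  have top: "topspace ?t \<subseteq> M" by simp
  have "continuous_map ?t (ultraweak_topology Y) amplify"
    unfolding ultraweak_topology_def[of Y]
  proof (rule continuous_map_pullback')
    show "continuous_map ?t (product_topology (\<lambda>_. euclidean) ?S)
      ((\<lambda>T. \<lambda>(F, G)\<in>?S. \<Sum>n. ell2_inner Y (T (F n)) (G n)) \<circ> amplify)"
      unfolding continuous_map_componentwise
    proof (intro conjI ballI)
      fix p assume "p \<in> ?S"
      then obtain F G where p: "p = (F, G)" and F: "F \<in> square_summable_seqs Y" and G: "G \<in> square_summable_seqs Y" by blast
      obtain F' G' where F': "F' \<in> square_summable_seqs X" and G': "G' \<in> square_summable_seqs X"
        and eq: "\<And>T. T \<in> bounded_ops X \<Longrightarrow>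
          (\<Sum>n. ell2_inner Y (amplify T (F n)) (G n)) = (\<Sum>n. ell2_inner X (T (F' n)) (G' n))"
        using amplify_ultraweak[OF F G] by blast
      have "continuous_map (product_topology (\<lambda>_. euclidean) (square_summable_seqs X \<times> square_summable_seqs X))
          euclidean (\<lambda>\<Phi>. \<Phi> (F', G') :: complex)"
        using F' G' by (intro continuous_map_product_projection) simp
      from continuous_map_pullback[OF this, of "bounded_ops X"
          "\<lambda>T. \<lambda>(F, G)\<in>square_summable_seqs X \<times> square_summable_seqs X. \<Sum>n. ell2_inner X (T (F n)) (G n)"]
      have "continuous_map (ultraweak_topology X) euclidean (\<lambda>T. \<Sum>n. ell2_inner X (T (F' n)) (G' n))"
        unfolding ultraweak_topology_def using F' G' by (simp add: o_def)
      then have "continuous_map ?t euclidean (\<lambda>T. \<Sum>n. ell2_inner X (T (F' n)) (G' n))"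
        by (rule continuous_map_from_subtopology)
      then show "continuous_map ?t euclidean
          (\<lambda>T. ((\<lambda>T. \<lambda>(F, G)\<in>?S. \<Sum>n. ell2_inner Y (T (F n)) (G n)) \<circ> amplify) T p)"
        by (rule continuous_map_eq) (use top M F G in \<open>auto simp: p eq subset_iff\<close>)
    qed (auto simp: o_def)
    show "topspace ?t \<subseteq> amplify -` bounded_ops Y" using top M amplify_bounded by blast
  qed
  then show ?thesis
    unfolding normal_map_def using top N by (auto simp: continuous_map_in_subtopology)
qed

section \<open>The reducing subspace carried by one slice\<close>

text \<open>The subspace \<open>W\<^sup>-\<^sup>1 (\<delta>\<^sub>j \<otimes> \<ell>\<^sup>2(X))\<close>.\<close>

definition fibre :: "'j \<Rightarrow> ('y \<Rightarrow> complex) set" where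
  "fibre j = {f \<in> ell2 Y. \<forall>i x. i \<noteq> j \<longrightarrow> W f (i, x) = 0}"

lemma fibre_invariant:
  assumes T: "T \<in> bounded_ops X" and f: "f \<in> fibre j" shows "amplify T f \<in> fibre j"
proof -
  have fY: "f \<in> ell2 Y" and f0: "\<And>i x. i \<noteq> j \<Longrightarrow> W f (i, x) = 0" using f by (auto simp: fibre_def)
  have "W (amplify T f) (i, x) = 0" if "i \<noteq> j" for i x
    unfolding amplify_mem(2)[OF T fY]
    by (simp add: ell2_blockdiag_def f0[OF that] linear_zero[OF bounded_opsD(2)[OF T]])
  then show ?thesis by (simp add: fibre_def amplify_mem(1)[OF T fY])
qed

text \<open>For the orthogonal complement, move \<open>amplify T\<close> across the inner product:
  its adjoint is the amplification of the adjoint of T and so preserves the fibre.\<close>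

lemma reducing_fibre:
  assumes M: "M \<subseteq> bounded_ops X" shows "reducing_subspace Y M amplify (fibre j)"
proof -
  have "amplify T g \<in> ell2_orthogonal Y (fibre j)"
    if T: "T \<in> bounded_ops X" and g: "g \<in> ell2_orthogonal Y (fibre j)" for T g
  proof -
    have gY: "g \<in> ell2 Y" and g0: "\<And>f. f \<in> fibre j \<Longrightarrow> ell2_inner Y g f = 0"
      using g by (auto simp: ell2_orthogonal_def)
    have "ell2_inner Y (amplify T g) f = 0" if f: "f \<in> fibre j" for f
    proof -
      have "f \<in> ell2 Y" using f by (simp add: fibre_def)
      then have "ell2_inner Y (amplify T g) f = ell2_inner Y g (amplify (op_adjoint X T) f)"
        unfolding amplify_adjoint[OF T] by (rule op_adjoint_bounded(2)[OF amplify_bounded[OF T] gY])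
      then show ?thesis using g0[OF fibre_invariant[OF op_adjoint_bounded(1)[OF T] f]] by simp
    qed
    then show ?thesis by (simp add: ell2_orthogonal_def amplify_mem(1)[OF T gY])
  qed
  then show ?thesis using M fibre_invariant by (auto simp: reducing_subspace_def subset_iff)
qed

lemma fibre_other: "f \<in> fibre j \<Longrightarrow> i \<noteq> j \<Longrightarrow> (\<lambda>x. W f (i, x)) = (\<lambda>x. 0)"
  by (simp add: fibre_def)

text \<open>All slices other than j vanish, so one term of the sum over J survives.\<close>

lemma fibre_inner:
  assumes j: "j \<in> J" and f: "f \<in> fibre j" and g: "g \<in> fibre j"
  shows "ell2_inner X (\<lambda>x. W f (j, x)) (\<lambda>x. W g (j, x)) = ell2_inner Y f g"
proof -
  have fY: "f \<in> ell2 Y" and gY: "g \<in> ell2 Y" using f g by (simp_all add: fibre_def)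
  have "ell2_inner Y f g = (\<Sum>\<^sub>\<infinity>i\<in>J. ell2_inner X (\<lambda>x. W f (i, x)) (\<lambda>x. W g (i, x)))"
    using unitary_betweenD(4)[OF W fY gY] ell2_inner_Times[OF W_mem[OF fY] W_mem[OF gY]] by simp
  also have "\<dots> = (\<Sum>\<^sub>\<infinity>i\<in>{j}. ell2_inner X (\<lambda>x. W f (i, x)) (\<lambda>x. W g (i, x)))"
    by (rule infsum_cong_neutral) (use j fibre_other[OF f] in \<open>auto simp: ell2_inner_def\<close>)
  finally show ?thesis by simp
qed

lemma unitary_fibre:
  assumes j: "j \<in> J"
  shows "unitary_between Y (fibre j) X (ell2 X) (\<lambda>f x. W f (j, x))"
  unfolding unitary_between_def
proof (intro conjI ballI)
  have sub: "f \<in> ell2 Y" if "f \<in> fibre j" for f using that by (simp add: fibre_def)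
  show "linear_on_space (fibre j) (\<lambda>f x. W f (j, x))"
    using sub by (auto simp: linear_on_space_def W_linear)
  show "bij_betw (\<lambda>f x. W f (j, x)) (fibre j) (ell2 X)"
    unfolding bij_betw_def
  proof (intro conjI inj_onI subset_antisym subsetI)
    fix f g assume f: "f \<in> fibre j" and g: "g \<in> fibre j" and eq: "(\<lambda>x. W f (j, x)) = (\<lambda>x. W g (j, x))"
    show "f = g"
    proof (rule W_eqI[OF sub[OF f] sub[OF g]])
      show "(\<lambda>x. W f (i, x)) = (\<lambda>x. W g (i, x))" for i
        using eq fibre_other[OF f, of i] fibre_other[OF g, of i] by (cases "i = j") auto
    qed
  next
    show "h \<in> ell2 X" if "h \<in> (\<lambda>f x. W f (j, x)) ` fibre j" for h
      using that sub W_slice[OF _ j] by blast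
  next
    fix h assume h: "h \<in> ell2 X"
    obtain f where f: "f \<in> ell2 Y" "W f = (\<lambda>(i, x). if i = j then h x else 0)"
      using W_surj[OF tensor_mem[OF j h]] by blast
    then have "f \<in> fibre j" "h = (\<lambda>x. W f (j, x))" by (auto simp: fibre_def)
    then show "h \<in> (\<lambda>f x. W f (j, x)) ` fibre j" by blast
  qed
qed (rule fibre_inner[OF j])

text \<open>The fibre contains the closed span because each coordinate of \<open>W f\<close> is norm
  continuous. Conversely, truncating slice j of a fibre vector to a finite set gives a combination
  of the \<open>v x\<close> at the same small distance.\<close>

lemma closed_span_fibre:
  assumes j: "j \<in> J" and v: "\<And>x. x \<in> X \<Longrightarrow> v x \<in> ell2 Y" "\<And>x. x \<in> X \<Longrightarrow> W (v x) = ell2_delta (j, x)"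
  shows "ell2_closed_span Y (v ` X) = fibre j"
proof (intro subset_antisym subsetI)
  note Wlin = unitary_betweenD(1)[OF W]
  fix f assume "f \<in> ell2_closed_span Y (v ` X)"
  then have f: "f \<in> ell2 Y" and approx: "\<And>\<epsilon>. \<epsilon> > 0 \<Longrightarrow> \<exists>F c. finite F \<and> F \<subseteq> v ` X \<and>
      ell2_norm Y (\<lambda>y. f y - (\<Sum>w\<in>F. c w * w y)) < \<epsilon>"
    by (auto simp: ell2_closed_span_def)
  have "W f (i, x) = 0" if i: "i \<noteq> j" for i x
  proof -
    \<comment> \<open>The approximating combination has coordinate 0 at (i, x), so this coordinate
      is bounded by the norm of the error.\<close>
    have "cmod (W f (i, x)) \<le> 0 + \<epsilon>" if e: "\<epsilon> > 0" for \<epsilon>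
    proof -
      obtain F c where F: "finite F" "F \<subseteq> v ` X" and n: "ell2_norm Y (\<lambda>y. f y - (\<Sum>w\<in>F. c w * w y)) < \<epsilon>"
        using approx[OF e] by blast
      have wY: "w \<in> ell2 Y" if "w \<in> F" for w using that F(2) v(1) by auto
      have w0: "W w (i, x) = 0" if "w \<in> F" for w
        using that F(2) v(2) i by (auto simp: ell2_delta_def)
      let ?s = "\<lambda>y. \<Sum>w\<in>F. c w * w y"
      have s: "?s \<in> ell2 Y" using ell2_sum[OF F(1), of "\<lambda>w. w"] wY by simp
      have "W ?s = (\<lambda>p. \<Sum>w\<in>F. c w * W w p)" using linear_sum[OF Wlin F(1), of "\<lambda>w. w"] wY by simp
      then have "W (\<lambda>y. f y - ?s y) (i, x) = W f (i, x)"
        using w0 by (simp add: linear_diff[OF Wlin f s])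
      then have "cmod (W f (i, x)) \<le> ell2_norm (J \<times> X) (W (\<lambda>y. f y - ?s y))"
        using ell2_point_bound[OF W_mem[OF ell2_diff[OF f s]], of "(i, x)"] by simp
      then show ?thesis using n unfolding unitary_norm[OF W ell2_diff[OF f s]] by simp
    qed
    then have "cmod (W f (i, x)) \<le> 0" by (rule field_le_epsilon)
    then show ?thesis by simp
  qed
  then show "f \<in> fibre j" using f by (simp add: fibre_def)
next
  note Wlin = unitary_betweenD(1)[OF W]
  fix f assume fj: "f \<in> fibre j"
  then have f: "f \<in> ell2 Y" by (simp add: fibre_def)
  define h where "h = (\<lambda>x. W f (j, x))"
  have h: "h \<in> ell2 X" unfolding h_def by (rule W_slice[OF f j])
  \<comment> \<open>\<open>ell2_closed_span\<close> sums over a set of vectors; injectivity turns a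
    sum over points x into one over their images.\<close>
  have inj: "inj_on v X"
  proof (rule inj_onI)
    fix x y assume "x \<in> X" "y \<in> X" "v x = v y"
    then have "ell2_delta (j, x) (j, y) = (ell2_delta (j, y) (j, y) :: complex)" using v(2) by metis
    then show "x = y" by (simp add: ell2_delta_def split: if_splits)
  qed
  have "\<exists>F c. finite F \<and> F \<subseteq> v ` X \<and> ell2_norm Y (\<lambda>y. f y - (\<Sum>w\<in>F. c w * w y)) < \<epsilon>"
    if e: "\<epsilon> > 0" for \<epsilon>
  proof -
    obtain C where C: "finite C" "C \<subseteq> X" and n: "ell2_norm X (\<lambda>y. h y - (\<Sum>x\<in>C. h x * ell2_delta x y)) < \<epsilon>"
      using ell2_approx[OF h e] by blast
    let ?s = "\<lambda>y. \<Sum>x\<in>C. h x * v x y"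
    have vC: "v x \<in> ell2 Y" if "x \<in> C" for x using that C v(1) by auto
    have s: "?s \<in> ell2 Y" using C vC by (intro ell2_sum) auto
    let ?d = "\<lambda>y. f y - ?s y"
    have d: "?d \<in> ell2 Y" by (rule ell2_diff[OF f s])
    have "W ?s = (\<lambda>p. \<Sum>x\<in>C. h x * W (v x) p)" by (rule linear_sum[OF Wlin C(1) vC])
    also have "\<dots> = (\<lambda>p. \<Sum>x\<in>C. h x * ell2_delta (j, x) p)"
      using C v(2) by (intro ext sum.cong) auto
    finally have Wd: "W ?d = (\<lambda>p. W f p - (\<Sum>x\<in>C. h x * ell2_delta (j, x) p))"
      by (simp add: linear_diff[OF Wlin f s])
    \<comment> \<open>The correction lives in slice j, so the error stays in the fibre and its norm
      is that of slice j.\<close>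
    have "?d \<in> fibre j" using fj d by (simp add: fibre_def Wd ell2_delta_def)
    then have "ell2_inner Y ?d ?d = ell2_inner X (\<lambda>x. W ?d (j, x)) (\<lambda>x. W ?d (j, x))"
      using fibre_inner[OF j] by simp
    then have "(ell2_norm Y ?d)\<^sup>2 = (ell2_norm X (\<lambda>x. W ?d (j, x)))\<^sup>2"
      by (simp only: ell2_inner_self[OF d] ell2_inner_self[OF W_slice[OF d j]] of_real_eq_iff)
    moreover have "(\<lambda>x. W ?d (j, x)) = (\<lambda>y. h y - (\<Sum>x\<in>C. h x * ell2_delta x y))"
      unfolding Wd by (simp add: h_def ell2_delta_def)
    ultimately have "ell2_norm Y ?d < \<epsilon>" using n by (simp add: ell2_norm_nonneg)
    moreover have "?s y = (\<Sum>w\<in>v ` C. h (inv_into X v w) * w y)" for y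
    proof -
      have "(\<Sum>w\<in>v ` C. h (inv_into X v w) * w y) = (\<Sum>x\<in>C. h (inv_into X v (v x)) * v x y)"
        by (subst sum.reindex[OF inj_on_subset[OF inj C(2)]]) simp
      also have "\<dots> = ?s y" using C(2) inj by (intro sum.cong) (auto simp: inv_into_f_f subset_iff)
      finally show "?s y = (\<Sum>w\<in>v ` C. h (inv_into X v w) * w y)" by simp
    qed
    ultimately show ?thesis
      using C by (intro exI[of _ "v ` C"] exI[of _ "\<lambda>w. h (inv_into X v w)"]) auto
  qed
  then show "f \<in> ell2_closed_span Y (v ` X)" using f by (simp add: ell2_closed_span_def)
qed

end

section \<open>Extending the left regular representation of an almost normal subgroup\<close>

lemma ell2_mono: "A \<subseteq> B \<Longrightarrow> ell2 A \<subseteq> ell2 B"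
proof
  fix f assume A: "A \<subseteq> B" and f: "f \<in> ell2 A"
  have "(\<lambda>x. (cmod (f x))\<^sup>2) summable_on B \<longleftrightarrow> (\<lambda>x. (cmod (f x))\<^sup>2) summable_on A"
    by (rule summable_on_cong_neutral) (use A ell2_outside[OF f] in auto)
  then show "f \<in> ell2 B" using ell2_summable[OF f] A ell2_outside[OF f] by (auto simp: ell2_def)
qed

lemma continuous_weak_functional:
  assumes "f \<in> ell2 X" "g \<in> ell2 X"
  shows "continuous_map (weak_op_topology X) euclidean (\<lambda>T. ell2_inner X (T f) g)"
proof -
  have "continuous_map (product_topology (\<lambda>_. euclidean) (ell2 X \<times> ell2 X)) euclidean (\<lambda>\<Phi>. \<Phi> (f, g) :: complex)"
    using assms by (intro continuous_map_product_projection) simp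
  from continuous_map_pullback[OF this, of "bounded_ops X" "\<lambda>T. \<lambda>(f, g)\<in>ell2 X \<times> ell2 X. ell2_inner X (T f) g"]
  show ?thesis unfolding weak_op_topology_def using assms by (simp add: o_def)
qed

locale regular_extension = hecke_pair G \<Gamma> for G :: "('a, 'b) monoid_scheme" (structure) and \<Gamma> +
  fixes \<pi> :: "'a \<Rightarrow> 'a ell2_op"
  assumes pi_hom: "\<pi> \<in> hom G (unitary_group \<Gamma>)"
    and pi_regular: "\<forall>\<gamma>\<in>\<Gamma>. \<pi> \<gamma> = left_regular G \<Gamma> \<gamma>"
begin

section \<open>The representation and its matrix coefficient\<close>

abbreviation "vac \<equiv> ell2_delta \<one>"
abbreviation "t \<equiv> t_coeff G \<Gamma> \<pi>"

lemma pi_unitary: "g \<in> carrier G \<Longrightarrow> unitary_between \<Gamma> (ell2 \<Gamma>) \<Gamma> (ell2 \<Gamma>) (\<pi> g)"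
  using pi_hom by (auto simp: hom_def unitary_group_def)

lemma pi_mem: "g \<in> carrier G \<Longrightarrow> f \<in> ell2 \<Gamma> \<Longrightarrow> \<pi> g f \<in> ell2 \<Gamma>"
  using unitary_betweenD(3)[OF pi_unitary] .

lemma pi_mult:
  "g \<in> carrier G \<Longrightarrow> h \<in> carrier G \<Longrightarrow> f \<in> ell2 \<Gamma> \<Longrightarrow> \<pi> (g \<otimes> h) f = \<pi> g (\<pi> h f)"
  using hom_mult[OF pi_hom] by (simp add: unitary_group_def op_comp_def compose_def)

lemma pi_one: "f \<in> ell2 \<Gamma> \<Longrightarrow> \<pi> \<one> f = f"
  using pi_regular by (auto simp: left_regular_def fun_eq_iff ell2_outside)

lemma vac_mem: "vac \<in> ell2 \<Gamma>"
  by (simp add: ell2_delta_mem)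

text \<open>This is where the regular representation enters: the \<Gamma>-orbit of e is the standard
  basis of \<open>ell2 \<Gamma>\<close>.\<close>

lemma pi_Gamma_vac: "\<gamma> \<in> \<Gamma> \<Longrightarrow> \<pi> \<gamma> vac = ell2_delta \<gamma>"
proof
  fix x assume \<gamma>: "\<gamma> \<in> \<Gamma>"
  have "inv \<gamma> \<otimes> x = \<one> \<longleftrightarrow> x = \<gamma>" if "x \<in> \<Gamma>"
    using \<gamma> that by (metis Gamma_mem inv_closed inv_equality inv_inv l_inv)
  then show "\<pi> \<gamma> vac x = ell2_delta \<gamma> x"
    using \<gamma> pi_regular vac_mem by (auto simp: left_regular_def ell2_delta_def)
qed

lemma pi_adjoint:
  assumes "g \<in> carrier G" "f \<in> ell2 \<Gamma>" "h \<in> ell2 \<Gamma>"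
  shows "ell2_inner \<Gamma> (\<pi> g f) h = ell2_inner \<Gamma> f (\<pi> (inv g) h)"
proof -
  have "ell2_inner \<Gamma> (\<pi> g f) (\<pi> g (\<pi> (inv g) h)) = ell2_inner \<Gamma> f (\<pi> (inv g) h)"
    using assms by (intro unitary_betweenD(4)[OF pi_unitary] pi_mem) auto
  then show ?thesis using assms pi_mult[of g "inv g" h] by (simp add: pi_one)
qed

text \<open>Exhibits t(h g^-1) as an entry of the Gram matrix of the vectors that the untwisting
  unitary attaches to g and h.\<close>

lemma t_mult_inv:
  assumes "g \<in> carrier G" "h \<in> carrier G"
  shows "t (h \<otimes> inv g) = ell2_inner \<Gamma> (\<pi> (inv g) vac) (\<pi> (inv h) vac)"
  using assms by (simp add: t_coeff_def pi_mult pi_adjoint pi_mem vac_mem)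

text \<open>The values of t along a coset are the coordinates of a single vector of
  \<open>ell2 \<Gamma>\<close>; this is the source of square summability.\<close>

lemma t_inv_mult:
  assumes "\<gamma> \<in> \<Gamma>" "g \<in> carrier G" shows "t (inv \<gamma> \<otimes> g) = \<pi> g vac \<gamma>"
proof -
  have "t (inv \<gamma> \<otimes> g) = ell2_inner \<Gamma> (\<pi> g vac) (\<pi> \<gamma> vac)"
    unfolding t_coeff_def using assms pi_adjoint[of "inv \<gamma>" "\<pi> g vac" vac]
    by (simp add: pi_mult pi_mem vac_mem)
  then show ?thesis using assms by (simp add: pi_Gamma_vac ell2_inner_delta_right)
qed

section \<open>The partition of the group into right cosets\<close>

definition rep :: "'a set \<Rightarrow> 'a" where "rep c = (SOME h. h \<in> c)"

lemma rep_mem: "c \<in> rcosets \<Gamma> \<Longrightarrow> rep c \<in> c"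
  unfolding rep_def by (rule some_in_coset)

lemma rep_carrier: "c \<in> rcosets \<Gamma> \<Longrightarrow> rep c \<in> carrier G"
  using rep_mem coset_carrier by blast

text \<open>The inverse of \<gamma> is used so that the element \<gamma>^-1 g of the coset
  corresponds to \<gamma>, matching both \<open>t_inv_mult\<close> and the identity \<pi>(g^-1)
  \<pi>(\<gamma>) e = \<pi>((\<gamma>^-1 g)^-1) e.\<close>

lemma coset_bij:
  assumes c: "c \<in> rcosets \<Gamma>" and g: "g \<in> c"
  shows "bij_betw (\<lambda>\<gamma>. inv \<gamma> \<otimes> g) \<Gamma> c"
proof (rule bij_betw_byWitness[where f' = "\<lambda>x. g \<otimes> inv x"])
  have gG: "g \<in> carrier G" using coset_carrier[OF c g] .
  have c_eq: "c = \<Gamma> #> g" using coset_eq[OF c g] .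
  show "\<forall>\<gamma>\<in>\<Gamma>. g \<otimes> inv (inv \<gamma> \<otimes> g) = \<gamma>"
    using gG by (auto simp: inv_mult_group m_assoc[symmetric])
  show "\<forall>x\<in>c. inv (g \<otimes> inv x) \<otimes> g = x"
    using gG coset_carrier[OF c] by (auto simp: inv_mult_group m_assoc)
  show "(\<lambda>\<gamma>. inv \<gamma> \<otimes> g) ` \<Gamma> \<subseteq> c" using Gamma_closed(2) by (fastforce simp: c_eq coset_mem)
  show "(\<lambda>x. g \<otimes> inv x) ` c \<subseteq> \<Gamma>"
  proof
    fix y assume "y \<in> (\<lambda>x. g \<otimes> inv x) ` c"
    then obtain \<gamma> where "\<gamma> \<in> \<Gamma>" "y = g \<otimes> inv (\<gamma> \<otimes> g)" by (auto simp: c_eq coset_mem)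
    then have "y = inv \<gamma>" using gG by (simp add: inv_mult_group m_assoc[symmetric])
    then show "y \<in> \<Gamma>" using \<open>\<gamma> \<in> \<Gamma>\<close> by simp
  qed
qed

lemma coset_disjoint: "c \<in> rcosets \<Gamma> \<Longrightarrow> d \<in> rcosets \<Gamma> \<Longrightarrow> x \<in> c \<Longrightarrow> x \<in> d \<Longrightarrow> c = d"
  using coset_eq by metis

lemma group_bij: "bij_betw (\<lambda>(c, \<gamma>). inv \<gamma> \<otimes> rep c) ((rcosets \<Gamma>) \<times> \<Gamma>) (carrier G)"
  unfolding bij_betw_def
proof (intro conjI inj_onI subset_antisym subsetI)
  note b = coset_bij[OF _ rep_mem]
  fix p q assume p: "p \<in> (rcosets \<Gamma>) \<times> \<Gamma>" and q: "q \<in> (rcosets \<Gamma>) \<times> \<Gamma>"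
    and eq: "(\<lambda>(c, \<gamma>). inv \<gamma> \<otimes> rep c) p = (\<lambda>(c, \<gamma>). inv \<gamma> \<otimes> rep c) q"
  obtain c \<gamma> d \<delta> where pq: "p = (c, \<gamma>)" "q = (d, \<delta>)" by fastforce
  have mem: "inv \<gamma> \<otimes> rep c \<in> c" "inv \<delta> \<otimes> rep d \<in> d"
    using p q pq bij_betw_apply[OF b] by auto
  then have "c = d" using eq p q pq coset_disjoint[of c d "inv \<gamma> \<otimes> rep c"] by simp
  then show "p = q" using bij_betw_imp_inj_on[OF b, of c] p q pq eq by (auto simp: inj_on_def)
next
  fix x assume "x \<in> (\<lambda>(c, \<gamma>). inv \<gamma> \<otimes> rep c) ` ((rcosets \<Gamma>) \<times> \<Gamma>)"
  then show "x \<in> carrier G" using rep_carrier by auto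
next
  fix x assume x: "x \<in> carrier G"
  let ?c = "\<Gamma> #> x"
  have c: "?c \<in> rcosets \<Gamma>" "x \<in> ?c" using x by simp_all
  have "x \<in> (\<lambda>\<gamma>. inv \<gamma> \<otimes> rep ?c) ` \<Gamma>"
    using bij_betw_imp_surj_on[OF coset_bij[OF c(1) rep_mem[OF c(1)]]] c(2) by (simp only:)
  then obtain \<gamma> where \<gamma>: "\<gamma> \<in> \<Gamma>" "x = inv \<gamma> \<otimes> rep ?c" by (rule imageE)
  have "x = (\<lambda>(c, \<gamma>). inv \<gamma> \<otimes> rep c) (?c, \<gamma>)" unfolding prod.case by (rule \<gamma>(2))
  then show "x \<in> (\<lambda>(c, \<gamma>). inv \<gamma> \<otimes> rep c) ` ((rcosets \<Gamma>) \<times> \<Gamma>)"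
    by (rule image_eqI) (use c(1) \<gamma>(1) in blast)
qed

section \<open>The untwisting unitary\<close>

text \<open>
  The unitary with \<open>\<delta>\<^sub>g \<mapsto> \<pi>(g\<^sup>-\<^sup>1)e \<otimes> [\<Gamma>g]\<close>; the coset representatives are needed only to write
  it down.
\<close>

definition untwist :: "('a \<Rightarrow> complex) \<Rightarrow> ('a \<times> 'a set \<Rightarrow> complex)" where
  "untwist f = ell2_relabel (\<Gamma> \<times> (rcosets \<Gamma>)) (\<lambda>(\<gamma>, c). (c, \<gamma>))
     (ell2_blockdiag (rcosets \<Gamma>) (\<lambda>c. \<pi> (inv (rep c)))
       (ell2_relabel ((rcosets \<Gamma>) \<times> \<Gamma>) (\<lambda>(c, \<gamma>). inv \<gamma> \<otimes> rep c) f))"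

text \<open>Three unitaries are composed: split the group into cosets, rotate each coset's copy of
  \<open>ell2 \<Gamma>\<close> by \<pi>, and swap factors so that \<Gamma> indexes the
  multiplicity.\<close>

lemma untwist_unitary:
  "unitary_between (carrier G) (ell2 (carrier G)) (\<Gamma> \<times> (rcosets \<Gamma>)) (ell2 (\<Gamma> \<times> (rcosets \<Gamma>))) untwist"
proof -
  have swap: "bij_betw (\<lambda>(\<gamma>, c). (c, \<gamma>)) (\<Gamma> \<times> (rcosets \<Gamma>)) ((rcosets \<Gamma>) \<times> \<Gamma>)"
    by (rule bij_betw_byWitness[where f' = "\<lambda>(c, \<gamma>). (\<gamma>, c)"]) auto
  have block: "unitary_between ((rcosets \<Gamma>) \<times> \<Gamma>) (ell2 ((rcosets \<Gamma>) \<times> \<Gamma>)) ((rcosets \<Gamma>) \<times> \<Gamma>)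
      (ell2 ((rcosets \<Gamma>) \<times> \<Gamma>)) (ell2_blockdiag (rcosets \<Gamma>) (\<lambda>c. \<pi> (inv (rep c))))"
    using rep_carrier by (intro unitary_blockdiag pi_unitary) auto
  have "untwist = (\<lambda>f. ell2_relabel (\<Gamma> \<times> (rcosets \<Gamma>)) (\<lambda>(\<gamma>, c). (c, \<gamma>))
     (ell2_blockdiag (rcosets \<Gamma>) (\<lambda>c. \<pi> (inv (rep c)))
       (ell2_relabel ((rcosets \<Gamma>) \<times> \<Gamma>) (\<lambda>(c, \<gamma>). inv \<gamma> \<otimes> rep c) f)))"
    by (simp add: fun_eq_iff untwist_def)
  then show ?thesis
    using unitary_between_comp[OF unitary_between_comp[OF unitary_relabel[OF group_bij] block]
        unitary_relabel[OF swap]] by simp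
qed

lemma untwist_apply:
  "untwist f (\<gamma>, c) = (if \<gamma> \<in> \<Gamma> \<and> c \<in> rcosets \<Gamma>
     then \<pi> (inv (rep c)) (\<lambda>\<delta>. if \<delta> \<in> \<Gamma> then f (inv \<delta> \<otimes> rep c) else 0) \<gamma> else 0)"
  by (simp add: untwist_def ell2_relabel_def ell2_blockdiag_def cong: if_cong)

lemma linear_pi: "g \<in> carrier G \<Longrightarrow> linear_on_space (ell2 \<Gamma>) (\<pi> g)"
  using unitary_betweenD(1)[OF pi_unitary] .

text \<open>With s the representative and g = \<delta>^-1 s, the slice at the coset of g is the
  point mass at \<delta>, which is \<pi>(\<delta>) e. The block \<pi>(s^-1) sends it to \<pi>(g^-1)
  e, so the choice of s disappears.\<close>

lemma untwist_delta:
  assumes g: "g \<in> carrier G"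
  shows "untwist (ell2_delta g) (\<gamma>, c) = (if \<gamma> \<in> \<Gamma> then \<pi> (inv g) vac \<gamma> * ell2_delta (\<Gamma> #> g) c else 0)"
proof (cases "\<gamma> \<in> \<Gamma> \<and> c \<in> rcosets \<Gamma>")
  case False
  then show ?thesis using g by (auto simp: untwist_apply ell2_delta_def)
next
  case True
  then have c: "c \<in> rcosets \<Gamma>" and \<gamma>: "\<gamma> \<in> \<Gamma>" by auto
  let ?s = "rep c" and ?f = "\<lambda>\<delta>. if \<delta> \<in> \<Gamma> then ell2_delta g (inv \<delta> \<otimes> rep c) else 0"
  have s: "?s \<in> carrier G" using rep_carrier[OF c] .
  note b = coset_bij[OF c rep_mem[OF c]]
  show ?thesis
  proof (cases "c = \<Gamma> #> g")
    case eq: True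
    then have "g \<in> c" using g by simp
    then obtain \<delta> where \<delta>: "\<delta> \<in> \<Gamma>" "g = inv \<delta> \<otimes> ?s"
      using bij_betw_imp_surj_on[OF b] by blast
    have "inv \<delta>' \<otimes> ?s = g \<longleftrightarrow> \<delta>' = \<delta>" if "\<delta>' \<in> \<Gamma>" for \<delta>'
      using bij_betw_imp_inj_on[OF b] that \<delta> by (auto simp: inj_on_def)
    then have "?f = ell2_delta \<delta>" using \<delta>(1) by (auto simp: fun_eq_iff ell2_delta_def)
    then have "\<pi> (inv ?s) ?f = \<pi> (inv ?s) (\<pi> \<delta> vac)" using pi_Gamma_vac[OF \<delta>(1)] by simp
    also have "\<dots> = \<pi> (inv g) vac"
      using \<delta> s vac_mem by (simp add: pi_mult[symmetric] inv_mult_group)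
    finally have "untwist (ell2_delta g) (\<gamma>, c) = \<pi> (inv g) vac \<gamma>"
      using \<gamma> c by (simp add: untwist_apply)
    moreover have "ell2_delta (\<Gamma> #> g) c = 1" by (simp add: eq ell2_delta_def)
    ultimately show ?thesis using \<gamma> by simp
  next
    case ne: False
    then have "g \<notin> c" using coset_eq[OF c] by blast
    then have "inv \<delta> \<otimes> ?s \<noteq> g" if "\<delta> \<in> \<Gamma>" for \<delta> using bij_betw_apply[OF b that] by blast
    then have "?f = (\<lambda>_. 0)" by (auto simp: fun_eq_iff ell2_delta_def)
    then have "\<pi> (inv ?s) ?f = (\<lambda>_. 0)" using linear_zero[OF linear_pi] s by simp
    then have "untwist (ell2_delta g) (\<gamma>, c) = 0" using \<gamma> c by (simp add: untwist_apply)
    moreover have "ell2_delta (\<Gamma> #> g) c = 0" using ne by (simp add: ell2_delta_def)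
    ultimately show ?thesis by simp
  qed
qed

section \<open>The vectors attached to cosets and double cosets\<close>

lemma t_vec_coset_mem:
  assumes c: "c \<in> rcosets \<Gamma>" shows "t_vec G \<Gamma> \<pi> c \<in> ell2 c"
proof -
  note b = coset_bij[OF c rep_mem[OF c]]
  have "(\<lambda>\<gamma>. (cmod (\<pi> (rep c) vac \<gamma>))\<^sup>2) summable_on \<Gamma>"
    using rep_carrier[OF c] by (intro ell2_summable pi_mem vac_mem)
  then have "(\<lambda>\<gamma>. (cmod (t (inv \<gamma> \<otimes> rep c)))\<^sup>2) summable_on \<Gamma>"
    using rep_carrier[OF c] by (simp add: t_inv_mult cong: summable_on_cong)
  then have "(\<lambda>\<theta>. (cmod (t \<theta>))\<^sup>2) summable_on c"
    using summable_on_reindex_bij_betw[OF b, of "\<lambda>\<theta>. (cmod (t \<theta>))\<^sup>2"] by simp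
  then show ?thesis by (simp add: ell2_def t_vec_def cong: summable_on_cong)
qed

lemma coset_sub_carrier: "c \<in> rcosets \<Gamma> \<Longrightarrow> c \<subseteq> carrier G"
  using coset_carrier by blast

lemma t_vec_coset_carrier: "c \<in> rcosets \<Gamma> \<Longrightarrow> t_vec G \<Gamma> \<pi> c \<in> ell2 (carrier G)"
  using t_vec_coset_mem ell2_mono[OF coset_sub_carrier] by blast

text \<open>For the representative s of c, reading t along c gives the coordinates of \<pi>(s) e,
  and the block \<pi>(s^-1) returns this vector to e. Distinct cosets are disjoint, so the other
  slices vanish.\<close>

lemma untwist_t_vec:
  assumes c: "c \<in> rcosets \<Gamma>" shows "untwist (t_vec G \<Gamma> \<pi> c) = ell2_delta (\<one>, c)"
proof
  fix p :: "'a \<times> 'a set"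
  obtain \<gamma> d where p: "p = (\<gamma>, d)" by (cases p)
  show "untwist (t_vec G \<Gamma> \<pi> c) p = ell2_delta (\<one>, c) p"
  proof (cases "\<gamma> \<in> \<Gamma> \<and> d \<in> rcosets \<Gamma>")
    case False
    then show ?thesis using c by (auto simp: p untwist_apply ell2_delta_def)
  next
    case True
    then have d: "d \<in> rcosets \<Gamma>" and \<gamma>: "\<gamma> \<in> \<Gamma>" by auto
    let ?s = "rep d" and ?f = "\<lambda>\<delta>. if \<delta> \<in> \<Gamma> then t_vec G \<Gamma> \<pi> c (inv \<delta> \<otimes> rep d) else 0"
    have s: "?s \<in> carrier G" using rep_carrier[OF d] .
    have mem: "inv \<delta> \<otimes> ?s \<in> d" if "\<delta> \<in> \<Gamma>" for \<delta>
      using bij_betw_apply[OF coset_bij[OF d rep_mem[OF d]] that] .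
    show ?thesis
    proof (cases "d = c")
      case True
      have "?f = \<pi> ?s vac"
        using mem ell2_outside[OF pi_mem[OF s vac_mem]]
        by (auto simp: fun_eq_iff True[symmetric] t_vec_def t_inv_mult s)
      then have "\<pi> (inv ?s) ?f = vac" using s vac_mem by (simp add: pi_mult[symmetric] pi_one)
      then have "untwist (t_vec G \<Gamma> \<pi> c) p = vac \<gamma>" using \<gamma> d by (simp add: p untwist_apply)
      then show ?thesis by (simp add: p True ell2_delta_def)
    next
      case False
      then have "?f = (\<lambda>_. 0)"
        using mem coset_disjoint[OF c d] by (auto simp: fun_eq_iff t_vec_def)
      then have "\<pi> (inv ?s) ?f = (\<lambda>_. 0)" using linear_zero[OF linear_pi] s by simp
      then show ?thesis using \<gamma> d False by (simp add: p untwist_apply ell2_delta_def)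
    qed
  qed
qed

lemma t_vec_orthonormal:
  assumes c: "c \<in> rcosets \<Gamma>" and d: "d \<in> rcosets \<Gamma>"
  shows "ell2_inner (carrier G) (t_vec G \<Gamma> \<pi> c) (t_vec G \<Gamma> \<pi> d) = (if c = d then 1 else 0)"
proof -
  have "ell2_inner (carrier G) (t_vec G \<Gamma> \<pi> c) (t_vec G \<Gamma> \<pi> d)
      = ell2_inner (\<Gamma> \<times> (rcosets \<Gamma>)) (ell2_delta (\<one>, c)) (ell2_delta (\<one>, d))"
    using unitary_betweenD(4)[OF untwist_unitary t_vec_coset_carrier[OF c] t_vec_coset_carrier[OF d]]
    by (simp add: untwist_t_vec c d)
  also have "\<dots> = (if c = d then 1 else 0)"
    using c by (subst ell2_inner_delta) (auto simp: ell2_delta_def)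
  finally show ?thesis .
qed

text \<open>Almost normality makes the double coset a finite disjoint union of right cosets, so its
  vector is a finite sum of coset vectors.\<close>

lemma t_vec_dcoset_mem:
  assumes D: "D \<in> double_cosets G \<Gamma>" shows "t_vec G \<Gamma> \<pi> D \<in> ell2 D"
proof -
  have "(\<lambda>\<theta>. \<Sum>c\<in>cosets_in G \<Gamma> D. 1 * t_vec G \<Gamma> \<pi> c \<theta>) \<in> ell2 D"
  proof (rule ell2_sum[OF finite_cosets_in[OF D]])
    fix c assume "c \<in> cosets_in G \<Gamma> D"
    then show "t_vec G \<Gamma> \<pi> c \<in> ell2 D"
      using t_vec_coset_mem[of c] ell2_mono[of c D] by (auto simp: cosets_in_def)
  qed
  moreover have "(\<Sum>c\<in>cosets_in G \<Gamma> D. 1 * t_vec G \<Gamma> \<pi> c \<theta>) = t_vec G \<Gamma> \<pi> D \<theta>" for \<theta>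
  proof (cases "\<theta> \<in> D")
    case True
    then have \<theta>: "\<theta> \<in> carrier G" using dcoset_carrier[OF D] by blast
    have "(\<Sum>c\<in>cosets_in G \<Gamma> D. 1 * t_vec G \<Gamma> \<pi> c \<theta>) = (\<Sum>c\<in>{\<Gamma> #> \<theta>}. t_vec G \<Gamma> \<pi> c \<theta>)"
    proof (rule sum.mono_neutral_cong_right[OF finite_cosets_in[OF D]])
      show "{\<Gamma> #> \<theta>} \<subseteq> cosets_in G \<Gamma> D"
        using True \<theta> coset_subset[OF D \<theta>] by (simp add: cosets_in_def)
      show "\<forall>c\<in>cosets_in G \<Gamma> D - {\<Gamma> #> \<theta>}. 1 * t_vec G \<Gamma> \<pi> c \<theta> = 0"
        using coset_eq by (auto simp: cosets_in_def t_vec_def)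
    qed simp
    then show ?thesis using True \<theta> by (simp add: t_vec_def)
  qed (auto simp: t_vec_def cosets_in_def intro!: sum.neutral)
  ultimately show ?thesis by simp
qed

section \<open>Matrix entries of amplified operators and left convolution\<close>

sublocale amplification "rcosets \<Gamma>" "carrier G" \<Gamma> untwist
  by unfold_locales (rule untwist_unitary)

text \<open>By \<open>untwist_delta\<close>, each slice contributes the same coefficient of T,
  weighted by coordinates of \<pi>(g^-1) e and \<pi>(h^-1) e. Summing the weights over \<Gamma>
  gives the Gram entry t(h g^-1).\<close>

lemma amplify_matrix:
  assumes T: "T \<in> bounded_ops (rcosets \<Gamma>)" and g: "g \<in> carrier G" and h: "h \<in> carrier G"
  shows "amplify T (ell2_delta g) h = t (h \<otimes> inv g) * T (ell2_delta (\<Gamma> #> g)) (\<Gamma> #> h)"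
proof -
  let ?a = "\<pi> (inv g) vac" and ?b = "\<pi> (inv h) vac"
  let ?m = "T (ell2_delta (\<Gamma> #> g)) (\<Gamma> #> h)"
  have dg: "ell2_delta (\<Gamma> #> g) \<in> ell2 (rcosets \<Gamma>)" and hR: "\<Gamma> #> h \<in> rcosets \<Gamma>"
    using g h by (simp_all add: ell2_delta_mem)
  have in_eq: "ell2_inner (rcosets \<Gamma>) (T (\<lambda>c. untwist (ell2_delta g) (\<gamma>, c))) (\<lambda>c. untwist (ell2_delta h) (\<gamma>, c))
      = ?a \<gamma> * cnj (?b \<gamma>) * ?m" if \<gamma>: "\<gamma> \<in> \<Gamma>" for \<gamma>
  proof -
    \<comment> \<open>The inner product is flipped to extract the scalar from its conjugate-linear
      second argument.\<close>
    have "ell2_inner (rcosets \<Gamma>) (T (\<lambda>c. ?a \<gamma> * ell2_delta (\<Gamma> #> g) c)) (\<lambda>c. ?b \<gamma> * ell2_delta (\<Gamma> #> h) c)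
        = ?a \<gamma> * cnj (ell2_inner (rcosets \<Gamma>) (\<lambda>c. ?b \<gamma> * ell2_delta (\<Gamma> #> h) c) (T (ell2_delta (\<Gamma> #> g))))"
      unfolding linear_on_spaceD(2)[OF bounded_opsD(2)[OF T] dg]
        ell2_inner_scale_left[of _ "\<pi> (inv g) vac \<gamma>"]
      by (simp only: ell2_inner_cnj[symmetric])
    then show ?thesis
      using \<gamma> by (simp add: untwist_delta g h ell2_inner_scale_left ell2_inner_delta[OF hR])
  qed
  have "amplify T (ell2_delta g) h = ell2_inner (carrier G) (amplify T (ell2_delta g)) (ell2_delta h)"
    by (simp add: ell2_inner_delta_right h)
  also have "\<dots> = (\<Sum>\<^sub>\<infinity>\<gamma>\<in>\<Gamma>. ?a \<gamma> * cnj (?b \<gamma>) * ?m)"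
    unfolding amplify_inner[OF T ell2_delta_mem[OF g] ell2_delta_mem[OF h]]
    by (rule infsum_cong) (rule in_eq)
  also have "\<dots> = t (h \<otimes> inv g) * ?m"
    unfolding t_mult_inv[OF g h] ell2_inner_def by (rule infsum_cmult_left')
  finally show ?thesis .
qed

text \<open>For bounded T this is commutation with right translations of the coset space, written
  through coefficients so that it passes to weak limits.\<close>

definition translation_invariant :: "'a set ell2_op \<Rightarrow> bool" where
  "translation_invariant T \<longleftrightarrow> (\<forall>g\<in>carrier G. \<forall>h\<in>carrier G.
     T (ell2_delta (\<Gamma> #> g)) (\<Gamma> #> h) = T (ell2_delta \<Gamma>) (\<Gamma> #> (h \<otimes> inv g)))"

definition symbol :: "'a set ell2_op \<Rightarrow> 'a \<Rightarrow> complex" where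
  "symbol T = (\<lambda>z. if z \<in> carrier G then t z * T (ell2_delta \<Gamma>) (\<Gamma> #> z) else 0)"

lemma Gamma_one: "\<Gamma> #> \<one> = \<Gamma>"
  using Gamma_carrier by simp

lemma Gamma_coset: "\<Gamma> \<in> rcosets \<Gamma>"
  using coset_of[OF one_closed] by (simp add: Gamma_one)

text \<open>Identifies the symbol as a vector of \<open>ell2 (carrier G)\<close>, as membership in
  \<open>group_vn_algebra\<close> requires.\<close>

lemma amplify_vac:
  assumes T: "T \<in> bounded_ops (rcosets \<Gamma>)"
  shows "amplify T vac = symbol T"
proof
  fix z show "amplify T vac z = symbol T z"
  proof (cases "z \<in> carrier G")
    case True
    then show ?thesis using amplify_matrix[OF T one_closed True] by (simp add: Gamma_one symbol_def)
  next
    case False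
    then show ?thesis
      using ell2_outside[OF amplify_mem(1)[OF T ell2_delta_mem[OF one_closed]] False] by (simp add: symbol_def)
  qed
qed

lemma inv_mult_bij:
  assumes h: "h \<in> carrier G" shows "bij_betw (\<lambda>y. inv y \<otimes> h) (carrier G) (carrier G)"
proof (rule bij_betw_byWitness[where f' = "\<lambda>g. h \<otimes> inv g"])
  show "\<forall>y\<in>carrier G. h \<otimes> inv (inv y \<otimes> h) = y"
    using h by (simp add: inv_mult_group m_assoc[symmetric])
  show "\<forall>g\<in>carrier G. inv (h \<otimes> inv g) \<otimes> h = g"
    using h by (simp add: inv_mult_group m_assoc)
qed (use h in auto)

text \<open>Invariance makes the matrix entry at (g, h) the value of the symbol at h g^-1.
  Substituting g = y^-1 h in the matrix expansion gives convolution.\<close>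

lemma amplify_left_convolution:
  assumes T: "T \<in> bounded_ops (rcosets \<Gamma>)" and inv: "translation_invariant T"
  shows "amplify T = left_convolution G (symbol T)"
proof (rule extensionalityI[of _ "ell2 (carrier G)"])
  fix f assume f: "f \<in> ell2 (carrier G)"
  show "amplify T f = left_convolution G (symbol T) f"
  proof
    fix h show "amplify T f h = left_convolution G (symbol T) f h"
    proof (cases "h \<in> carrier G")
      case False
      then show ?thesis using ell2_outside[OF amplify_mem(1)[OF T f] False] f by (simp add: left_convolution_def)
    next
      case h: True
      have "amplify T f h = (\<Sum>\<^sub>\<infinity>g\<in>carrier G. f g * amplify T (ell2_delta g) h)"
        by (rule bounded_ops_matrix[OF amplify_bounded[OF T] f h])
      also have "\<dots> = (\<Sum>\<^sub>\<infinity>g\<in>carrier G. f g * symbol T (h \<otimes> inv g))"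
        using inv h by (intro infsum_cong)
          (simp add: amplify_matrix[OF T] symbol_def translation_invariant_def)
      also have "\<dots> = (\<Sum>\<^sub>\<infinity>y\<in>carrier G. f (inv y \<otimes> h) * symbol T (h \<otimes> inv (inv y \<otimes> h)))"
        by (rule infsum_reindex_bij_betw[OF inv_mult_bij[OF h], symmetric])
      also have "\<dots> = (\<Sum>\<^sub>\<infinity>y\<in>carrier G. symbol T y * f (inv y \<otimes> h))"
        using h by (intro infsum_cong) (simp add: inv_mult_group m_assoc[symmetric] mult.commute)
      finally show ?thesis using f h by (simp add: left_convolution_def)
    qed
  qed
qed (auto simp: amplify_def left_convolution_def)

lemma amplify_in_group_vn:
  assumes T: "T \<in> bounded_ops (rcosets \<Gamma>)" and inv: "translation_invariant T"
  shows "amplify T \<in> group_vn_algebra G"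
  unfolding group_vn_algebra_def
  using amplify_bounded[OF T] amplify_left_convolution[OF T inv]
    amplify_mem(1)[OF T ell2_delta_mem[OF one_closed]] amplify_vac[OF T] by auto

section \<open>The Hecke von Neumann algebra under amplification\<close>

text \<open>Double cosets are disjoint, so at most one term is nonzero: the entry is the coefficient
  of the double coset of h g^-1.\<close>

lemma hecke_rep_matrix:
  assumes a: "a \<in> hecke_algebra G \<Gamma>" and g: "g \<in> carrier G" and h: "h \<in> carrier G"
  shows "hecke_rep G \<Gamma> a (ell2_delta (\<Gamma> #> g)) (\<Gamma> #> h)
    = (\<Sum>D | a D \<noteq> 0. if h \<otimes> inv g \<in> D then a D else 0)"
proof -
  have dg: "ell2_delta (\<Gamma> #> g) \<in> ell2 (rcosets \<Gamma>)" using g by (simp add: ell2_delta_mem)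
  have "single_rep D (ell2_delta (\<Gamma> #> g)) (\<Gamma> #> h) = (if h \<otimes> inv g \<in> D then 1 else 0)"
    if D: "D \<in> double_cosets G \<Gamma>" for D
  proof -
    have "single_rep D (ell2_delta (\<Gamma> #> g)) (\<Gamma> #> h)
        = (\<Sum>c\<in>{c \<in> rcosets \<Gamma>. hecke_rel D c (\<Gamma> #> h)}. if c = \<Gamma> #> g then 1 else 0)"
      using h by (simp add: single_rep_def ell2_delta_def)
    also have "\<dots> = (if hecke_rel D (\<Gamma> #> g) (\<Gamma> #> h) then 1 else 0)"
      using card_rel_left(1)[OF D] g h by simp
    also have "hecke_rel D (\<Gamma> #> g) (\<Gamma> #> h) \<longleftrightarrow> h \<otimes> inv g \<in> D"
      using g h by (intro hecke_rel_iff D) auto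
    finally show ?thesis .
  qed
  then show ?thesis
    unfolding hecke_rep_single[OF a dg] using a
    by (intro sum.cong) (auto simp: hecke_algebra_def)
qed

lemma hecke_rep_invariant:
  assumes a: "a \<in> hecke_algebra G \<Gamma>" shows "translation_invariant (hecke_rep G \<Gamma> a)"
  unfolding translation_invariant_def
proof (intro ballI)
  fix g h assume g: "g \<in> carrier G" and h: "h \<in> carrier G"
  show "hecke_rep G \<Gamma> a (ell2_delta (\<Gamma> #> g)) (\<Gamma> #> h)
      = hecke_rep G \<Gamma> a (ell2_delta \<Gamma>) (\<Gamma> #> (h \<otimes> inv g))"
    using hecke_rep_matrix[OF a g h] hecke_rep_matrix[OF a one_closed, of "h \<otimes> inv g"] g h
    by (simp add: Gamma_one)
qed

lemma hecke_vn_bounded: "hecke_vn_algebra G \<Gamma> \<subseteq> bounded_ops (rcosets \<Gamma>)"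
  unfolding hecke_vn_algebra_def
  by (rule order_trans[OF closure_of_subset_topspace])
    (auto simp: weak_op_topology_def topspace_pullback_topology)

lemma hecke_rep_in_vn: "a \<in> hecke_algebra G \<Gamma> \<Longrightarrow> hecke_rep G \<Gamma> a \<in> hecke_vn_algebra G \<Gamma>"
proof -
  have "topspace (weak_op_topology (rcosets \<Gamma>)) = bounded_ops (rcosets \<Gamma>)"
    by (auto simp: weak_op_topology_def topspace_pullback_topology)
  then have "hecke_rep G \<Gamma> ` hecke_algebra G \<Gamma> \<subseteq> hecke_vn_algebra G \<Gamma>"
    unfolding hecke_vn_algebra_def using hecke_rep_bounded by (intro closure_of_subset) auto
  then show "a \<in> hecke_algebra G \<Gamma> \<Longrightarrow> hecke_rep G \<Gamma> a \<in> hecke_vn_algebra G \<Gamma>" by blast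
qed

text \<open>Each invariance equation compares two weakly continuous functionals, so it extends from
  the Hecke operators to their weak closure.\<close>

lemma hecke_vn_invariant:
  assumes T: "T \<in> hecke_vn_algebra G \<Gamma>" shows "translation_invariant T"
  unfolding translation_invariant_def
proof (intro ballI)
  fix g h assume g: "g \<in> carrier G" and h: "h \<in> carrier G"
  have cosets: "\<Gamma> #> g \<in> rcosets \<Gamma>" "\<Gamma> #> h \<in> rcosets \<Gamma>" "\<Gamma> #> (h \<otimes> inv g) \<in> rcosets \<Gamma>"
    using g h by simp_all
  have "ell2_inner (rcosets \<Gamma>) (T (ell2_delta (\<Gamma> #> g))) (ell2_delta (\<Gamma> #> h))
      = ell2_inner (rcosets \<Gamma>) (T (ell2_delta \<Gamma>)) (ell2_delta (\<Gamma> #> (h \<otimes> inv g)))"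
  proof (rule forall_in_closure_of_eq[OF T[unfolded hecke_vn_algebra_def], where Y = euclidean])
    fix S assume "S \<in> hecke_rep G \<Gamma> ` hecke_algebra G \<Gamma>"
    then have "translation_invariant S" using hecke_rep_invariant by blast
    then show "ell2_inner (rcosets \<Gamma>) (S (ell2_delta (\<Gamma> #> g))) (ell2_delta (\<Gamma> #> h))
      = ell2_inner (rcosets \<Gamma>) (S (ell2_delta \<Gamma>)) (ell2_delta (\<Gamma> #> (h \<otimes> inv g)))"
      using g h by (simp add: ell2_inner_delta_right cosets translation_invariant_def)
  qed (use cosets Gamma_coset in \<open>auto intro!: continuous_weak_functional ell2_delta_mem\<close>)
  then show "T (ell2_delta (\<Gamma> #> g)) (\<Gamma> #> h) = T (ell2_delta \<Gamma>) (\<Gamma> #> (h \<otimes> inv g))"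
    by (simp add: ell2_inner_delta_right cosets)
qed

lemma symbol_hecke_rep:
  assumes a: "a \<in> hecke_algebra G \<Gamma>" shows "symbol (hecke_rep G \<Gamma> a) = t_linear G \<Gamma> \<pi> a"
proof
  fix z
  have D: "D \<in> double_cosets G \<Gamma>" if "a D \<noteq> 0" for D using a that by (auto simp: hecke_algebra_def)
  show "symbol (hecke_rep G \<Gamma> a) z = t_linear G \<Gamma> \<pi> a z"
  proof (cases "z \<in> carrier G")
    case False
    then have "a D * t_vec G \<Gamma> \<pi> D z = 0" if "a D \<noteq> 0" for D
      using dcoset_carrier[OF D[OF that]] by (auto simp: t_vec_def)
    then show ?thesis using False by (auto simp: symbol_def t_linear_def intro!: sum.neutral[symmetric])
  next
    case True
    have "hecke_rep G \<Gamma> a (ell2_delta \<Gamma>) (\<Gamma> #> z) = (\<Sum>D | a D \<noteq> 0. if z \<in> D then a D else 0)"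
      using hecke_rep_matrix[OF a one_closed True] True by (simp add: Gamma_one)
    then show ?thesis
      using True by (auto simp: symbol_def t_linear_def t_vec_def sum_distrib_left intro!: sum.cong)
  qed
qed

text \<open>Both sides are the matrix entry at the identity, since t(1) = 1.\<close>

lemma amplify_trace:
  assumes T: "T \<in> bounded_ops (rcosets \<Gamma>)"
  shows "group_vn_trace G (amplify T) = hecke_state G \<Gamma> T"
proof -
  have "t \<one> = 1" by (simp add: t_coeff_def pi_one vac_mem ell2_inner_delta) (simp add: ell2_delta_def)
  then show ?thesis
    using amplify_matrix[OF T one_closed one_closed]
    by (simp add: group_vn_trace_def hecke_state_def ell2_inner_delta_right Gamma_coset Gamma_one)
qed

lemma amplify_star_hom:
  "unital_star_hom (rcosets \<Gamma>) (hecke_vn_algebra G \<Gamma>) (carrier G) (group_vn_algebra G) amplify"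
  using hecke_vn_bounded hecke_vn_invariant
  by (auto simp: unital_star_hom_def subset_iff amplify_plus amplify_scale amplify_comp
      amplify_adjoint amplify_id intro!: amplify_in_group_vn)

end

section \<open>Assembly of the final statement\<close>

theorem theorem19:
  fixes G :: "('a, 'b) monoid_scheme" and \<Gamma> :: "'a set" and \<pi> :: "'a \<Rightarrow> 'a ell2_op"
  assumes "group G" and "subgroup \<Gamma> G" and "almost_normal G \<Gamma>"
    and "\<pi> \<in> hom G (unitary_group \<Gamma>)"
    and "\<forall>\<gamma>\<in>\<Gamma>. \<pi> \<gamma> = left_regular G \<Gamma> \<gamma>"
  shows "(\<forall>D\<in>double_cosets G \<Gamma>. t_vec G \<Gamma> \<pi> D \<in> ell2 D \<and> ell2 D \<subseteq> ell2 (carrier G)) \<and>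
    (\<exists>\<rho>.
      unital_star_hom (rcosets\<^bsub>G\<^esub> \<Gamma>) (hecke_vn_algebra G \<Gamma>) (carrier G) (group_vn_algebra G) \<rho> \<and>
      normal_map (rcosets\<^bsub>G\<^esub> \<Gamma>) (hecke_vn_algebra G \<Gamma>) (carrier G) (group_vn_algebra G) \<rho> \<and>
      inj_on \<rho> (hecke_vn_algebra G \<Gamma>) \<and>
      (\<forall>a\<in>hecke_algebra G \<Gamma>.
         \<rho> (hecke_rep G \<Gamma> a) = left_convolution G (t_linear G \<Gamma> \<pi> a)) \<and>
      (\<forall>x\<in>hecke_vn_algebra G \<Gamma>. group_vn_trace G (\<rho> x) = hecke_state G \<Gamma> x) \<and>
      (\<forall>c\<in>rcosets\<^bsub>G\<^esub> \<Gamma>. t_vec G \<Gamma> \<pi> c \<in> ell2 c) \<and>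
      (\<forall>c\<in>rcosets\<^bsub>G\<^esub> \<Gamma>. \<forall>d\<in>rcosets\<^bsub>G\<^esub> \<Gamma>.
         ell2_inner (carrier G) (t_vec G \<Gamma> \<pi> c) (t_vec G \<Gamma> \<pi> d) = (if c = d then 1 else 0)) \<and>
      (\<exists>K. K = ell2_closed_span (carrier G) (t_vec G \<Gamma> \<pi> ` (rcosets\<^bsub>G\<^esub> \<Gamma>)) \<and>
         reducing_subspace (carrier G) (hecke_vn_algebra G \<Gamma>) \<rho> K \<and>
         (\<exists>U. unitary_between (carrier G) K (rcosets\<^bsub>G\<^esub> \<Gamma>) (ell2 (rcosets\<^bsub>G\<^esub> \<Gamma>)) U \<and>
            (\<forall>c\<in>rcosets\<^bsub>G\<^esub> \<Gamma>. U (t_vec G \<Gamma> \<pi> c) = ell2_delta c) \<and>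
            (\<forall>a\<in>hecke_algebra G \<Gamma>. \<forall>f\<in>K.
               U (\<rho> (hecke_rep G \<Gamma> a) f) = hecke_rep G \<Gamma> a (U f)) \<and>
            (\<forall>x\<in>hecke_vn_algebra G \<Gamma>. \<forall>f\<in>K. U (\<rho> x f) = x (U f)))))"
proof -
  interpret regular_extension G \<Gamma> \<pi>
    using assms by (simp add: regular_extension_def regular_extension_axioms_def hecke_pair_def
        hecke_pair_axioms_def)
  let ?R = "rcosets\<^bsub>G\<^esub> \<Gamma>" and ?H = "hecke_vn_algebra G \<Gamma>"
  \<comment> \<open>The coset vectors are sent to the point masses at (1, c), so their closed span
    is the fibre over the identity of \<Gamma>.\<close>
  have K: "ell2_closed_span (carrier G) (t_vec G \<Gamma> \<pi> ` ?R) = fibre \<one>\<^bsub>G\<^esub>"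
    by (intro closed_span_fibre t_vec_coset_carrier untwist_t_vec Gamma_closed)
  have sub: "ell2 D \<subseteq> ell2 (carrier G)" if "D \<in> double_cosets G \<Gamma>" for D
    using dcoset_carrier[OF that] by (intro ell2_mono) blast
  \<comment> \<open>On this fibre the slice at 1 is the required unitary; it intertwines because
    amplification acts on each slice as the original operator.\<close>
  define U where "U = (\<lambda>f c. untwist f (\<one>\<^bsub>G\<^esub>, c))"
  have U: "U (amplify x f) = x (U f)" if "x \<in> ?H" "f \<in> fibre \<one>\<^bsub>G\<^esub>" for x f
    unfolding U_def using that hecke_vn_bounded by (intro W_amplify_slice) (auto simp: fibre_def)
  have hecke: "amplify (hecke_rep G \<Gamma> a) = left_convolution G (t_linear G \<Gamma> \<pi> a)"
    if "a \<in> hecke_algebra G \<Gamma>" for a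
    using amplify_left_convolution[OF hecke_rep_bounded[OF that] hecke_rep_invariant[OF that]]
    by (simp add: symbol_hecke_rep[OF that])
  show ?thesis
  proof (intro conjI exI[of _ amplify] exI[of _ "fibre \<one>\<^bsub>G\<^esub>"] exI[of _ U] ballI)
    show "normal_map ?R ?H (carrier G) (group_vn_algebra G) amplify"
      using hecke_vn_bounded hecke_vn_invariant
      by (intro amplify_normal) (auto intro!: amplify_in_group_vn)
    show "inj_on amplify ?H"
      using amplify_inj[OF Gamma_closed(1)] hecke_vn_bounded by (rule inj_on_subset)
    show "group_vn_trace G (amplify x) = hecke_state G \<Gamma> x" if "x \<in> ?H" for x
      using amplify_trace hecke_vn_bounded that by blast
    show "reducing_subspace (carrier G) ?H amplify (fibre \<one>\<^bsub>G\<^esub>)"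
      by (rule reducing_fibre[OF hecke_vn_bounded])
    show "unitary_between (carrier G) (fibre \<one>\<^bsub>G\<^esub>) ?R (ell2 ?R) U"
      unfolding U_def by (rule unitary_fibre[OF Gamma_closed(1)])
    show "U (t_vec G \<Gamma> \<pi> c) = ell2_delta c" if "c \<in> ?R" for c
      using untwist_t_vec[OF that] by (auto simp: U_def ell2_delta_def)
    show "U (amplify (hecke_rep G \<Gamma> a) f) = hecke_rep G \<Gamma> a (U f)"
      if "a \<in> hecke_algebra G \<Gamma>" "f \<in> fibre \<one>\<^bsub>G\<^esub>" for a f
      by (rule U[OF hecke_rep_in_vn[OF that(1)] that(2)])
  qed (use K sub U hecke in \<open>simp_all add: t_vec_dcoset_mem t_vec_coset_mem t_vec_orthonormal
        amplify_star_hom\<close>)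
qed

end
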